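(* Let $M\subset\mathbb{R}^d$ be a polyhedral model set. Then $$H^1_{repr}(M,\mathbb{R})=H^1_{ns}(M,\mathbb{R})=H^1_{an}(M,\mathbb{R}).$$
   Context: Model sets. A cut and project scheme $(\Gamma,H,\mathbb{R}^d)$ consists of a locally compact abelian group $H$ and a lattice (discrete cocompact subgroup) $\Gamma\subset H\times\mathbb{R}^d$ such that the projection $\pi^\|:H\times\mathbb{R}^d\to\mathbb{R}^d$ is injective on $\Gamma$ and the projection $\pi^\perp:H\times\mathbb{R}^d\to H$ maps $\Gamma$ densely into $H$. A window is a compact set $W\subset H$ that is the closure of its interior and satisfies: $W+h=W$ implies $h=0$. For $\xi\in (H\times\mathbb{R}^d)/\Gamma$ put $\curlywedge_\xi(W)=\{\pi^\|(\gamma):\gamma\in\Gamma+\xi,\ \pi^\perp(\gamma)\in W\}$; $\xi$ is non-singular if $\pi^\perp(\Gamma+\xi)\cap\partial W=\emptyset$. The hull $\Omega_\Lambda$ of a Delone set $\Lambda$ is the closure of $\{\Lambda-x:x\in\mathbb{R}^d\}$ in a metric in which two Delone sets are close if they agree exactly on a large ball around the origin up to a small translation. The hull of $\curlywedge_\xi(W)$, $\xi$ non-singular, is independent of such $\xi$ and is denoted $\Omega(W)$; a model set with window $W$ is any element of $\Omega(W)$. The map $\curlywedge_\xi(W)\mapsto\xi$ ($\xi$ non-singular) extends to a continuous map $\pi_{max}:\Omega(W)\to(H\times\mathbb{R}^d)/\Gamma$, which is the maximal equicontinuous factor map. A model set is polyhedral if $H=\mathbb{R}^n$ and $W$ is a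 finite disjoint union of polyhedra. The star map $\sigma_M:M\to H$ is defined by $(\sigma_M(x),x)\in\Gamma+\pi_{max}(M)$ for $x\in M$. Pattern equivariance. Let $Y$ be an abelian group (with a metric where needed) and let $\Xi$ be the closure in $\Omega_M$ of $\{M-x:x\in M\}$. $F:M\to Y$ is strongly pattern equivariant (s.p.e.) if there is $R>0$ such that $F(x_1)=F(x_2)$ whenever $x_1,x_2\in M$ and $M-x_1$, $M-x_2$ agree on $B_R(0)$. $F:M\to Y$ is weakly pattern equivariant (w.p.e.) if there is a continuous $\tilde F:\Xi\to Y$ with $F(x)=\tilde F(M-x)$ for all $x\in M$. The coboundary of $F$ is $\delta F(x,y)=F(y)-F(x)$. A function $\Psi:M\times M\to Y$ is s.p.e. if for some $R_0$, large enough that every ball of radius $R_0/3$ contains a point of $M$, there is $R>0$ such that $\Psi(x_1,y_1)=\Psi(x_2,y_2)$ whenever $|y_i-x_i|\le R_0$, $y_1-x_1=y_2-x_2$ and $M-x_1,M-x_2$ agree on $B_R(0)$. A w.p.e. $F:M\to Y$ is nonslip if there is $\epsilon>0$ such that for all $M_1,M_2\in\Xi$ with $\pi_{max}(M_1)=\pi_{max}(M_2)$ that agree on $B_{1/\epsilon}(0)$ one has $\tilde F(M_1)=\tilde F(M_2)$. Cohomology. $H^1(M,Y)$ is the group of s.p.e. 1-cocycles with values in $Y$, modulo coboundaries of s.p.e. 0-cochains $M\to Y$, on the CW-complex in $\mathbb{R}^d$ with vertex set $M$ dual to the Voronoi complex of $M$. (Every 1-cocycle is of the form $\delta F$, restricted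 to edges, for some $F:M\to Y$.) Subgroups of $H^1(M,\mathbb{R})$: - $H^1_{an}(M,\mathbb{R})$: classes $[\delta F]$ with $F:M\to\mathbb{R}$ w.p.e. and $\delta F$ s.p.e.; - $H^1_{ns}(M,\mathbb{R})$: classes $[\delta F]$ with $F:M\to\mathbb{R}$ nonslip (in particular w.p.e.) and $\delta F$ s.p.e.; - $H^1_{repr}(M,\mathbb{R})$: classes $[\delta(L\circ\sigma_M)]$ with $L:H\to\mathbb{R}$ a continuous group homomorphism. *)

theory Defs
  imports "HOL-Analysis.Analysis"
begin

section \<open>Delone sets, the hull and the transversal\<close>

definition shift :: "'d::euclidean_space set \<Rightarrow> 'd \<Rightarrow> 'd set" where
  "shift A x = (\<lambda>z. z - x) ` A"

definition agree :: "real \<Rightarrow> 'd::euclidean_space set \<Rightarrow> 'd set \<Rightarrow> bool" where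
  "agree R A B \<longleftrightarrow> A \<inter> ball 0 R = B \<inter> ball 0 R"

definition delone :: "'d::euclidean_space set \<Rightarrow> bool" where
  "delone A \<longleftrightarrow> uniform_discrete A \<and> (\<exists>R>0. \<forall>z. \<exists>x\<in>A. dist z x \<le> R)"

definition close_patterns :: "real \<Rightarrow> 'd::euclidean_space set \<Rightarrow> 'd set \<Rightarrow> bool" where
  "close_patterns \<epsilon> A B \<longleftrightarrow>
     (\<exists>u v. norm u < \<epsilon> \<and> norm v < \<epsilon> \<and> agree (1 / \<epsilon>) (shift A u) (shift B v))"

text \<open>The cut-off at 1 makes the triangle inequality hold; it does not affect small distances.\<close>

definition delone_dist :: "'d::euclidean_space set \<Rightarrow> 'd set \<Rightarrow> real" where
  "delone_dist A B = Inf (insert 1 {\<epsilon>. 0 < \<epsilon> \<and> close_patterns \<epsilon> A B})"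

definition delone_topology :: "'d::euclidean_space set topology" where
  "delone_topology = Metric_space.mtopology (Collect delone) delone_dist"

definition hull_of :: "'d::euclidean_space set \<Rightarrow> 'd set set" where
  "hull_of A = delone_topology closure_of range (shift A)"

definition transversal :: "'d::euclidean_space set \<Rightarrow> 'd set set" where
  "transversal M = subtopology delone_topology (hull_of M) closure_of (shift M ` M)"

lemma in_shift_iff: "z \<in> shift A x \<longleftrightarrow> z + x \<in> A"
proof
  assume "z + x \<in> A"
  then have "(z + x) - x \<in> shift A x" unfolding shift_def by (rule imageI)
  then show "z \<in> shift A x" by simp
qed (auto simp: shift_def)

lemma agree_iff: "agree R A B \<longleftrightarrow> (\<forall>z. norm z < R \<longrightarrow> (z \<in> A \<longleftrightarrow> z \<in> B))"
  unfolding agree_def set_eq_iff Int_iff mem_ball_0 by blast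

lemma close_patterns_sym: "close_patterns e A B \<Longrightarrow> close_patterns e B A"
  unfolding close_patterns_def agree_def by metis

lemma close_patterns_refl: "0 < e \<Longrightarrow> close_patterns e A A"
  unfolding close_patterns_def agree_def by (intro exI[of _ 0]) auto

lemma close_patterns_triangle:
  assumes "close_patterns a A B" "close_patterns b B C" "0 < a" "0 < b" "a + b \<le> 1"
  shows "close_patterns (a + b) A C"
proof -
  obtain u v where uv: "norm u < a" "norm v < a"
    and AB: "\<And>z. norm z < 1 / a \<Longrightarrow> z + u \<in> A \<longleftrightarrow> z + v \<in> B"
    using assms(1) by (auto simp: close_patterns_def agree_iff in_shift_iff)
  obtain s t where st: "norm s < b" "norm t < b"
    and BC: "\<And>z. norm z < 1 / b \<Longrightarrow> z + s \<in> B \<longleftrightarrow> z + t \<in> C"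
    using assms(2) by (auto simp: close_patterns_def agree_iff in_shift_iff)
  have ab: "a * (a + b) \<le> 1" "b * (a + b) \<le> 1"
    using assms by (auto intro!: mult_le_one)
  have 1: "1 / (a + b) + b \<le> 1 / a"
  proof -
    have "b * (a * (a + b)) \<le> b" using ab assms by (simp add: mult_left_le)
    then show ?thesis using assms by (simp add: field_simps)
  qed
  have 2: "1 / (a + b) + a \<le> 1 / b"
  proof -
    have "a * (b * (a + b)) \<le> a" using ab assms by (simp add: mult_left_le)
    then show ?thesis using assms by (simp add: field_simps)
  qed
  have "z + (u + s) \<in> A \<longleftrightarrow> z + (v + t) \<in> C" if z: "norm z < 1 / (a + b)" for z
  proof -
    have "norm (z + s) < 1 / a"
      using norm_triangle_ineq[of z s] st z 1 by linarith
    moreover have "norm (z + v) < 1 / b"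
      using norm_triangle_ineq[of z v] uv z 2 by linarith
    ultimately show ?thesis
      using AB[of "z + s"] BC[of "z + v"] by (simp add: algebra_simps)
  qed
  moreover have "norm (u + s) < a + b" "norm (v + t) < a + b"
    using norm_triangle_ineq[of u s] norm_triangle_ineq[of v t] uv st by linarith+
  ultimately show ?thesis
    unfolding close_patterns_def agree_iff in_shift_iff by blast
qed

lemma delone_dist_less:
  assumes "delone_dist A B < e" "e \<le> 1"
  obtains a where "0 < a" "a < e" "close_patterns a A B"
proof -
  have "\<exists>x\<in>insert 1 {\<epsilon>. 0 < \<epsilon> \<and> close_patterns \<epsilon> A B}. x < e"
    using assms(1) unfolding delone_dist_def
    by (subst (asm) cInf_less_iff) (auto intro!: bdd_belowI[of _ 0])
  then show ?thesis using assms(2) that by auto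
qed

lemma delone_dist_le: "0 < e \<Longrightarrow> close_patterns e A B \<Longrightarrow> delone_dist A B \<le> e"
  unfolding delone_dist_def by (intro cInf_lower bdd_belowI[of _ 0]) auto

lemma delone_dist_le_1: "delone_dist A B \<le> 1"
  unfolding delone_dist_def by (intro cInf_lower bdd_belowI[of _ 0]) auto

lemma delone_dist_nonneg: "0 \<le> delone_dist A B"
  unfolding delone_dist_def by (intro cInf_greatest) auto

lemma delone_dist_sym: "delone_dist A B = delone_dist B A"
  unfolding delone_dist_def using close_patterns_sym by metis

lemma delone_dist_0_subset:
  assumes "delone_dist A B = 0" "closed B"
  shows "A \<subseteq> B"
proof
  fix p assume p: "p \<in> A"
  have "\<exists>q\<in>B. dist q p < e" if "0 < e" for e
  proof -
    have np: "0 < norm p + 1" by (rule add_nonneg_pos) auto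
    define e' where "e' = min (e / 2) (min (1 / (norm p + 1)) 1)"
    have "0 < 1 / (norm p + 1)" using np by simp
    then have e': "0 < e'" "e' \<le> e / 2" "e' \<le> 1 / (norm p + 1)" "e' \<le> 1"
      using \<open>0 < e\<close> unfolding e'_def by linarith+
    have "delone_dist A B < e'" using assms(1) e'(1) by simp
    then obtain a where a: "0 < a" "a < e'" "close_patterns a A B"
      by (rule delone_dist_less[OF _ e'(4)])
    then obtain u v where uv: "norm u < a" "norm v < a"
      and AB: "\<And>z. norm z < 1 / a \<Longrightarrow> z + u \<in> A \<longleftrightarrow> z + v \<in> B"
      by (auto simp: close_patterns_def agree_iff in_shift_iff)
    have "norm p + 1 \<le> 1 / e'"
      using e'(3) unfolding le_divide_eq using np e'(1) by (simp add: mult.commute)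
    also have "1 / e' < 1 / a" using a(1,2) by (intro divide_strict_left_mono) auto
    finally have "norm p + 1 < 1 / a" .
    moreover have "norm (p - u) \<le> norm p + norm u" by (rule norm_triangle_ineq4)
    ultimately have "norm (p - u) < 1 / a" using uv a e' by linarith
    then have "p - u + v \<in> B" using AB[of "p - u"] p by simp
    moreover have "dist (p - u + v) p < e"
      using norm_triangle_ineq4[of v u] uv a e' by (simp add: dist_norm algebra_simps)
    ultimately show ?thesis by blast
  qed
  then have "p \<in> closure B" by (simp add: closure_approachable)
  then show "p \<in> B" using assms(2) by simp
qed

lemma Metric_space_delone: "Metric_space (Collect delone) delone_dist"
proof
  fix A B C :: "'a set"
  show "0 \<le> delone_dist A B" by (rule delone_dist_nonneg)
  show "delone_dist A B = delone_dist B A" by (rule delone_dist_sym)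
  show "delone_dist A B = 0 \<longleftrightarrow> A = B" if "A \<in> Collect delone" "B \<in> Collect delone"
  proof
    assume "delone_dist A B = 0"
    moreover have "closed A" "closed B"
      using that uniform_discrete_imp_closed by (auto simp: delone_def)
    ultimately show "A = B"
      using delone_dist_0_subset[of A B] delone_dist_0_subset[of B A]
      by (auto simp: delone_dist_sym)
  next
    assume "A = B"
    then have "delone_dist A B \<le> e" if "0 < e" for e
      using that delone_dist_le close_patterns_refl by metis
    then have "delone_dist A B \<le> 0" by (rule dense_ge)
    then show "delone_dist A B = 0" using delone_dist_nonneg[of A B] by simp
  qed
  show "delone_dist A C \<le> delone_dist A B + delone_dist B C"
  proof (rule ccontr)
    assume *: "\<not> ?thesis"
    define g where "g = (delone_dist A C - delone_dist A B - delone_dist B C) / 2"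
    have g: "0 < g" using * by (simp add: g_def)
    have g2: "2 * g = delone_dist A C - delone_dist A B - delone_dist B C" by (simp add: g_def)
    have AC: "delone_dist A C \<le> 1" by (rule delone_dist_le_1)
    have nn: "0 \<le> delone_dist A B" "0 \<le> delone_dist B C" by (rule delone_dist_nonneg)+
    have le: "delone_dist A B + g \<le> 1" "delone_dist B C + g \<le> 1"
      using AC g g2 nn by linarith+
    have "delone_dist A B < delone_dist A B + g" using g by simp
    then obtain a where a: "0 < a" "a < delone_dist A B + g" "close_patterns a A B"
      by (rule delone_dist_less[OF _ le(1)])
    have "delone_dist B C < delone_dist B C + g" using g by simp
    then obtain b where b: "0 < b" "b < delone_dist B C + g" "close_patterns b B C"
      by (rule delone_dist_less[OF _ le(2)])
    have lt: "a + b < delone_dist A C" using a(2) b(2) g2 by linarith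
    then have "close_patterns (a + b) A C"
      using close_patterns_triangle[OF a(3) b(3) a(1) b(1)] AC by simp
    then have "delone_dist A C \<le> a + b" by (rule delone_dist_le[OF add_pos_pos[OF a(1) b(1)]])
    then show False using lt by simp
  qed
qed

section \<open>Cut and project schemes and model sets\<close>

definition discrete_subgroup :: "'g::{topological_space, ab_group_add} set \<Rightarrow> bool" where
  "discrete_subgroup \<Gamma> \<longleftrightarrow>
     0 \<in> \<Gamma> \<and> (\<forall>a\<in>\<Gamma>. \<forall>b\<in>\<Gamma>. a - b \<in> \<Gamma>) \<and> discrete \<Gamma>"

text \<open>Cosets are represented as sets, so that the set written \<open>\<Gamma> + \<xi>\<close> is \<open>\<xi>\<close> itself.\<close>

definition coset_of :: "'g::ab_group_add set \<Rightarrow> 'g \<Rightarrow> 'g set" where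
  "coset_of \<Gamma> x = (\<lambda>\<gamma>. \<gamma> + x) ` \<Gamma>"

definition torus :: "'g::ab_group_add set \<Rightarrow> 'g set set" where
  "torus \<Gamma> = range (coset_of \<Gamma>)"

definition torus_topology :: "'g::{topological_space, ab_group_add} set \<Rightarrow> 'g set topology" where
  "torus_topology \<Gamma> = topology (\<lambda>U. U \<subseteq> torus \<Gamma> \<and> open (coset_of \<Gamma> -` U))"

lemma openin_torus_topology:
  "openin (torus_topology \<Gamma>) U \<longleftrightarrow> U \<subseteq> torus \<Gamma> \<and> open (coset_of \<Gamma> -` U)"
proof -
  have "istopology (\<lambda>U. U \<subseteq> torus \<Gamma> \<and> open (coset_of \<Gamma> -` U))"
    unfolding istopology_def by (auto simp: vimage_Union)
  then show ?thesis unfolding torus_topology_def by simp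
qed

lemma topspace_torus_topology [simp]: "topspace (torus_topology \<Gamma>) = torus \<Gamma>"
proof -
  have "coset_of \<Gamma> -` torus \<Gamma> = UNIV" by (auto simp: torus_def)
  then have "openin (torus_topology \<Gamma>) (torus \<Gamma>)"
    by (auto simp: openin_torus_topology)
  then show ?thesis
    by (meson openin_subset openin_topspace openin_torus_topology subset_antisym)
qed

lemma quotient_map_torus: "quotient_map euclidean (torus_topology \<Gamma>) (coset_of \<Gamma>)"
  by (auto simp: quotient_map_def openin_torus_topology torus_def vimage_def)

definition cut_and_project_scheme ::
  "('h::{topological_ab_group_add, t2_space} \<times> 'd::euclidean_space) set \<Rightarrow> bool" where
  "cut_and_project_scheme \<Gamma> \<longleftrightarrow>
     locally_compact_space (euclidean :: 'h topology) \<and>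
     discrete_subgroup \<Gamma> \<and> compact_space (torus_topology \<Gamma>) \<and>
     inj_on snd \<Gamma> \<and> closure (fst ` \<Gamma>) = UNIV"

definition is_window :: "'h::{topological_space, ab_group_add} set \<Rightarrow> bool" where
  "is_window W \<longleftrightarrow>
     compact W \<and> W = closure (interior W) \<and> (\<forall>h. (\<lambda>w. w + h) ` W = W \<longrightarrow> h = 0)"

definition cut_project :: "'h set \<Rightarrow> ('h \<times> 'd) set \<Rightarrow> 'd set" where
  "cut_project W \<xi> = snd ` {\<gamma> \<in> \<xi>. fst \<gamma> \<in> W}"

definition nonsingular ::
  "('h::{topological_space, ab_group_add} \<times> 'd::ab_group_add) set \<Rightarrow> 'h set \<Rightarrow> ('h \<times> 'd) set \<Rightarrow> bool" where
  "nonsingular \<Gamma> W \<xi> \<longleftrightarrow> \<xi> \<in> torus \<Gamma> \<and> fst ` \<xi> \<inter> frontier W = {}"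

text \<open>The hull is the same for all nonsingular \<open>\<xi>\<close>, so the union is that common hull.\<close>

definition model_hull ::
  "('h::{topological_ab_group_add, t2_space} \<times> 'd::euclidean_space) set \<Rightarrow> 'h set \<Rightarrow> 'd set set" where
  "model_hull \<Gamma> W = (\<Union>\<xi>\<in>Collect (nonsingular \<Gamma> W). hull_of (cut_project W \<xi>))"

text \<open>Uniqueness holds because the nonsingular model sets are dense in the hull and the torus is
  Hausdorff.\<close>

definition pi_max ::
  "('h::{topological_ab_group_add, t2_space} \<times> 'd::euclidean_space) set \<Rightarrow> 'h set
    \<Rightarrow> 'd set \<Rightarrow> ('h \<times> 'd) set" where
  "pi_max \<Gamma> W = (THE p. p \<in> extensional (model_hull \<Gamma> W) \<and>
      continuous_map (subtopology delone_topology (model_hull \<Gamma> W)) (torus_topology \<Gamma>) p \<and>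
      (\<forall>\<xi>. nonsingular \<Gamma> W \<xi> \<longrightarrow> p (cut_project W \<xi>) = \<xi>))"

definition star_map ::
  "('h::{topological_ab_group_add, t2_space} \<times> 'd::euclidean_space) set \<Rightarrow> 'h set
    \<Rightarrow> 'd set \<Rightarrow> 'd \<Rightarrow> 'h" where
  "star_map \<Gamma> W M x = (THE h. (h, x) \<in> pi_max \<Gamma> W M)"

text \<open>Polyhedra are compact and need not be convex (unlike \<^const>\<open>polyhedron\<close>).\<close>

definition compact_polyhedron :: "'h::euclidean_space set \<Rightarrow> bool" where
  "compact_polyhedron P \<longleftrightarrow> (\<exists>\<Q>. finite \<Q> \<and> (\<forall>Q\<in>\<Q>. polytope Q) \<and> P = \<Union>\<Q>)"

definition polyhedral_window :: "'h::euclidean_space set \<Rightarrow> bool" where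
  "polyhedral_window W \<longleftrightarrow>
     is_window W \<and>
     (\<exists>\<P>. finite \<P> \<and> disjoint \<P> \<and> (\<forall>P\<in>\<P>. compact_polyhedron P) \<and> W = \<Union>\<P>)"

definition polyhedral_model_set ::
  "('h::euclidean_space \<times> 'd::euclidean_space) set \<Rightarrow> 'h set \<Rightarrow> 'd set \<Rightarrow> bool" where
  "polyhedral_model_set \<Gamma> W M \<longleftrightarrow>
     cut_and_project_scheme \<Gamma> \<and> polyhedral_window W \<and> M \<in> model_hull \<Gamma> W"

section \<open>Pattern equivariance\<close>

text \<open>Functions on \<open>M\<close> are total functions of which only the values on \<open>M\<close> matter.\<close>

definition spe :: "'d::euclidean_space set \<Rightarrow> ('d \<Rightarrow> 'y) \<Rightarrow> bool" where
  "spe M F \<longleftrightarrow>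
     (\<exists>R>0. \<forall>x1\<in>M. \<forall>x2\<in>M. agree R (shift M x1) (shift M x2) \<longrightarrow> F x1 = F x2)"

definition wpe_ext ::
  "'d::euclidean_space set \<Rightarrow> ('d \<Rightarrow> 'y::topological_space) \<Rightarrow> ('d set \<Rightarrow> 'y) \<Rightarrow> bool" where
  "wpe_ext M F Ft \<longleftrightarrow>
     continuous_map (subtopology delone_topology (transversal M)) euclidean Ft \<and>
     (\<forall>x\<in>M. F x = Ft (shift M x))"

definition wpe :: "'d::euclidean_space set \<Rightarrow> ('d \<Rightarrow> 'y::topological_space) \<Rightarrow> bool" where
  "wpe M F \<longleftrightarrow> (\<exists>Ft. wpe_ext M F Ft)"

definition nonslip ::
  "('h::{topological_ab_group_add, t2_space} \<times> 'd::euclidean_space) set \<Rightarrow> 'h set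
    \<Rightarrow> 'd set \<Rightarrow> ('d \<Rightarrow> 'y::topological_space) \<Rightarrow> bool" where
  "nonslip \<Gamma> W M F \<longleftrightarrow>
     (\<exists>Ft. wpe_ext M F Ft \<and>
       (\<exists>\<epsilon>>0. \<forall>M1\<in>transversal M. \<forall>M2\<in>transversal M.
          pi_max \<Gamma> W M1 = pi_max \<Gamma> W M2 \<and> agree (1 / \<epsilon>) M1 M2 \<longrightarrow> Ft M1 = Ft M2))"

definition delta :: "('d \<Rightarrow> 'y::ab_group_add) \<Rightarrow> 'd \<Rightarrow> 'd \<Rightarrow> 'y" where
  "delta F x y = F y - F x"

definition spe2 :: "'d::euclidean_space set \<Rightarrow> ('d \<Rightarrow> 'd \<Rightarrow> 'y) \<Rightarrow> bool" where
  "spe2 M \<Psi> \<longleftrightarrow>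
     (\<exists>R0. (\<forall>z. \<exists>x\<in>M. dist z x \<le> R0 / 3) \<and>
       (\<exists>R>0. \<forall>x1\<in>M. \<forall>y1\<in>M. \<forall>x2\<in>M. \<forall>y2\<in>M.
          norm (y1 - x1) \<le> R0 \<and> norm (y2 - x2) \<le> R0 \<and> y1 - x1 = y2 - x2 \<and>
          agree R (shift M x1) (shift M x2) \<longrightarrow> \<Psi> x1 y1 = \<Psi> x2 y2))"

section \<open>Cohomology of the complex dual to the Voronoi complex\<close>

definition voronoi_cell :: "'d::euclidean_space set \<Rightarrow> 'd \<Rightarrow> 'd set" where
  "voronoi_cell M x = {z. \<forall>y\<in>M. dist z x \<le> dist z y}"

definition dual_edges :: "'d::euclidean_space set \<Rightarrow> ('d \<times> 'd) set" where
  "dual_edges M = {(x, y). x \<in> M \<and> y \<in> M \<and> x \<noteq> y \<and>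
     aff_dim (voronoi_cell M x \<inter> voronoi_cell M y) = int DIM('d) - 1}"

text \<open>A 2-cell is dual to a Voronoi face \<open>E\<close> of codimension 2; it is represented by its set of
  vertices, the points of \<open>M\<close> whose Voronoi cells contain \<open>E\<close>.  The condition \<open>E \<noteq> {}\<close> is needed
  in dimension 1, where \<open>aff_dim {} = -1\<close>.\<close>

definition dual_2cells :: "'d::euclidean_space set \<Rightarrow> 'd set set" where
  "dual_2cells M = {S. \<exists>E. S = {x \<in> M. E \<subseteq> voronoi_cell M x} \<and> S \<noteq> {} \<and>
     E = (\<Inter>x\<in>S. voronoi_cell M x) \<and> E \<noteq> {} \<and> aff_dim E = int DIM('d) - 2}"

text \<open>A 1-cochain is an alternating function of oriented edges, set to 0 off the edges.\<close>

definition cochain1 :: "'d::euclidean_space set \<Rightarrow> ('d \<times> 'd \<Rightarrow> 'y::ab_group_add) \<Rightarrow> bool" where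
  "cochain1 M \<psi> \<longleftrightarrow>
     (\<forall>e. e \<notin> dual_edges M \<longrightarrow> \<psi> e = 0) \<and>
     (\<forall>(x, y)\<in>dual_edges M. \<psi> (y, x) = - \<psi> (x, y))"

text \<open>The sequence \<open>p\<close> runs once around the boundary of the 2-cell.\<close>

definition closed1 :: "'d::euclidean_space set \<Rightarrow> ('d \<times> 'd \<Rightarrow> 'y::ab_group_add) \<Rightarrow> bool" where
  "closed1 M \<psi> \<longleftrightarrow>
     (\<forall>S\<in>dual_2cells M. \<forall>k p. bij_betw p {..<k} S \<and> p k = p 0 \<and>
        (\<forall>i<k. (p i, p (Suc i)) \<in> dual_edges M) \<longrightarrow>
        (\<Sum>i<k. \<psi> (p i, p (Suc i))) = 0)"

definition spe_cochain1 :: "'d::euclidean_space set \<Rightarrow> ('d \<times> 'd \<Rightarrow> 'y) \<Rightarrow> bool" where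
  "spe_cochain1 M \<psi> \<longleftrightarrow>
     (\<exists>R>0. \<forall>(x1, y1)\<in>dual_edges M. \<forall>(x2, y2)\<in>dual_edges M.
        y1 - x1 = y2 - x2 \<and> agree R (shift M x1) (shift M x2) \<longrightarrow> \<psi> (x1, y1) = \<psi> (x2, y2))"

definition Z1 :: "'d::euclidean_space set \<Rightarrow> ('d \<times> 'd \<Rightarrow> 'y::ab_group_add) set" where
  "Z1 M = {\<psi>. cochain1 M \<psi> \<and> closed1 M \<psi> \<and> spe_cochain1 M \<psi>}"

definition edge_restrict ::
  "'d::euclidean_space set \<Rightarrow> ('d \<Rightarrow> 'd \<Rightarrow> 'y::ab_group_add) \<Rightarrow> 'd \<times> 'd \<Rightarrow> 'y" where
  "edge_restrict M \<Psi> = (\<lambda>(x, y). if (x, y) \<in> dual_edges M then \<Psi> x y else 0)"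

definition cohomologous ::
  "'d::euclidean_space set \<Rightarrow> (('d \<times> 'd \<Rightarrow> 'y::ab_group_add) \<times> ('d \<times> 'd \<Rightarrow> 'y)) set" where
  "cohomologous M = {(\<phi>, \<psi>). \<phi> \<in> Z1 M \<and> \<psi> \<in> Z1 M \<and>
     (\<exists>G. spe M G \<and> (\<lambda>e. \<psi> e - \<phi> e) = edge_restrict M (delta G))}"

definition H1 :: "'d::euclidean_space set \<Rightarrow> ('d \<times> 'd \<Rightarrow> 'y::ab_group_add) set set" where
  "H1 M = Z1 M // cohomologous M"

definition coh_class ::
  "'d::euclidean_space set \<Rightarrow> ('d \<Rightarrow> 'd \<Rightarrow> 'y::ab_group_add) \<Rightarrow> ('d \<times> 'd \<Rightarrow> 'y) set" where
  "coh_class M \<Psi> = cohomologous M `` {edge_restrict M \<Psi>}"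

definition H1_an :: "'d::euclidean_space set \<Rightarrow> ('d \<times> 'd \<Rightarrow> real) set set" where
  "H1_an M = {coh_class M (delta F) | F :: 'd \<Rightarrow> real. wpe M F \<and> spe2 M (delta F)}"

definition H1_ns ::
  "('h::{topological_ab_group_add, t2_space} \<times> 'd::euclidean_space) set \<Rightarrow> 'h set
    \<Rightarrow> 'd set \<Rightarrow> ('d \<times> 'd \<Rightarrow> real) set set" where
  "H1_ns \<Gamma> W M =
     {coh_class M (delta F) | F :: 'd \<Rightarrow> real. nonslip \<Gamma> W M F \<and> spe2 M (delta F)}"

definition H1_repr ::
  "('h::{topological_ab_group_add, t2_space} \<times> 'd::euclidean_space) set \<Rightarrow> 'h set
    \<Rightarrow> 'd set \<Rightarrow> ('d \<times> 'd \<Rightarrow> real) set set" where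
  "H1_repr \<Gamma> W M =
     {coh_class M (delta (L \<circ> star_map \<Gamma> W M)) | L :: 'h \<Rightarrow> real.
        continuous_on UNIV L \<and> Modules.additive L}"

lemma dual_edges_sym: "(x, y) \<in> dual_edges M \<Longrightarrow> (y, x) \<in> dual_edges M"
  by (auto simp: dual_edges_def Int_commute)

lemma dual_edges_short:
  fixes M :: "'d::euclidean_space set"
  assumes "(x, y) \<in> dual_edges M" and cov: "\<forall>z. \<exists>x\<in>M. dist z x \<le> R0 / 3"
  shows "norm (y - x) \<le> R0"
proof -
  have "voronoi_cell M x \<inter> voronoi_cell M y \<noteq> {}"
  proof
    assume "voronoi_cell M x \<inter> voronoi_cell M y = {}"
    then have "int DIM('d) - 1 = -1" using assms(1) by (simp add: dual_edges_def)
    then show False by simp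
  qed
  then obtain z where z: "z \<in> voronoi_cell M x" "z \<in> voronoi_cell M y" by blast
  obtain m where "m \<in> M" "dist z m \<le> R0 / 3" using cov by blast
  then have "dist z x \<le> R0 / 3" "dist z y \<le> R0 / 3"
    using z by (force simp: voronoi_cell_def)+
  moreover have "dist y x \<le> dist z y + dist z x" by (metis dist_commute dist_triangle)
  ultimately show ?thesis using zero_le_dist[of z x] unfolding dist_norm[symmetric] by linarith
qed

lemma edge_restrict_delta_Z1:
  fixes M :: "'d::euclidean_space set" and F :: "'d \<Rightarrow> 'y::ab_group_add"
  assumes "spe2 M (delta F)"
  shows "edge_restrict M (delta F) \<in> Z1 M"
proof -
  have 1: "cochain1 M (edge_restrict M (delta F))"
    using dual_edges_sym by (fastforce simp: cochain1_def edge_restrict_def delta_def)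
  have "(\<Sum>i<k. edge_restrict M (delta F) (p i, p (Suc i))) = 0"
    if "p k = p 0" "\<forall>i<k. (p i, p (Suc i)) \<in> dual_edges M" for k and p :: "nat \<Rightarrow> 'd"
  proof -
    have "(\<Sum>i<k. edge_restrict M (delta F) (p i, p (Suc i))) = (\<Sum>i<k. F (p (Suc i)) - F (p i))"
      using that by (intro sum.cong) (auto simp: edge_restrict_def delta_def)
    then show ?thesis using that by (simp add: sum_lessThan_telescope[of "\<lambda>i. F (p i)"])
  qed
  then have 2: "closed1 M (edge_restrict M (delta F))"
    by (auto simp: closed1_def)
  obtain R0 R where cov: "\<forall>z. \<exists>x\<in>M. dist z x \<le> R0 / 3" and "0 < R"
    and R: "\<And>x1 y1 x2 y2. \<lbrakk>x1 \<in> M; y1 \<in> M; x2 \<in> M; y2 \<in> M; norm (y1 - x1) \<le> R0;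
        norm (y2 - x2) \<le> R0; y1 - x1 = y2 - x2; agree R (shift M x1) (shift M x2)\<rbrakk>
        \<Longrightarrow> delta F x1 y1 = delta F x2 y2"
    using assms unfolding spe2_def by blast
  have "edge_restrict M (delta F) (x1, y1) = edge_restrict M (delta F) (x2, y2)"
    if e: "(x1, y1) \<in> dual_edges M" "(x2, y2) \<in> dual_edges M"
      and "y1 - x1 = y2 - x2" "agree R (shift M x1) (shift M x2)" for x1 y1 x2 y2
    using R[of x1 y1 x2 y2] that dual_edges_short[OF e(1) cov] dual_edges_short[OF e(2) cov]
    by (auto simp: edge_restrict_def dual_edges_def)
  then have "spe_cochain1 M (edge_restrict M (delta F))"
    using \<open>0 < R\<close> unfolding spe_cochain1_def by blast
  with 1 2 show ?thesis by (simp add: Z1_def)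
qed

lemma H1_an_subset: "H1_an M \<subseteq> H1 M"
  using edge_restrict_delta_Z1 by (fastforce simp: H1_an_def H1_def coh_class_def intro: quotientI)

lemma H1_ns_subset_an: "H1_ns \<Gamma> W M \<subseteq> H1_an M"
  unfolding H1_ns_def H1_an_def nonslip_def wpe_def by blast

end

theory Submission
  imports Defs "HOL-Library.Diagonal_Subsequence"
begin

text \<open>
  The classes of \<open>L \<circ> star\<close> are nonslip because the star map depends continuously on the point of the
  hull and, at the origin, only on the image under \<open>pi_max\<close>.  The substance is the converse: a weakly
  pattern equivariant \<open>F\<close> with strongly pattern equivariant coboundary differs from some \<open>L \<circ> star\<close> by a
  strongly pattern equivariant function (lemma \<open>spe_minus_linear\<close>).

  Think of \<open>F x\<close> as a function of the address \<open>star x\<close> in the window \<open>W\<close>.  The pattern of radius \<open>T\<close>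
  around \<open>x\<close> is determined by the sides on which the address lies of the hyperplanes in \<open>planes T\<close>:
  the hyperplanes that carry the faces of \<open>W\<close>, translated by the lattice vectors of physical length less
  than \<open>T\<close>.  Hence, up to an error that vanishes as \<open>T\<close> grows, \<open>F\<close> is constant on the chambers of these
  arrangements; but the arrangements become dense.  The key is that \<open>F\<close> can jump only across the
  planes of one fixed radius \<open>R'\<close>.

  To see this, take \<open>x\<close> and \<open>y\<close> whose addresses are separated by one plane only, with normal \<open>c\<close>.  The lattice
  vectors at which the patterns of \<open>x\<close> and \<open>y\<close> disagree have bounded internal parts on finitely many
  hyperplanes with normal \<open>c\<close>.  The physical parts of such vectors stay in a slab orthogonal to some
  direction \<open>e\<close>, with a width that depends neither on \<open>x\<close> and \<open>y\<close> nor on \<open>T\<close> (\<open>wall_direction\<close>): otherwise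
  the real span of the lattice vectors with internal part orthogonal to \<open>c\<close> would contain the physical
  space, and then the lattice could not project densely to the internal space.  If \<open>x\<close> and \<open>y\<close> agree on a ball that is large compared with the
  slab, one can walk from \<open>x\<close> and from \<open>y\<close> along the same path in direction \<open>e\<close> or \<open>- e\<close> without ever coming near
  a disagreement.  As the coboundary of \<open>F\<close> is strongly pattern equivariant, \<open>F\<close> changes by the same
  amount along both paths; at their far ends the patterns agree on a huge ball, so that \<open>F x\<close> and \<open>F y\<close> are
  close (\<open>adjacent_values_close\<close>).  A short segment crosses at most one plane for each normal; crossing them one
  by one shows that \<open>F\<close> is uniformly continuous in the address on every chamber of \<open>planes R'\<close>.

  On such a chamber \<open>F\<close> therefore extends to a continuous function \<open>g\<close>.  For a lattice vector \<open>\<gamma>\<close> the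
  increment \<open>g (h + fst \<gamma>) - g h\<close> is continuous in \<open>h\<close> and takes finitely many values, hence is constant; by
  density, \<open>g\<close> is affine (\<open>affine_on_chamber\<close>).  The slopes on two chambers agree, since the increments of
  \<open>F\<close> between them are locally constant (\<open>slopes_agree\<close>).  So \<open>F - L \<circ> star\<close> takes finitely many values, and a
  weakly pattern equivariant function with finitely many values is strongly pattern equivariant.

  All this needs \<open>pi_max\<close> in concrete form.  It maps \<open>N\<close> to the coset \<open>\<xi>\<close> with
  \<open>cut_project (interior W) \<xi> \<subseteq> N \<subseteq> cut_project W \<xi>\<close>, which exists by compactness of the torus, is unique
  because the window has no translational symmetry, and depends continuously on \<open>N\<close> because these inclusions
  survive limits (\<open>pi_max_eq_address\<close>).
\<close>

section \<open>Generic points and the lattice\<close>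

lemma open_off_hyperplanes:
  fixes A :: "('a::euclidean_space \<times> real) set"
  assumes "finite A"
  shows "open {z. \<forall>(c, s)\<in>A. c \<bullet> z \<noteq> s}"
proof -
  have "{z. \<forall>(c, s)\<in>A. c \<bullet> z \<noteq> s} = (\<Inter>p\<in>A. - {z. fst p \<bullet> z = snd p})"
    by force
  then show ?thesis
    using assms by (auto intro!: open_INT simp: closed_hyperplane open_Compl)
qed

lemma open_meets_generic:
  fixes A :: "('a::euclidean_space \<times> real) set"
  assumes "finite A" "\<And>c s. (c, s) \<in> A \<Longrightarrow> c \<noteq> 0" "open U" "U \<noteq> {}"
  obtains z where "z \<in> U" "\<forall>(c, s)\<in>A. c \<bullet> z \<noteq> s"
proof -
  have "negligible (\<Union>p\<in>A. {z. fst p \<bullet> z = snd p})"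
    using assms(1,2) by (intro negligible_Union) (auto intro!: negligible_hyperplane)
  then have "\<not> U \<subseteq> (\<Union>p\<in>A. {z. fst p \<bullet> z = snd p})"
    using open_not_negligible[OF assms(3,4)] negligible_subset by blast
  then show ?thesis using that by fastforce
qed

text \<open>The bound on \<open>norm p\<close> keeps \<open>p\<close> inside the ball on which the shifted patterns agree.\<close>

lemma close_patterns_point:
  assumes "delone_dist A B < e" "e \<le> 1" "p \<in> A" "norm p + 1 < 1 / e"
  obtains q where "q \<in> B" "dist q p < 2 * e"
proof -
  obtain a where a: "0 < a" "a < e" "close_patterns a A B"
    using delone_dist_less assms(1,2) by metis
  then obtain u v where uv: "norm u < a" "norm v < a"
    and AB: "\<And>z. norm z < 1 / a \<Longrightarrow> z + u \<in> A \<longleftrightarrow> z + v \<in> B"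
    by (auto simp: close_patterns_def agree_iff in_shift_iff)
  have "1 / e < 1 / a" using a(1,2) by (intro divide_strict_left_mono) auto
  then have "norm (p - u) < 1 / a"
    using norm_triangle_ineq4[of p u] uv a assms by linarith
  then have "p - u + v \<in> B" using AB[of "p - u"] assms by simp
  moreover have "dist (p - u + v) p < 2 * e"
    using norm_triangle_ineq4[of v u] uv a by (simp add: dist_norm algebra_simps)
  ultimately show ?thesis using that by blast
qed

locale model_scheme =
  fixes \<Gamma> :: "('h::euclidean_space \<times> 'd::euclidean_space) set" and W :: "'h set"
  assumes scheme: "cut_and_project_scheme \<Gamma>" and window: "is_window W"
begin

lemma lattice_zero: "0 \<in> \<Gamma>"
  and lattice_diff: "\<gamma> \<in> \<Gamma> \<Longrightarrow> \<delta> \<in> \<Gamma> \<Longrightarrow> \<gamma> - \<delta> \<in> \<Gamma>"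
  using scheme by (auto simp: cut_and_project_scheme_def discrete_subgroup_def)

lemma lattice_uminus: "\<gamma> \<in> \<Gamma> \<Longrightarrow> - \<gamma> \<in> \<Gamma>"
  using lattice_diff[OF lattice_zero] by simp

lemma lattice_add: "\<gamma> \<in> \<Gamma> \<Longrightarrow> \<delta> \<in> \<Gamma> \<Longrightarrow> \<gamma> + \<delta> \<in> \<Gamma>"
  using lattice_diff[OF _ lattice_uminus] by fastforce

lemma lattice_snd_inj: "\<gamma> \<in> \<Gamma> \<Longrightarrow> \<delta> \<in> \<Gamma> \<Longrightarrow> snd \<gamma> = snd \<delta> \<Longrightarrow> \<gamma> = \<delta>"
  using scheme by (auto simp: cut_and_project_scheme_def inj_on_def)

lemma lattice_dense:
  assumes "open U" "U \<noteq> {}"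
  obtains \<gamma> where "\<gamma> \<in> \<Gamma>" "fst \<gamma> \<in> U"
proof -
  have "U \<inter> closure (fst ` \<Gamma>) \<noteq> {}"
    using scheme assms by (auto simp: cut_and_project_scheme_def)
  then have "U \<inter> fst ` \<Gamma> \<noteq> {}"
    using assms(1) by (metis open_Int_closure_eq_empty)
  then show ?thesis using that by blast
qed

lemma lattice_uniform_discrete: "uniform_discrete \<Gamma>"
proof -
  have "0 isolated_in \<Gamma>"
    using scheme lattice_zero
    by (auto simp: cut_and_project_scheme_def discrete_subgroup_def discrete_def)
  then obtain e where e: "e > 0" "ball 0 e \<inter> \<Gamma> = {0}"
    using isolated_in_dist_Ex_iff[of 0 \<Gamma>] by (force simp: set_eq_iff dist_norm)
  have "x = y" if "x \<in> \<Gamma>" "y \<in> \<Gamma>" "dist x y < e" for x y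
  proof -
    have "x - y \<in> ball 0 e \<inter> \<Gamma>"
      using that lattice_diff by (simp add: dist_norm norm_minus_commute)
    then show ?thesis using e by auto
  qed
  then show ?thesis using e(1) unfolding uniform_discrete_def by blast
qed

lemma lattice_finite: "finite {\<gamma> \<in> \<Gamma>. norm (fst \<gamma>) \<le> a \<and> norm (snd \<gamma>) \<le> b}" (is "finite ?S")
proof -
  have "?S \<subseteq> cball 0 a \<times> cball 0 b" by auto
  then have "bounded ?S"
    by (rule bounded_subset[rotated]) (intro bounded_Times bounded_cball)
  moreover have "uniform_discrete ?S"
    using lattice_uniform_discrete by (rule uniform_discrete_subset) auto
  ultimately show ?thesis using uniform_discrete_finite_iff by blast
qed

text \<open>Finitely many lattice vectors have bounded internal part and short physical part, and none but \<open>0\<close> has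
  vanishing physical part.  Thus short vectors between points with addresses in a bounded set vanish.\<close>

lemma lattice_gap:
  obtains \<mu> where "\<mu> > 0" "\<And>\<gamma>. \<gamma> \<in> \<Gamma> \<Longrightarrow> norm (fst \<gamma>) \<le> b \<Longrightarrow> norm (snd \<gamma>) < \<mu> \<Longrightarrow> \<gamma> = 0"
proof -
  define S where "S = {\<gamma> \<in> \<Gamma>. norm (fst \<gamma>) \<le> b \<and> norm (snd \<gamma>) \<le> 1} - {0}"
  have S: "finite S" unfolding S_def using lattice_finite by blast
  define \<mu> where "\<mu> = Min (insert 1 ((\<lambda>\<gamma>. norm (snd \<gamma>)) ` S))"
  have "norm (snd \<gamma>) > 0" if "\<gamma> \<in> S" for \<gamma>
    using that lattice_snd_inj[OF _ lattice_zero, of \<gamma>] unfolding S_def by auto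
  then have "\<mu> > 0" unfolding \<mu>_def using S by auto
  moreover have "\<gamma> = 0" if "\<gamma> \<in> \<Gamma>" "norm (fst \<gamma>) \<le> b" "norm (snd \<gamma>) < \<mu>" for \<gamma>
  proof (rule ccontr)
    assume "\<gamma> \<noteq> 0"
    have "\<mu> \<le> 1" unfolding \<mu>_def using S by auto
    then have "\<gamma> \<in> S" using that \<open>\<gamma> \<noteq> 0\<close> unfolding S_def by auto
    then have "\<mu> \<le> norm (snd \<gamma>)" unfolding \<mu>_def using S by auto
    then show False using that by simp
  qed
  ultimately show ?thesis using that by blast
qed

lemma mem_coset: "z \<in> coset_of \<Gamma> c \<longleftrightarrow> z - c \<in> \<Gamma>"
  by (force simp: coset_of_def image_iff algebra_simps)

lemma coset_eq_iff: "coset_of \<Gamma> a = coset_of \<Gamma> b \<longleftrightarrow> a - b \<in> \<Gamma>"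
proof
  assume "coset_of \<Gamma> a = coset_of \<Gamma> b"
  then show "a - b \<in> \<Gamma>" using lattice_zero by (metis mem_coset diff_self)
next
  assume "a - b \<in> \<Gamma>"
  then have "z - a \<in> \<Gamma> \<longleftrightarrow> z - b \<in> \<Gamma>" for z
    using lattice_add[of "z - a" "a - b"] lattice_diff[of "z - b" "a - b"] by auto
  then show "coset_of \<Gamma> a = coset_of \<Gamma> b" by (simp add: set_eq_iff mem_coset)
qed

lemma coset_in_torus: "coset_of \<Gamma> c \<in> torus \<Gamma>"
  by (simp add: torus_def)

lemma torus_eq_coset: "\<xi> \<in> torus \<Gamma> \<Longrightarrow> z \<in> \<xi> \<Longrightarrow> \<xi> = coset_of \<Gamma> z"
  using coset_eq_iff mem_coset lattice_uminus unfolding torus_def by (metis imageE minus_diff_eq)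

lemma coset_diff: "\<xi> \<in> torus \<Gamma> \<Longrightarrow> z \<in> \<xi> \<Longrightarrow> z' \<in> \<xi> \<Longrightarrow> z - z' \<in> \<Gamma>"
  using torus_eq_coset mem_coset by metis

lemma coset_add: "\<xi> \<in> torus \<Gamma> \<Longrightarrow> z \<in> \<xi> \<Longrightarrow> \<gamma> \<in> \<Gamma> \<Longrightarrow> z + \<gamma> \<in> \<xi>"
  using torus_eq_coset mem_coset by (metis add_diff_cancel_left')

lemma coset_snd_inj: "\<xi> \<in> torus \<Gamma> \<Longrightarrow> z \<in> \<xi> \<Longrightarrow> z' \<in> \<xi> \<Longrightarrow> snd z = snd z' \<Longrightarrow> z = z'"
  using lattice_snd_inj[OF coset_diff lattice_zero, of \<xi> z z'] by simp

lemma coset_dense: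
  assumes "\<xi> \<in> torus \<Gamma>" "open U" "U \<noteq> {}"
  obtains z where "z \<in> \<xi>" "fst z \<in> U"
proof -
  obtain c where c: "\<xi> = coset_of \<Gamma> c" using assms(1) by (auto simp: torus_def)
  have "open ((\<lambda>h. h + fst c) -` U)" using assms(2) by (intro open_vimage continuous_intros)
  moreover have "(\<lambda>h. h + fst c) -` U \<noteq> {}"
  proof -
    obtain u where "u \<in> U" using assms(3) by blast
    then have "u - fst c \<in> (\<lambda>h. h + fst c) -` U" by simp
    then show ?thesis by blast
  qed
  ultimately obtain \<gamma> where "\<gamma> \<in> \<Gamma>" "fst \<gamma> \<in> (\<lambda>h. h + fst c) -` U" by (rule lattice_dense)
  then show ?thesis using that[of "\<gamma> + c"] c by (auto simp: mem_coset)
qed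

lemma openin_torus_image:
  assumes "open U"
  shows "openin (torus_topology \<Gamma>) (coset_of \<Gamma> ` U)"
proof -
  have "coset_of \<Gamma> -` (coset_of \<Gamma> ` U) = (\<Union>\<gamma>\<in>\<Gamma>. (\<lambda>z. \<gamma> + z) ` U)"
  proof (intro set_eqI iffI)
    fix z assume "z \<in> coset_of \<Gamma> -` (coset_of \<Gamma> ` U)"
    then obtain u where "u \<in> U" "coset_of \<Gamma> z = coset_of \<Gamma> u" by auto
    then have "z - u \<in> \<Gamma>" using coset_eq_iff by blast
    then show "z \<in> (\<Union>\<gamma>\<in>\<Gamma>. (\<lambda>z. \<gamma> + z) ` U)"
      using \<open>u \<in> U\<close> by (intro UN_I[of "z - u"] image_eqI[of _ _ u]) auto
  next
    fix z assume "z \<in> (\<Union>\<gamma>\<in>\<Gamma>. (\<lambda>z. \<gamma> + z) ` U)"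
    then obtain \<gamma> u where "\<gamma> \<in> \<Gamma>" "u \<in> U" "z = \<gamma> + u" by auto
    then have "coset_of \<Gamma> z = coset_of \<Gamma> u" by (simp add: coset_eq_iff)
    then show "z \<in> coset_of \<Gamma> -` (coset_of \<Gamma> ` U)" using \<open>u \<in> U\<close> by auto
  qed
  moreover have "open (\<Union>\<gamma>\<in>\<Gamma>. (\<lambda>z. \<gamma> + z) ` U)" using assms by (auto intro: open_translation)
  ultimately show ?thesis by (auto simp: openin_torus_topology torus_def)
qed

text \<open>The images of the balls around \<open>0\<close> form an increasing open cover of the compact torus.\<close>

lemma bounded_representatives:
  obtains r where "\<And>\<xi>. \<xi> \<in> torus \<Gamma> \<Longrightarrow> \<exists>c. norm c \<le> r \<and> \<xi> = coset_of \<Gamma> c"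
proof -
  define \<U> where "\<U> = range (\<lambda>n::nat. coset_of \<Gamma> ` ball 0 (real n))"
  have "torus \<Gamma> \<subseteq> \<Union>\<U>"
  proof
    fix \<xi> assume "\<xi> \<in> torus \<Gamma>"
    then obtain c where c: "\<xi> = coset_of \<Gamma> c" by (auto simp: torus_def)
    obtain n :: nat where "norm c < real n" using reals_Archimedean2 by blast
    then have "\<xi> \<in> coset_of \<Gamma> ` ball 0 (real n)" using c by simp
    then show "\<xi> \<in> \<Union>\<U>" unfolding \<U>_def by blast
  qed
  moreover have "\<forall>U\<in>\<U>. openin (torus_topology \<Gamma>) U"
    using openin_torus_image by (auto simp: \<U>_def)
  moreover have "compact_space (torus_topology \<Gamma>)"
    using scheme by (simp add: cut_and_project_scheme_def)
  ultimately obtain \<F> where \<F>: "finite \<F>" "\<F> \<subseteq> \<U>" "torus \<Gamma> \<subseteq> \<Union>\<F>"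
    unfolding compact_space_alt topspace_torus_topology by meson
  then obtain I :: "nat set" where I: "finite I" "\<F> = (\<lambda>n. coset_of \<Gamma> ` ball 0 (real n)) ` I"
    unfolding \<U>_def by (meson finite_subset_image)
  have "\<exists>c. norm c \<le> real (Max (insert 0 I)) \<and> \<xi> = coset_of \<Gamma> c" if \<xi>: "\<xi> \<in> torus \<Gamma>" for \<xi>
  proof -
    obtain n where n: "n \<in> I" "\<xi> \<in> coset_of \<Gamma> ` ball 0 (real n)"
      using \<xi> \<F>(3) I by blast
    then obtain c where "norm c < real n" "\<xi> = coset_of \<Gamma> c" by auto
    moreover have "real n \<le> real (Max (insert 0 I))" using I n(1) by simp
    ultimately have "norm c \<le> real (Max (insert 0 I))" by linarith
    then show ?thesis using \<open>\<xi> = coset_of \<Gamma> c\<close> by blast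
  qed
  then show ?thesis using that by blast
qed

lemma window_bounded:
  obtains \<beta> where "\<beta> > 0" "\<And>w. w \<in> W \<Longrightarrow> norm w \<le> \<beta>"
  using window compact_imp_bounded bounded_pos unfolding is_window_def by metis

lemma window_closed: "closed W"
  using window compact_imp_closed by (auto simp: is_window_def)

lemma window_interior_nonempty: "interior W \<noteq> {}"
proof
  assume "interior W = {}"
  then have "W = {}" using window unfolding is_window_def by (metis closure_empty)
  then have "(\<forall>h::'h. h = 0)" using window by (auto simp: is_window_def)
  moreover obtain b :: 'h where "b \<in> Basis" using nonempty_Basis by blast
  ultimately show False using nonzero_Basis by blast
qed

text \<open>By density every coset has a point over the interior of the window; boundedness of the physical part
  is an open condition, so compactness makes the bound uniform over the torus.\<close>

lemma coset_relatively_dense: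
  obtains R where "R > 0" "\<And>\<xi>. \<xi> \<in> torus \<Gamma> \<Longrightarrow> \<exists>z\<in>\<xi>. fst z \<in> interior W \<and> norm (snd z) \<le> R"
proof -
  obtain r where r: "\<And>\<xi>. \<xi> \<in> torus \<Gamma> \<Longrightarrow> \<exists>c. norm c \<le> r \<and> \<xi> = coset_of \<Gamma> c"
    using bounded_representatives by metis
  define U where "U n = (\<Union>\<gamma>\<in>\<Gamma>. (\<lambda>c. \<gamma> + c) -` (interior W \<times> ball 0 (real n)))" for n :: nat
  have op: "open (U n)" for n
    unfolding U_def by (intro open_UN ballI open_vimage open_Times open_interior open_ball continuous_intros)
  have "cball 0 r \<subseteq> (\<Union>n\<in>UNIV. U n)"
  proof
    fix c :: "'h \<times> 'd"
    obtain z where z: "z \<in> coset_of \<Gamma> c" "fst z \<in> interior W"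
      using coset_dense[OF coset_in_torus open_interior window_interior_nonempty] by metis
    obtain n :: nat where n: "norm (snd z) < real n" using reals_Archimedean2 by blast
    have "(z - c) + c \<in> interior W \<times> ball 0 (real n)"
      using z n by (simp add: mem_Times_iff)
    moreover have "z - c \<in> \<Gamma>" using z(1) by (simp add: mem_coset)
    ultimately have "c \<in> U n" unfolding U_def by blast
    then show "c \<in> (\<Union>n\<in>UNIV. U n)" by blast
  qed
  then obtain I where I: "finite I" "cball 0 r \<subseteq> (\<Union>n\<in>I. U n)"
    using compactE_image[OF compact_cball, of UNIV U 0 r] op by auto
  have "\<exists>z\<in>\<xi>. fst z \<in> interior W \<and> norm (snd z) \<le> real (Max (insert 0 I)) + 1"
    if \<xi>: "\<xi> \<in> torus \<Gamma>" for \<xi>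
  proof -
    obtain c where c: "norm c \<le> r" "\<xi> = coset_of \<Gamma> c" using r[OF \<xi>] by blast
    then obtain n \<gamma> where n: "n \<in> I" "\<gamma> \<in> \<Gamma>" "\<gamma> + c \<in> interior W \<times> ball 0 (real n)"
      using I(2) by (force simp: U_def)
    have "n \<le> Max (insert 0 I)" using I n by simp
    then have "norm (snd (\<gamma> + c)) \<le> real (Max (insert 0 I)) + 1"
      using n(3) by (auto simp: mem_Times_iff)
    moreover have "\<gamma> + c \<in> \<xi>" using c n by (simp add: mem_coset)
    moreover have "fst (\<gamma> + c) \<in> interior W" using n(3) by (simp add: mem_Times_iff)
    ultimately show ?thesis by blast
  qed
  then show ?thesis using that[of "real (Max (insert 0 I)) + 1"] by auto
qed

lemma mem_cut_project: "x \<in> cut_project V \<xi> \<longleftrightarrow> (\<exists>h\<in>V. (h, x) \<in> \<xi>)"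
  by (force simp: cut_project_def)

lemma coset_shift: "(h, y) \<in> coset_of \<Gamma> (c - (0, x)) \<longleftrightarrow> (h, y + x) \<in> coset_of \<Gamma> c"
  unfolding mem_coset by (cases c) (simp add: algebra_simps)

lemma cut_project_shift:
  "shift (cut_project V (coset_of \<Gamma> c)) x = cut_project V (coset_of \<Gamma> (c - (0, x)))"
  by (auto simp: in_shift_iff mem_cut_project coset_shift)

lemma delone_cut_project:
  assumes \<xi>: "\<xi> \<in> torus \<Gamma>"
  shows "delone (cut_project W \<xi>)"
proof -
  obtain c where c: "\<xi> = coset_of \<Gamma> c" using assms by (auto simp: torus_def)
  obtain \<beta> where \<beta>: "\<And>w. w \<in> W \<Longrightarrow> norm w \<le> \<beta>" using window_bounded by metis
  obtain \<mu> where \<mu>: "\<mu> > 0"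
    "\<And>\<gamma>. \<gamma> \<in> \<Gamma> \<Longrightarrow> norm (fst \<gamma>) \<le> 2 * \<beta> \<Longrightarrow> norm (snd \<gamma>) < \<mu> \<Longrightarrow> \<gamma> = 0"
    using lattice_gap by metis
  have "x = y" if "x \<in> cut_project W \<xi>" "y \<in> cut_project W \<xi>" "dist x y < \<mu>" for x y
  proof -
    obtain h k where hk: "h \<in> W" "k \<in> W" "(h, x) \<in> \<xi>" "(k, y) \<in> \<xi>"
      using \<open>x \<in> _\<close> \<open>y \<in> _\<close> by (auto simp: mem_cut_project)
    have "norm (h - k) \<le> 2 * \<beta>"
      using \<beta>[OF hk(1)] \<beta>[OF hk(2)] norm_triangle_ineq4[of h k] by linarith
    moreover have "norm (x - y) < \<mu>" using that by (simp add: dist_norm)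
    ultimately have "(h, x) - (k, y) = 0"
      using \<mu>(2)[OF coset_diff[OF \<xi> hk(3,4)]] by simp
    then show ?thesis by (simp add: zero_prod_def)
  qed
  then have "uniform_discrete (cut_project W \<xi>)"
    using \<mu>(1) unfolding uniform_discrete_def by blast
  moreover obtain R where R: "R > 0"
    "\<And>\<xi>. \<xi> \<in> torus \<Gamma> \<Longrightarrow> \<exists>z\<in>\<xi>. fst z \<in> interior W \<and> norm (snd z) \<le> R"
    using coset_relatively_dense by metis
  have "\<exists>x\<in>cut_project W \<xi>. dist z x \<le> R" for z
  proof -
    obtain h y where hy: "(h, y) \<in> coset_of \<Gamma> (c - (0, z))" "h \<in> interior W" "norm y \<le> R"
      using R(2)[OF coset_in_torus, of "c - (0, z)"] by auto
    then have "y + z \<in> cut_project W \<xi>"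
      using c interior_subset unfolding coset_shift mem_cut_project by auto
    moreover have "dist z (y + z) \<le> R" using hy by (simp add: dist_norm)
    ultimately show ?thesis by blast
  qed
  ultimately show ?thesis unfolding delone_def using R(1) by blast
qed

section \<open>Cosets compatible with a point set\<close>

text \<open>For a singular coset \<open>\<xi>\<close> the points with address on the boundary of the window may or may not belong
  to \<open>N\<close>, so that \<open>\<xi>\<close> does not determine \<open>N\<close>.\<close>

definition param :: "'d set \<Rightarrow> ('h \<times> 'd) set \<Rightarrow> bool" where
  "param N \<xi> \<longleftrightarrow> \<xi> \<in> torus \<Gamma> \<and> cut_project (interior W) \<xi> \<subseteq> N \<and> N \<subseteq> cut_project W \<xi>"

lemma param_cut_project: "\<xi> \<in> torus \<Gamma> \<Longrightarrow> param (cut_project W \<xi>) \<xi>"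
  using interior_subset[of W] unfolding param_def subset_iff mem_cut_project by blast

lemma param_shift: "param N (coset_of \<Gamma> c) \<Longrightarrow> param (shift N x) (coset_of \<Gamma> (c - (0, x)))"
  by (auto simp: param_def coset_in_torus in_shift_iff subset_iff mem_cut_project coset_shift)

text \<open>Two compatible cosets differ by an internal translation \<open>t\<close>.  By density of the lattice \<open>W\<close> is mapped
  into itself by the translations by \<open>t\<close> and \<open>- t\<close>, so \<open>t\<close> is a symmetry of the window.\<close>

lemma param_unique:
  assumes "param N \<xi>" "param N \<xi>'"
  shows "\<xi> = \<xi>'"
proof -
  have tor: "\<xi> \<in> torus \<Gamma>" "\<xi>' \<in> torus \<Gamma>" using assms by (auto simp: param_def)
  obtain h x where hx: "(h, x) \<in> \<xi>" "h \<in> interior W"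
    using coset_dense[OF tor(1) open_interior window_interior_nonempty] by (metis prod.collapse)
  then have "x \<in> cut_project (interior W) \<xi>" unfolding mem_cut_project by blast
  then have "x \<in> N" using assms(1) by (auto simp: param_def)
  then have "x \<in> cut_project W \<xi>'" using assms(2) by (auto simp: param_def)
  then obtain h' where h': "(h', x) \<in> \<xi>'" by (auto simp: mem_cut_project)
  \<comment> \<open>both cosets meet the fibre over \<open>x\<close>, so they differ by a translation \<open>t\<close> in the internal space\<close>
  have *: "W \<subseteq> (\<lambda>w. w - t) -` W"
    if "param N \<zeta>" "param N \<zeta>'" "(k, x) \<in> \<zeta>" "(k', x) \<in> \<zeta>'" "t = k - k'" for \<zeta> \<zeta>' k k' t
  proof -
    have \<zeta>: "\<zeta> \<in> torus \<Gamma>" "\<zeta>' \<in> torus \<Gamma>" using that by (auto simp: param_def)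
    have cl: "closed ((\<lambda>w. w - t) -` W)"
      using window_closed by (intro closed_vimage continuous_intros)
    have "interior W - (\<lambda>w. w - t) -` W = {}"
    proof (rule ccontr)
      assume "interior W - (\<lambda>w. w - t) -` W \<noteq> {}"
      moreover have "open (interior W - (\<lambda>w. w - t) -` W)" using cl by (intro open_Diff) auto
      ultimately obtain g y where g: "(g, y) \<in> \<zeta>" "g \<in> interior W" "g - t \<notin> W"
        using coset_dense[OF \<zeta>(1), of "interior W - (\<lambda>w. w - t) -` W"]
        by (metis DiffE prod.collapse vimageI2)
      then have "y \<in> cut_project (interior W) \<zeta>" unfolding mem_cut_project by blast
      then have "y \<in> N" using that(1) by (auto simp: param_def)
      then have "y \<in> cut_project W \<zeta>'" using that(2) by (auto simp: param_def)
      then obtain g' where g': "g' \<in> W" "(g', y) \<in> \<zeta>'" by (auto simp: mem_cut_project)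
      have "(k', x) + ((g, y) - (k, x)) \<in> \<zeta>'"
        using coset_add[OF \<zeta>(2) that(4) coset_diff[OF \<zeta>(1) g(1) that(3)]] .
      moreover have "k' + (g - k) = g - t" using that(5) by simp
      ultimately have "(g - t, y) \<in> \<zeta>'" by simp
      then have "g' = g - t" using coset_snd_inj[OF \<zeta>(2) g'(2), of "(g - t, y)"] by simp
      then show False using g g' by simp
    qed
    then have "interior W \<subseteq> (\<lambda>w. w - t) -` W" by blast
    then have "closure (interior W) \<subseteq> (\<lambda>w. w - t) -` W" using cl by (rule closure_minimal)
    then show ?thesis using window by (auto simp: is_window_def)
  qed
  have 1: "W \<subseteq> (\<lambda>w. w - (h - h')) -` W" by (rule *[OF assms hx(1) h']) simp
  have 2: "W \<subseteq> (\<lambda>w. w - (h' - h)) -` W" by (rule *[OF assms(2,1) h' hx(1)]) simp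
  have "(\<lambda>w. w + (h - h')) ` W = W"
  proof
    show "(\<lambda>w. w + (h - h')) ` W \<subseteq> W" using 2 by (auto simp: algebra_simps)
    show "W \<subseteq> (\<lambda>w. w + (h - h')) ` W"
    proof
      fix w assume "w \<in> W"
      then have "w - (h - h') \<in> W" using 1 by auto
      then show "w \<in> (\<lambda>w. w + (h - h')) ` W" by (rule rev_image_eqI) simp
    qed
  qed
  then have "h - h' = 0" using window unfolding is_window_def by blast
  then have "(h, x) \<in> \<xi>'" using h' by simp
  then show ?thesis using torus_eq_coset[OF tor(1) hx(1)] torus_eq_coset[OF tor(2)] by simp
qed

end

section \<open>The topology of the hull\<close>

lemma continuous_map_delone_iff:
  assumes "A \<subseteq> Collect delone"
  shows "continuous_map (subtopology delone_topology A) Y f \<longleftrightarrow>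
    f ` A \<subseteq> topspace Y \<and>
    (\<forall>N\<in>A. \<forall>U. openin Y U \<and> f N \<in> U \<longrightarrow>
       (\<exists>\<delta>>0. \<forall>N'\<in>A. delone_dist N N' < \<delta> \<longrightarrow> f N' \<in> U))"
proof -
  interpret Metric_space "Collect delone" delone_dist by (rule Metric_space_delone)
  interpret Submetric "Collect delone" delone_dist A by unfold_locales (rule assms)
  have top: "subtopology delone_topology A = sub.mtopology"
    by (simp add: mtopology_submetric delone_topology_def)
  show ?thesis
    unfolding top continuous_map_def sub.openin_mtopology sub.topspace_mtopology
  proof (intro iffI conjI ballI allI impI)
    fix N U
    assume f: "f \<in> A \<rightarrow> topspace Y \<and> (\<forall>U. openin Y U \<longrightarrow>
        {x \<in> A. f x \<in> U} \<subseteq> A \<and> (\<forall>x. x \<in> {x \<in> A. f x \<in> U} \<longrightarrow> (\<exists>r>0. sub.mball x r \<subseteq> {x \<in> A. f x \<in> U})))"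
      and N: "N \<in> A" "openin Y U \<and> f N \<in> U"
    then obtain r where "r > 0" "sub.mball N r \<subseteq> {x \<in> A. f x \<in> U}" by blast
    then show "\<exists>\<delta>>0. \<forall>N'\<in>A. delone_dist N N' < \<delta> \<longrightarrow> f N' \<in> U"
      using N(1) by (intro exI[of _ r]) (auto simp: sub.in_mball subset_iff)
  next
    fix U x
    assume f: "f ` A \<subseteq> topspace Y \<and> (\<forall>N\<in>A. \<forall>U. openin Y U \<and> f N \<in> U \<longrightarrow>
       (\<exists>\<delta>>0. \<forall>N'\<in>A. delone_dist N N' < \<delta> \<longrightarrow> f N' \<in> U))"
      and x: "openin Y U" "x \<in> {x \<in> A. f x \<in> U}"
    then obtain \<delta> where "\<delta> > 0" "\<forall>N'\<in>A. delone_dist x N' < \<delta> \<longrightarrow> f N' \<in> U" by blast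
    then show "\<exists>r>0. sub.mball x r \<subseteq> {x \<in> A. f x \<in> U}"
      by (intro exI[of _ \<delta>]) (auto simp: sub.in_mball)
  qed auto
qed

lemma norm_diff_diff_le:
  fixes a b c :: "'a::real_normed_vector"
  shows "norm (a - b - c) \<le> norm a + norm b + norm c"
  using norm_triangle_ineq4[of "a - b" c] norm_triangle_ineq4[of a b] by linarith

lemma norm_fst: "norm (fst p) \<le> norm p" and norm_snd: "norm (snd p) \<le> norm p"
  using norm_fst_le[of "fst p" "snd p"] norm_snd_le[of "snd p" "fst p"] by simp_all

lemma mem_delone_closure:
  "B \<in> delone_topology closure_of S \<longleftrightarrow>
     delone B \<and> (\<forall>e>0. \<exists>A\<in>S. delone A \<and> delone_dist B A < e)"
  unfolding delone_topology_def Metric_space.metric_closure_of[OF Metric_space_delone]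
    Metric_space.in_mball[OF Metric_space_delone] by auto

lemma mem_hull_of:
  "B \<in> hull_of A \<longleftrightarrow>
     delone B \<and> (\<forall>e>0. \<exists>x. delone (shift A x) \<and> delone_dist B (shift A x) < e)"
  unfolding hull_of_def mem_delone_closure by auto

lemma delone_closed: "delone A \<Longrightarrow> closed A"
  by (simp add: delone_def uniform_discrete_imp_closed)

lemma shift_0 [simp]: "shift A 0 = A"
  by (auto simp: in_shift_iff)

lemma delone_dist_self: "delone A \<Longrightarrow> delone_dist A A = 0"
  using Metric_space.mdist_zero[OF Metric_space_delone] by auto

lemma delone_shift:
  assumes "delone A"
  shows "delone (shift A x)"
proof -
  obtain e where e: "e > 0" "\<And>a b. a \<in> A \<Longrightarrow> b \<in> A \<Longrightarrow> dist a b < e \<Longrightarrow> a = b"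
    using assms unfolding delone_def uniform_discrete_def by blast
  obtain R where R: "R > 0" "\<And>z. \<exists>a\<in>A. dist z a \<le> R" using assms by (auto simp: delone_def)
  have "uniform_discrete (shift A x)"
    unfolding uniform_discrete_def
  proof (intro exI[of _ e] conjI ballI impI e(1))
    fix a b assume "a \<in> shift A x" "b \<in> shift A x" "dist a b < e"
    then have "a + x = b + x" by (intro e(2)) (auto simp: in_shift_iff)
    then show "a = b" by simp
  qed
  moreover have "\<exists>a\<in>shift A x. dist z a \<le> R" for z
  proof -
    obtain a where "a \<in> A" "dist (z + x) a \<le> R" using R by blast
    then show ?thesis by (intro bexI[of _ "a - x"]) (auto simp: in_shift_iff dist_norm algebra_simps)
  qed
  ultimately show ?thesis using R(1) unfolding delone_def by blast
qed

context model_scheme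
begin

section \<open>The torus parametrization\<close>

text \<open>Within this radius the points of two nearby model sets are matched by one and the same lattice
  vector: displacements of points are displacements of the cosets.\<close>

definition lift_radius :: "real \<Rightarrow> bool" where
  "lift_radius \<mu> \<longleftrightarrow> \<mu> > 0 \<and> (\<forall>c c' h h' x x'. h \<in> W \<and> h' \<in> W \<and> (h, x) \<in> coset_of \<Gamma> c \<and>
     (h', x') \<in> coset_of \<Gamma> c' \<and> norm (c' - c) < \<mu> \<and> norm (x' - x) < \<mu> \<longrightarrow>
     h' - h = fst (c' - c) \<and> x' - x = snd (c' - c))"

lemma lift_radiusD:
  assumes "lift_radius \<mu>" "h \<in> W" "h' \<in> W" "(h, x) \<in> coset_of \<Gamma> c" "(h', x') \<in> coset_of \<Gamma> c'"
    "norm (c' - c) < \<mu>" "norm (x' - x) < \<mu>"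
  shows "h' - h = fst (c' - c) \<and> x' - x = snd (c' - c)"
  using assms unfolding lift_radius_def by blast

lemma lift_radius_exists: "\<exists>\<mu>. lift_radius \<mu>"
proof -
  obtain \<beta> where \<beta>: "\<And>w. w \<in> W \<Longrightarrow> norm w \<le> \<beta>" using window_bounded by metis
  obtain \<mu> where \<mu>: "\<mu> > 0"
    "\<And>\<gamma>. \<gamma> \<in> \<Gamma> \<Longrightarrow> norm (fst \<gamma>) \<le> 2 * \<beta> + 1 \<Longrightarrow> norm (snd \<gamma>) < \<mu> \<Longrightarrow> \<gamma> = 0"
    using lattice_gap by metis
  have "h' - h = fst (c' - c) \<and> x' - x = snd (c' - c)"
    if h: "h \<in> W" "h' \<in> W" and z: "(h, x) \<in> coset_of \<Gamma> c" "(h', x') \<in> coset_of \<Gamma> c'"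
      and small: "norm (c' - c) < min 1 (\<mu> / 2)" "norm (x' - x) < min 1 (\<mu> / 2)" for c c' h h' x x'
  proof -
    define \<gamma> where "\<gamma> = ((h', x') - c') - ((h, x) - c)"
    have f: "fst \<gamma> = h' - h - fst (c' - c)" and s: "snd \<gamma> = (x' - x) - snd (c' - c)"
      by (auto simp: \<gamma>_def)
    have "\<gamma> \<in> \<Gamma>"
      unfolding \<gamma>_def by (rule lattice_diff[OF z(2)[unfolded mem_coset] z(1)[unfolded mem_coset]])
    moreover have "norm (fst \<gamma>) \<le> 2 * \<beta> + 1"
      using norm_diff_diff_le[of h' h "fst (c' - c)"] \<beta>[OF h(1)] \<beta>[OF h(2)] norm_fst[of "c' - c"] small(1)
      unfolding f by linarith
    moreover have "norm (snd \<gamma>) < \<mu>"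
      unfolding s using norm_triangle_ineq4[of "x' - x" "snd (c' - c)"] norm_snd[of "c' - c"] small
      by linarith
    ultimately have "\<gamma> = 0" by (rule \<mu>(2))
    then show ?thesis using f s by simp
  qed
  then have "lift_radius (min 1 (\<mu> / 2))" unfolding lift_radius_def using \<mu>(1) by auto
  then show ?thesis by blast
qed

text \<open>A point of \<open>N\<close> is a limit of points of the approximating sets.  All of them eventually come from the same
  lattice vector, so their addresses converge, and the limit is in \<open>W\<close> because \<open>W\<close> is closed.  A point of
  the coset with address in the interior of \<open>W\<close> belongs to the approximating sets up to a small translation,
  hence to the closed set \<open>N\<close>.\<close>

lemma param_closed:
  assumes cl: "closed N"
    and approx: "\<And>\<epsilon>. \<epsilon> > 0 \<Longrightarrow> \<exists>N' c'. delone_dist N N' < \<epsilon> \<and> norm (c' - c) < \<epsilon> \<and>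
      param N' (coset_of \<Gamma> c')"
  shows "param N (coset_of \<Gamma> c)"
proof -
  have 1: "x \<in> cut_project W (coset_of \<Gamma> c)" if x: "x \<in> N" for x
  proof -
    obtain \<mu> where lift_\<mu>: "lift_radius \<mu>" using lift_radius_exists by blast
    then have \<mu>: "\<mu> > 0" by (simp add: lift_radius_def)
    \<comment> \<open>\<open>\<mu> / 4\<close>: any two of the approximations below then lie within the lift radius of each other\<close>
    define \<epsilon>0 where "\<epsilon>0 = min (1/2) (min (\<mu> / 4) (1 / (norm x + 2)))"
    have np: "norm x + 2 > 0" by (rule add_nonneg_pos) auto
    have \<epsilon>0: "\<epsilon>0 > 0" "\<epsilon>0 \<le> 1/2" "\<epsilon>0 \<le> \<mu> / 4" "\<epsilon>0 \<le> 1 / (norm x + 2)"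
      using \<mu> np unfolding \<epsilon>0_def by auto
    have lift: "\<exists>h\<in>W. \<exists>y c'. (h, y) \<in> coset_of \<Gamma> c' \<and> dist y x < 2 * \<epsilon> \<and> norm (c' - c) < \<epsilon>"
      if \<epsilon>: "\<epsilon> > 0" "\<epsilon> \<le> \<epsilon>0" for \<epsilon>
    proof -
      obtain N' c' where N': "delone_dist N N' < \<epsilon>" "norm (c' - c) < \<epsilon>" "param N' (coset_of \<Gamma> c')"
        using approx \<epsilon> by blast
      have "1 / \<epsilon>0 \<le> 1 / \<epsilon>" using \<epsilon> by (intro divide_left_mono) auto
      moreover have "norm x + 2 \<le> 1 / \<epsilon>0" using \<epsilon>0(1,4) np by (simp add: field_simps)
      ultimately have "norm x + 1 < 1 / \<epsilon>" by simp
      then obtain y where y: "y \<in> N'" "dist y x < 2 * \<epsilon>"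
        using close_patterns_point[OF N'(1) _ x] \<epsilon> \<epsilon>0 by auto
      then have "y \<in> cut_project W (coset_of \<Gamma> c')" using N'(3) by (auto simp: param_def)
      then show ?thesis using y N'(2) unfolding mem_cut_project by blast
    qed
    obtain h0 y0 c0 where 0: "h0 \<in> W" "(h0, y0) \<in> coset_of \<Gamma> c0" "dist y0 x < 2 * \<epsilon>0" "norm (c0 - c) < \<epsilon>0"
      using lift[OF \<epsilon>0(1)] by auto
    \<comment> \<open>the candidate for the limit: the point of the coset of \<open>c\<close> with the lattice vector of \<open>(h0, y0)\<close>\<close>
    define k z where "k = h0 + fst (c - c0)" and "z = y0 + snd (c - c0)"
    have "(k, z) - c = (h0, y0) - c0" by (simp add: k_def z_def prod_eq_iff)
    then have kz: "(k, z) \<in> coset_of \<Gamma> c" using 0(2) by (simp add: mem_coset)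
    have near: "\<exists>h\<in>W. dist h k < \<epsilon> \<and> dist z x < 3 * \<epsilon>" if \<epsilon>: "\<epsilon> > 0" "\<epsilon> \<le> \<epsilon>0" for \<epsilon>
    proof -
      obtain h y c' where h: "h \<in> W" "(h, y) \<in> coset_of \<Gamma> c'" "dist y x < 2 * \<epsilon>" "norm (c' - c) < \<epsilon>"
        using lift[OF \<epsilon>] by auto
      have "norm (c' - c0) < \<mu>"
        using h(4) 0(4) \<epsilon>(2) \<epsilon>0(1,3) norm_triangle_ineq4[of "c' - c" "c0 - c"] by simp
      moreover have "norm (y - y0) < \<mu>"
        using h(3) 0(3) \<epsilon>(2) \<epsilon>0(3) dist_triangle2[of y y0 x] by (simp add: dist_norm)
      ultimately have "h - h0 = fst (c' - c0) \<and> y - y0 = snd (c' - c0)" by (rule lift_radiusD[OF lift_\<mu> 0(1) h(1) 0(2) h(2)])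
      then have "h - k = fst (c' - c)" "z - y = snd (c - c')" by (auto simp: k_def z_def algebra_simps)
      then have "dist h k < \<epsilon>" "dist z y < \<epsilon>"
        using h(4) norm_fst[of "c' - c"] norm_snd[of "c - c'"] norm_minus_commute[of c c'] by (auto simp: dist_norm)
      then show ?thesis using h(1,3) dist_triangle[of z x y] by auto
    qed
    have "k \<in> closure W"
      unfolding closure_approachable
    proof (intro allI impI)
      fix e :: real assume "e > 0"
      then show "\<exists>y\<in>W. dist y k < e" using near[of "min e \<epsilon>0"] \<epsilon>0(1) by fastforce
    qed
    then have "k \<in> W" using window_closed by simp
    moreover have "z = x"
    proof (rule ccontr)
      assume "z \<noteq> x"
      then have "dist z x > 0" by simp
      moreover define m where "m = min (dist z x / 3) \<epsilon>0"
      ultimately have "m > 0" "m \<le> \<epsilon>0" "m \<le> dist z x / 3"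
        using \<epsilon>0(1) by auto
      then show False using near[of m] by auto
    qed
    ultimately show ?thesis using kz unfolding mem_cut_project by blast
  qed
  have 2: "x \<in> N" if x: "x \<in> cut_project (interior W) (coset_of \<Gamma> c)" for x
  proof -
    obtain h where h: "h \<in> interior W" "(h, x) \<in> coset_of \<Gamma> c" using x by (auto simp: mem_cut_project)
    obtain \<rho> where \<rho>: "\<rho> > 0" "ball h \<rho> \<subseteq> interior W"
      using h(1) open_contains_ball open_interior by blast
    have np: "norm x + 3 > 0" by (rule add_nonneg_pos) auto
    have "x \<in> closure N"
      unfolding closure_approachable
    proof (intro allI impI)
      fix e :: real assume e: "e > 0"
      define \<epsilon> where "\<epsilon> = min (min (e / 3) 1) (min \<rho> (1 / (norm x + 3)))"
      have \<epsilon>: "\<epsilon> > 0" "\<epsilon> \<le> e / 3" "\<epsilon> \<le> 1" "\<epsilon> \<le> \<rho>" "\<epsilon> \<le> 1 / (norm x + 3)"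
        using e \<rho>(1) np unfolding \<epsilon>_def by auto
      obtain N' c' where N': "delone_dist N N' < \<epsilon>" "norm (c' - c) < \<epsilon>" "param N' (coset_of \<Gamma> c')"
        using approx \<epsilon>(1) by blast
      define y where "y = x + snd (c' - c)"
      have "dist (h + fst (c' - c)) h < \<rho>"
        using N'(2) \<epsilon>(4) norm_fst[of "c' - c"] by (simp add: dist_norm)
      then have "h + fst (c' - c) \<in> interior W" using \<rho>(2) by (auto simp: dist_commute)
      moreover have "(h + fst (c' - c), y) - c' = (h, x) - c"
        by (simp add: y_def prod_eq_iff)
      then have "(h + fst (c' - c), y) \<in> coset_of \<Gamma> c'" using h(2) by (simp add: mem_coset)
      ultimately have "y \<in> cut_project (interior W) (coset_of \<Gamma> c')"
        unfolding mem_cut_project by blast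
      then have yN: "y \<in> N'" using N'(3) by (auto simp: param_def)
      have yx: "dist y x < \<epsilon>"
        using N'(2) norm_snd[of "c' - c"] by (simp add: y_def dist_norm)
      have "norm x + 3 \<le> 1 / \<epsilon>" using \<epsilon>(1,5) np by (simp add: field_simps)
      then have "norm y + 1 < 1 / \<epsilon>"
        using yx \<epsilon>(3) norm_triangle_ineq2[of y x] by (simp add: dist_norm)
      then obtain q where "q \<in> N" "dist q y < 2 * \<epsilon>"
        using close_patterns_point[of N' N \<epsilon> y] N'(1) \<epsilon>(3) yN by (auto simp: delone_dist_sym)
      then show "\<exists>q\<in>N. dist q x < e"
        using yx \<epsilon>(2) dist_triangle[of q x y] by (intro bexI[of _ q]) auto
    qed
    then show ?thesis using cl by simp
  qed
  show ?thesis unfolding param_def using 1 2 coset_in_torus by blast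
qed

text \<open>Compactness of the torus, phrased with bounded representatives of the cosets.\<close>

lemma param_limit:
  assumes "closed N"
    and "\<And>k. delone_dist N (Nk k) < 1 / real (Suc k)" "\<And>k. norm (ck k) \<le> r"
    and "\<And>k. param (Nk k) (coset_of \<Gamma> (ck k))"
  obtains c s where "strict_mono s" "(ck \<circ> s) \<longlonglongrightarrow> c" "param N (coset_of \<Gamma> c)"
proof -
  have "compact (cball 0 r :: ('h \<times> 'd) set)" by simp
  then obtain c s where cs: "strict_mono (s :: nat \<Rightarrow> nat)" "(ck \<circ> s) \<longlonglongrightarrow> c"
    unfolding compact_def using assms(3) by (metis mem_cball_0)
  have "param N (coset_of \<Gamma> c)"
  proof (rule param_closed[OF assms(1)])
    fix \<epsilon> :: real assume \<epsilon>: "\<epsilon> > 0"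
    obtain k1 where k1: "\<And>k. k \<ge> k1 \<Longrightarrow> norm (ck (s k) - c) < \<epsilon>"
      using LIMSEQ_D[OF cs(2) \<epsilon>] by auto
    obtain k2 where k2: "1 / real (Suc k2) < \<epsilon>" using \<epsilon> nat_approx_posE by blast
    define k where "k = max k1 k2"
    have "Suc k2 \<le> Suc (s k)" using seq_suble[OF cs(1), of k] by (simp add: k_def)
    then have "1 / real (Suc (s k)) \<le> 1 / real (Suc k2)" by (intro divide_left_mono) auto
    then have "delone_dist N (Nk (s k)) < \<epsilon>" using assms(2)[of "s k"] k2 by linarith
    moreover have "norm (ck (s k) - c) < \<epsilon>" using k1 by (simp add: k_def)
    ultimately show "\<exists>N' c'. delone_dist N N' < \<epsilon> \<and> norm (c' - c) < \<epsilon> \<and> param N' (coset_of \<Gamma> c')"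
      using assms(4) by blast
  qed
  then show ?thesis using that cs by blast
qed

lemma nonsingular_shift:
  assumes "nonsingular \<Gamma> W (coset_of \<Gamma> c)"
  shows "nonsingular \<Gamma> W (coset_of \<Gamma> (c - (0, x)))"
proof -
  have "fst ` coset_of \<Gamma> (c - (0, x)) \<subseteq> fst ` coset_of \<Gamma> c"
    using coset_shift[of _ _ c x] by force
  then show ?thesis using assms coset_in_torus unfolding nonsingular_def by blast
qed

lemma model_hull_delone: "N \<in> model_hull \<Gamma> W \<Longrightarrow> delone N"
  by (auto simp: model_hull_def mem_hull_of)

lemma model_hull_approx:
  assumes "N \<in> model_hull \<Gamma> W" "e > 0"
  obtains c where "nonsingular \<Gamma> W (coset_of \<Gamma> c)"
    "delone_dist N (cut_project W (coset_of \<Gamma> c)) < e"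
proof -
  obtain \<xi> x where \<xi>: "nonsingular \<Gamma> W \<xi>" "delone_dist N (shift (cut_project W \<xi>) x) < e"
    using assms by (auto simp: model_hull_def mem_hull_of)
  moreover obtain c where "\<xi> = coset_of \<Gamma> c" using \<xi>(1) by (auto simp: nonsingular_def torus_def)
  ultimately show ?thesis using that nonsingular_shift cut_project_shift by metis
qed

lemma nonsingular_in_model_hull:
  assumes "nonsingular \<Gamma> W \<xi>"
  shows "cut_project W \<xi> \<in> model_hull \<Gamma> W"
proof -
  have "delone (cut_project W \<xi>)" using assms delone_cut_project by (auto simp: nonsingular_def)
  then have "cut_project W \<xi> \<in> hull_of (cut_project W \<xi>)"
    unfolding mem_hull_of by (intro conjI allI impI exI[of _ 0]) (simp_all add: delone_dist_self)
  then show ?thesis using assms by (auto simp: model_hull_def)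
qed

lemma param_exists:
  assumes "N \<in> model_hull \<Gamma> W"
  shows "\<exists>\<xi>. param N \<xi>"
proof -
  obtain r where r: "\<And>\<xi>. \<xi> \<in> torus \<Gamma> \<Longrightarrow> \<exists>c. norm c \<le> r \<and> \<xi> = coset_of \<Gamma> c"
    using bounded_representatives by metis
  have "\<exists>c. norm c \<le> r \<and> delone_dist N (cut_project W (coset_of \<Gamma> c)) < 1 / real (Suc k)" for k
    using model_hull_approx[OF assms, of "1 / real (Suc k)"] r[OF coset_in_torus]
    by (metis of_nat_0_less_iff zero_less_Suc zero_less_divide_1_iff)
  then obtain ck where "\<And>k. norm (ck k) \<le> r"
    "\<And>k. delone_dist N (cut_project W (coset_of \<Gamma> (ck k))) < 1 / real (Suc k)" by metis
  then show ?thesis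
    using param_limit[of N "\<lambda>k. cut_project W (coset_of \<Gamma> (ck k))" ck r]
      delone_closed[OF model_hull_delone[OF assms]] param_cut_project[OF coset_in_torus] by metis
qed

text \<open>The value off the hull is \<open>undefined\<close> because \<^const>\<open>pi_max\<close> is required to be extensional.\<close>

definition address :: "'d set \<Rightarrow> ('h \<times> 'd) set" where
  "address N = (if N \<in> model_hull \<Gamma> W then THE \<xi>. param N \<xi> else undefined)"

lemma param_address: "N \<in> model_hull \<Gamma> W \<Longrightarrow> param N (address N)"
  using theI'[of "param N"] param_exists param_unique unfolding address_def by auto

lemma address_eqI: "N \<in> model_hull \<Gamma> W \<Longrightarrow> param N \<xi> \<Longrightarrow> address N = \<xi>"
  using param_address param_unique by blast

text \<open>Otherwise a sequence \<open>N\<^sub>k\<close> tending to \<open>N\<close> has addresses outside \<open>U\<close>; a limit of these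
  is still outside the open set \<open>U\<close>, yet it is compatible with \<open>N\<close> and hence the address of \<open>N\<close>.\<close>

lemma address_continuous:
  assumes N: "N \<in> model_hull \<Gamma> W" and U: "openin (torus_topology \<Gamma>) U" "address N \<in> U"
  shows "\<exists>\<delta>>0. \<forall>N'\<in>model_hull \<Gamma> W. delone_dist N N' < \<delta> \<longrightarrow> address N' \<in> U"
proof (rule ccontr)
  assume contra: "\<not> ?thesis"
  obtain r where r: "\<And>\<xi>. \<xi> \<in> torus \<Gamma> \<Longrightarrow> \<exists>c. norm c \<le> r \<and> \<xi> = coset_of \<Gamma> c"
    using bounded_representatives by metis
  have "\<exists>N' c. delone_dist N N' < 1 / real (Suc k) \<and> norm c \<le> r \<and> param N' (coset_of \<Gamma> c) \<and>
      coset_of \<Gamma> c \<notin> U" for k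
  proof -
    have "(0::real) < 1 / real (Suc k)" by simp
    then obtain N' where N': "N' \<in> model_hull \<Gamma> W" "delone_dist N N' < 1 / real (Suc k)"
      "address N' \<notin> U" using contra by blast
    moreover obtain c where "norm c \<le> r" "address N' = coset_of \<Gamma> c"
      using r param_address[OF N'(1)] unfolding param_def by blast
    ultimately show ?thesis using param_address[OF N'(1)] by metis
  qed
  then obtain Nk ck where k: "\<And>k. delone_dist N (Nk k) < 1 / real (Suc k)" "\<And>k. norm (ck k) \<le> r"
    "\<And>k. param (Nk k) (coset_of \<Gamma> (ck k))" "\<And>k. coset_of \<Gamma> (ck k) \<notin> U" by metis
  obtain c s where cs: "strict_mono s" "(ck \<circ> s) \<longlonglongrightarrow> c" "param N (coset_of \<Gamma> c)"
    using param_limit[OF delone_closed[OF model_hull_delone[OF N]] k(1-3)] by metis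
  have "c \<in> coset_of \<Gamma> -` U" using address_eqI[OF N cs(3)] U(2) by simp
  moreover have "open (coset_of \<Gamma> -` U)" using U(1) by (simp add: openin_torus_topology)
  ultimately have "eventually (\<lambda>k. (ck \<circ> s) k \<in> coset_of \<Gamma> -` U) sequentially"
    using cs(2) topological_tendstoD by blast
  then show False using k(4) by (auto simp: eventually_sequentially)
qed

text \<open>Any other continuous map with the values required on nonsingular model sets is compatible with every
  \<open>N\<close> in the hull by \<open>param_closed\<close>, because nonsingular model sets are dense.\<close>

lemma pi_max_eq_address: "pi_max \<Gamma> W = address"
  unfolding pi_max_def
proof (rule the_equality)
  have hull: "model_hull \<Gamma> W \<subseteq> Collect delone" using model_hull_delone by auto
  have "continuous_map (subtopology delone_topology (model_hull \<Gamma> W)) (torus_topology \<Gamma>) address"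
    unfolding continuous_map_delone_iff[OF hull]
    using address_continuous param_address by (auto simp: param_def)
  moreover have "address (cut_project W \<xi>) = \<xi>" if "nonsingular \<Gamma> W \<xi>" for \<xi>
    using that by (intro address_eqI nonsingular_in_model_hull param_cut_project)
      (auto simp: nonsingular_def)
  ultimately show "address \<in> extensional (model_hull \<Gamma> W) \<and>
      continuous_map (subtopology delone_topology (model_hull \<Gamma> W)) (torus_topology \<Gamma>) address \<and>
      (\<forall>\<xi>. nonsingular \<Gamma> W \<xi> \<longrightarrow> address (cut_project W \<xi>) = \<xi>)"
    by (auto simp: extensional_def address_def)
  fix p assume p: "p \<in> extensional (model_hull \<Gamma> W) \<and>
      continuous_map (subtopology delone_topology (model_hull \<Gamma> W)) (torus_topology \<Gamma>) p \<and>
      (\<forall>\<xi>. nonsingular \<Gamma> W \<xi> \<longrightarrow> p (cut_project W \<xi>) = \<xi>)"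
  then have torus: "p N \<in> torus \<Gamma>" if "N \<in> model_hull \<Gamma> W" for N
    using that unfolding continuous_map_delone_iff[OF hull] by auto
  have pns: "p (cut_project W \<xi>) = \<xi>" if "nonsingular \<Gamma> W \<xi>" for \<xi>
    using that p by blast
  have cont: "\<exists>\<delta>>0. \<forall>N'\<in>model_hull \<Gamma> W. delone_dist N N' < \<delta> \<longrightarrow> p N' \<in> U"
    if "N \<in> model_hull \<Gamma> W" "openin (torus_topology \<Gamma>) U" "p N \<in> U" for N U
    using that p unfolding continuous_map_delone_iff[OF hull] by blast
  show "p = address"
  proof
    fix N show "p N = address N"
    proof (cases "N \<in> model_hull \<Gamma> W")
      case False
      then show ?thesis using p by (auto simp: extensional_def address_def)
    next
      case True
      then obtain c where c: "p N = coset_of \<Gamma> c" using torus unfolding torus_def by blast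
      have "param N (coset_of \<Gamma> c)"
      proof (rule param_closed[OF delone_closed[OF model_hull_delone[OF True]]])
        fix \<epsilon> :: real assume \<epsilon>: "\<epsilon> > 0"
        have "p N \<in> coset_of \<Gamma> ` ball c \<epsilon>" using c \<epsilon> by auto
        then obtain \<delta> where \<delta>: "\<delta> > 0"
          "\<And>N'. N' \<in> model_hull \<Gamma> W \<Longrightarrow> delone_dist N N' < \<delta> \<Longrightarrow> p N' \<in> coset_of \<Gamma> ` ball c \<epsilon>"
          using cont[OF True openin_torus_image[OF open_ball], of c \<epsilon>] by metis
        obtain d where d: "nonsingular \<Gamma> W (coset_of \<Gamma> d)"
          "delone_dist N (cut_project W (coset_of \<Gamma> d)) < min \<delta> \<epsilon>"
          using model_hull_approx[OF True, of "min \<delta> \<epsilon>"] \<delta>(1) \<epsilon> by auto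
        then have "p (cut_project W (coset_of \<Gamma> d)) \<in> coset_of \<Gamma> ` ball c \<epsilon>"
          using \<delta>(2) nonsingular_in_model_hull by simp
        then have "coset_of \<Gamma> d \<in> coset_of \<Gamma> ` ball c \<epsilon>" using pns d(1) by simp
        then obtain c' where c': "coset_of \<Gamma> d = coset_of \<Gamma> c'" "c' \<in> ball c \<epsilon>" by blast
        then show "\<exists>N' c'. delone_dist N N' < \<epsilon> \<and> norm (c' - c) < \<epsilon> \<and> param N' (coset_of \<Gamma> c')"
          using d(2) param_cut_project[OF coset_in_torus, of d]
          by (intro exI[of _ "cut_project W (coset_of \<Gamma> d)"] exI[of _ c'])
            (simp add: dist_norm norm_minus_commute)
      qed
      then show ?thesis using address_eqI[OF True] c by simp
    qed
  qed
qed

lemma address_near: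
  assumes N: "N \<in> model_hull \<Gamma> W" "address N = coset_of \<Gamma> c" and \<epsilon>: "\<epsilon> > 0"
  obtains \<delta> where "\<delta> > 0" "\<And>N'. N' \<in> model_hull \<Gamma> W \<Longrightarrow> delone_dist N N' < \<delta> \<Longrightarrow>
    \<exists>c'. address N' = coset_of \<Gamma> c' \<and> norm (c' - c) < \<epsilon>"
proof -
  have "address N \<in> coset_of \<Gamma> ` ball c \<epsilon>" using N(2) \<epsilon> by auto
  then obtain \<delta> where \<delta>: "\<delta> > 0"
    "\<And>N'. N' \<in> model_hull \<Gamma> W \<Longrightarrow> delone_dist N N' < \<delta> \<Longrightarrow> address N' \<in> coset_of \<Gamma> ` ball c \<epsilon>"
    using address_continuous[OF N(1) openin_torus_image[OF open_ball], of c \<epsilon>] by metis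
  have "\<exists>c'. address N' = coset_of \<Gamma> c' \<and> norm (c' - c) < \<epsilon>"
    if "N' \<in> model_hull \<Gamma> W" "delone_dist N N' < \<delta>" for N'
  proof -
    have "address N' \<in> coset_of \<Gamma> ` ball c \<epsilon>" by (rule \<delta>(2)) (use that in auto)
    then obtain c' where "address N' = coset_of \<Gamma> c'" "c' \<in> ball c \<epsilon>" by (rule imageE)
    then show ?thesis by (intro exI[of _ c']) (simp add: dist_norm norm_minus_commute)
  qed
  then show ?thesis using that \<delta>(1) by blast
qed

end

section \<open>Translations, the transversal and the star map\<close>

lemma shift_shift: "shift (shift A x) y = shift A (x + y)"
  by (auto simp: in_shift_iff algebra_simps)

lemma agree_mono: "agree r A B \<Longrightarrow> s \<le> r \<Longrightarrow> agree s A B"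
  by (simp add: agree_iff)

lemma delone_dist_shift:
  assumes "e > 0"
  obtains \<delta> where "\<delta> > 0" "\<And>A B. delone_dist A B < \<delta> \<Longrightarrow> delone_dist (shift A x) (shift B x) < e"
proof -
  define b where "b = min (e / 2) 1"
  have b: "b > 0" "b \<le> 1" "b < e" using assms by (auto simp: b_def)
  \<comment> \<open>shifting by \<open>x\<close> reduces the radius of agreement by \<open>norm x\<close>\<close>
  define \<delta> where "\<delta> = 1 / (1 / b + norm x)"
  have pos: "1 / b + norm x \<ge> 1 / b" "1 / b \<ge> 1" using b by auto
  then have \<delta>: "\<delta> > 0" "\<delta> \<le> b"
    unfolding \<delta>_def using b le_imp_inverse_le[OF pos(1)] order_trans[OF pos(2,1)]
    by (auto simp: divide_inverse)
  have "delone_dist (shift A x) (shift B x) < e" if AB: "delone_dist A B < \<delta>" for A B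
  proof -
    obtain a where a: "0 < a" "a < \<delta>" "close_patterns a A B"
      using delone_dist_less[OF AB] \<delta> b by auto
    then obtain u v where uv: "norm u < a" "norm v < a"
      and pat: "\<And>z. norm z < 1 / a \<Longrightarrow> z + u \<in> A \<longleftrightarrow> z + v \<in> B"
      by (auto simp: close_patterns_def agree_iff in_shift_iff)
    have "1 / \<delta> < 1 / a" using a by (intro divide_strict_left_mono) auto
    then have ab: "1 / b + norm x < 1 / a" by (simp add: \<delta>_def)
    have "z + u \<in> shift A x \<longleftrightarrow> z + v \<in> shift B x" if "norm z < 1 / b" for z
    proof -
      have "norm (z + x) < 1 / a" using norm_triangle_ineq[of z x] that ab by linarith
      then show ?thesis using pat[of "z + x"] by (simp add: in_shift_iff algebra_simps)
    qed
    then have "close_patterns b (shift A x) (shift B x)"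
      unfolding close_patterns_def agree_iff in_shift_iff[of _ "shift _ _"]
      using uv a \<delta> by (intro exI[of _ u] exI[of _ v]) auto
    then show ?thesis using delone_dist_le b by (meson le_less_trans)
  qed
  then show ?thesis using that \<delta>(1) by blast
qed

lemma delone_dist_triangle:
  "delone A \<Longrightarrow> delone B \<Longrightarrow> delone C \<Longrightarrow> delone_dist A C \<le> delone_dist A B + delone_dist B C"
  using Metric_space.triangle[OF Metric_space_delone] by auto

lemma hull_of_trans:
  assumes "M \<in> hull_of A" "N \<in> hull_of M"
  shows "N \<in> hull_of A"
  unfolding mem_hull_of
proof (intro conjI allI impI)
  show N: "delone N" using assms(2) by (simp add: mem_hull_of)
  fix e :: real assume e: "e > 0"
  obtain x where x: "delone (shift M x)" "delone_dist N (shift M x) < e / 2"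
    using assms(2) e unfolding mem_hull_of by (metis half_gt_zero)
  obtain \<delta> where \<delta>: "\<delta> > 0"
    "\<And>A B. delone_dist A B < \<delta> \<Longrightarrow> delone_dist (shift A x) (shift B x) < e / 2"
    using delone_dist_shift[of "e / 2" x] e by (metis half_gt_zero)
  obtain y where y: "delone (shift A y)" "delone_dist M (shift A y) < \<delta>"
    using assms(1) \<delta>(1) unfolding mem_hull_of by blast
  have d: "delone (shift A (y + x))" using delone_shift[OF y(1), of x] by (simp add: shift_shift)
  have "delone_dist (shift M x) (shift A (y + x)) < e / 2"
    using \<delta>(2)[OF y(2)] by (simp add: shift_shift)
  then have "delone_dist N (shift A (y + x)) < e"
    using delone_dist_triangle[OF N x(1) d] x(2) by linarith
  then show "\<exists>x. delone (shift A x) \<and> delone_dist N (shift A x) < e" using d by blast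
qed

text \<open>The closure inside the hull is the closure among all Delone sets, as the hull is closed.\<close>

lemma mem_transversal:
  assumes "delone M"
  shows "N \<in> transversal M \<longleftrightarrow> delone N \<and> (\<forall>e>0. \<exists>x\<in>M. delone_dist N (shift M x) < e)"
proof -
  have d: "delone (shift M x)" for x by (rule delone_shift[OF assms])
  then have "shift M x \<in> hull_of M" for x
    unfolding mem_hull_of by (metis delone_dist_self)
  then have "transversal M = hull_of M \<inter> (delone_topology closure_of (shift M ` M))"
    unfolding transversal_def closure_of_subtopology
    by (metis (no_types, lifting) image_subset_iff inf.absorb2)
  also have "\<dots> = delone_topology closure_of (shift M ` M)"
    unfolding hull_of_def by (intro Int_absorb1 closure_of_mono) auto
  finally show ?thesis using d by (auto simp: mem_delone_closure)
qed

context model_scheme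
begin

lemma hull_in_model_hull: "M \<in> model_hull \<Gamma> W \<Longrightarrow> N \<in> hull_of M \<Longrightarrow> N \<in> model_hull \<Gamma> W"
  using hull_of_trans by (auto simp: model_hull_def)

lemma shift_in_model_hull: "M \<in> model_hull \<Gamma> W \<Longrightarrow> shift M x \<in> model_hull \<Gamma> W"
  using hull_in_model_hull delone_shift[OF model_hull_delone] delone_dist_self
  unfolding mem_hull_of by metis

lemma transversal_in_model_hull:
  assumes "M \<in> model_hull \<Gamma> W" "N \<in> transversal M"
  shows "N \<in> model_hull \<Gamma> W"
proof -
  have "N \<in> topspace (subtopology delone_topology (hull_of M))"
    using assms(2) closure_of_subset_topspace unfolding transversal_def by (rule subsetD[rotated])
  then have "N \<in> hull_of M" by (simp only: topspace_subtopology Int_iff)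
  then show ?thesis by (rule hull_in_model_hull[OF assms(1)])
qed

lemma address_in_torus: "N \<in> model_hull \<Gamma> W \<Longrightarrow> address N \<in> torus \<Gamma>"
  using param_address[of N] by (simp add: param_def)

lemma star_map_eqI:
  assumes "N \<in> model_hull \<Gamma> W" "(h, x) \<in> address N"
  shows "star_map \<Gamma> W N x = h"
  unfolding star_map_def pi_max_eq_address
proof (rule the_equality)
  fix k assume "(k, x) \<in> address N"
  then have "(k, x) = (h, x)"
    by (rule coset_snd_inj[OF address_in_torus[OF assms(1)] _ assms(2)]) simp
  then show "k = h" by simp
qed (rule assms(2))

lemma star_map_mem:
  assumes "N \<in> model_hull \<Gamma> W" "x \<in> N"
  shows "star_map \<Gamma> W N x \<in> W" "(star_map \<Gamma> W N x, x) \<in> address N"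
proof -
  obtain h where "h \<in> W" "(h, x) \<in> address N"
    using param_address[OF assms(1)] assms(2) unfolding param_def subset_iff mem_cut_project by blast
  then show "star_map \<Gamma> W N x \<in> W" "(star_map \<Gamma> W N x, x) \<in> address N"
    using star_map_eqI[OF assms(1)] by auto
qed

lemma mem_if_star_interior:
  assumes "N \<in> model_hull \<Gamma> W" "(h, x) \<in> address N" "h \<in> interior W"
  shows "x \<in> N"
  using param_address[OF assms(1)] assms(2,3) unfolding param_def subset_iff mem_cut_project by blast

lemma star_map_shift:
  assumes "N \<in> model_hull \<Gamma> W" "x \<in> N"
  shows "star_map \<Gamma> W (shift N x) 0 = star_map \<Gamma> W N x"
proof -
  obtain c where c: "address N = coset_of \<Gamma> c" using address_in_torus[OF assms(1)] by (auto simp: torus_def)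
  have "address (shift N x) = coset_of \<Gamma> (c - (0, x))"
    using param_shift param_address[OF assms(1)] c
    by (intro address_eqI shift_in_model_hull assms) auto
  then have "(star_map \<Gamma> W N x, 0) \<in> address (shift N x)"
    using star_map_mem(2)[OF assms] c coset_shift[of _ 0 c x] by simp
  then show ?thesis by (intro star_map_eqI shift_in_model_hull assms)
qed

lemma zero_in_transversal:
  assumes "M \<in> model_hull \<Gamma> W" "N \<in> transversal M"
  shows "0 \<in> N"
proof -
  have M: "delone M" using assms(1) by (rule model_hull_delone)
  have N: "delone N" "\<And>e. e > 0 \<Longrightarrow> \<exists>x\<in>M. delone_dist N (shift M x) < e"
    using assms(2) mem_transversal[OF M] by auto
  have "0 \<in> closure N"
    unfolding closure_approachable
  proof (intro allI impI)
    fix e :: real assume "e > 0"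
    define b where "b = min (e / 2) (1 / 2)"
    have b: "b > 0" "b \<le> 1 / 2" "2 * b \<le> e" using \<open>e > 0\<close> by (auto simp: b_def)
    obtain x where x: "x \<in> M" "delone_dist N (shift M x) < b" using N(2) b(1) by blast
    have "(0::'d) \<in> shift M x" using x(1) by (simp add: in_shift_iff)
    moreover have "norm (0::'d) + 1 < 1 / b" using b by (auto simp: field_simps)
    ultimately obtain q where "q \<in> N" "dist q 0 < 2 * b"
      using close_patterns_point[of "shift M x" N b 0] x(2) b by (auto simp: delone_dist_sym)
    then show "\<exists>q\<in>N. dist q 0 < e" using b(3) by (intro bexI[of _ q]) auto
  qed
  then show ?thesis using delone_closed[OF N(1)] by simp
qed

text \<open>The origin belongs to all members of the transversal, so nearby members assign to it addresses
  that differ by the displacement of their cosets.\<close>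

lemma star_map_continuous:
  assumes M: "M \<in> model_hull \<Gamma> W" and N: "N \<in> transversal M" and e: "e > 0"
  obtains \<delta> where "\<delta> > 0" "\<And>N'. N' \<in> transversal M \<Longrightarrow> delone_dist N N' < \<delta> \<Longrightarrow>
     dist (star_map \<Gamma> W N' 0) (star_map \<Gamma> W N 0) < e"
proof -
  have hull: "N' \<in> model_hull \<Gamma> W" if "N' \<in> transversal M" for N'
    using transversal_in_model_hull[OF M that] .
  obtain \<mu> where lift_\<mu>: "lift_radius \<mu>" using lift_radius_exists by blast
  then have \<mu>: "\<mu> > 0" by (simp add: lift_radius_def)
  obtain c where c: "address N = coset_of \<Gamma> c"
    using address_in_torus[OF hull[OF N]] by (auto simp: torus_def)
  define \<epsilon> where "\<epsilon> = min e \<mu>"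
  have \<epsilon>: "\<epsilon> > 0" "\<epsilon> \<le> e" "\<epsilon> \<le> \<mu>" using e \<mu> by (auto simp: \<epsilon>_def)
  obtain \<delta> where \<delta>: "\<delta> > 0" "\<And>N'. N' \<in> model_hull \<Gamma> W \<Longrightarrow> delone_dist N N' < \<delta> \<Longrightarrow>
    \<exists>c'. address N' = coset_of \<Gamma> c' \<and> norm (c' - c) < \<epsilon>"
    using address_near[OF hull[OF N] c \<epsilon>(1)] by metis
  have "dist (star_map \<Gamma> W N' 0) (star_map \<Gamma> W N 0) < e"
    if N': "N' \<in> transversal M" "delone_dist N N' < \<delta>" for N'
  proof -
    obtain c' where c': "address N' = coset_of \<Gamma> c'" "norm (c' - c) < \<epsilon>"
      using \<delta>(2)[OF hull] N' by blast
    have "(star_map \<Gamma> W N 0, 0) \<in> coset_of \<Gamma> c" "star_map \<Gamma> W N 0 \<in> W"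
      using star_map_mem[OF hull[OF N] zero_in_transversal[OF M N]] c by auto
    moreover have "(star_map \<Gamma> W N' 0, 0) \<in> coset_of \<Gamma> c'" "star_map \<Gamma> W N' 0 \<in> W"
      using star_map_mem[OF hull[OF N'(1)] zero_in_transversal[OF M N'(1)]] c' by auto
    ultimately have "star_map \<Gamma> W N' 0 - star_map \<Gamma> W N 0 = fst (c' - c)"
      using lift_radiusD[OF lift_\<mu>, of "star_map \<Gamma> W N 0" "star_map \<Gamma> W N' 0" 0 c 0 c'] c'(2) \<epsilon>(3) \<mu>
      by simp
    then show ?thesis
      using norm_fst[of "c' - c"] c'(2) \<epsilon>(2) unfolding dist_norm by simp
  qed
  then show ?thesis using that \<delta>(1) by blast
qed

end

section \<open>Recurrence and uniform continuity\<close>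

locale model_set = model_scheme \<Gamma> W
  for \<Gamma> :: "('h::euclidean_space \<times> 'd::euclidean_space) set" and W :: "'h set" +
  fixes M :: "'d set"
  assumes in_hull: "M \<in> model_hull \<Gamma> W"
begin

abbreviation star :: "'d \<Rightarrow> 'h" where "star \<equiv> star_map \<Gamma> W M"

lemma delone_M: "delone M"
  using in_hull by (rule model_hull_delone)

lemma star_mem: "x \<in> M \<Longrightarrow> star x \<in> W" "x \<in> M \<Longrightarrow> (star x, x) \<in> address M"
  using star_map_mem[OF in_hull] by auto

lemma star_lattice: "x \<in> M \<Longrightarrow> y \<in> M \<Longrightarrow> (star y - star x, y - x) \<in> \<Gamma>"
  using coset_diff[OF address_in_torus[OF in_hull] star_mem(2) star_mem(2), of y x] by simp

lemma star_translate:
  assumes "x \<in> M" "\<gamma> \<in> \<Gamma>"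
  shows "(star x + fst \<gamma>, x + snd \<gamma>) \<in> address M" "star (x + snd \<gamma>) = star x + fst \<gamma>"
proof -
  show "(star x + fst \<gamma>, x + snd \<gamma>) \<in> address M"
    using coset_add[OF address_in_torus[OF in_hull] star_mem(2)[OF assms(1)] assms(2)]
    by (metis add.commute add_Pair prod.collapse)
  then show "star (x + snd \<gamma>) = star x + fst \<gamma>" by (rule star_map_eqI[OF in_hull])
qed

lemma translate_in_M:
  "x \<in> M \<Longrightarrow> \<gamma> \<in> \<Gamma> \<Longrightarrow> star x + fst \<gamma> \<in> interior W \<Longrightarrow> x + snd \<gamma> \<in> M"
  using mem_if_star_interior[OF in_hull star_translate(1)] .

lemma dense_in_M:
  assumes "open U" "U \<inter> interior W \<noteq> {}"
  obtains x where "x \<in> M" "star x \<in> U" "star x \<in> interior W"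
proof -
  obtain h x where "(h, x) \<in> address M" "h \<in> U \<inter> interior W"
    using coset_dense[OF address_in_torus[OF in_hull], of "U \<inter> interior W"] assms
    by (metis open_Int open_interior prod.collapse)
  then show ?thesis using that[of x] mem_if_star_interior[OF in_hull] star_map_eqI[OF in_hull] by auto
qed

text \<open>If \<open>M\<close> is singular, a hyperplane may contain the addresses of infinitely many of its points, and \<open>star x\<close>
  may lie on the boundary of the window.  A nearby nonsingular model set \<open>N\<close> shows the pattern around \<open>x\<close> at a point
  whose address \<open>h\<close>, and all whose relevant translates, avoid the boundary.  Then all addresses in an open set \<open>U\<close> around \<open>h\<close>
  give this pattern, and \<open>M\<close> has points with generic address in \<open>U\<close>.\<close>

lemma regular_recurrence:
  assumes x: "x \<in> M" and \<eta>: "\<eta> > 0" and A: "finite A" "\<And>c s. (c, s) \<in> A \<Longrightarrow> c \<noteq> (0::'h)"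
  obtains y where "y \<in> M" "agree r (shift M x) (shift M y)" "dist (star y) (star x) < \<eta>"
    "\<forall>(c, s)\<in>A. c \<bullet> star y \<noteq> s"
proof -
  obtain \<beta> where \<beta>: "\<And>w. w \<in> W \<Longrightarrow> norm w \<le> \<beta>" "\<beta> > 0" using window_bounded by metis
  have \<beta>2: "norm (v - w) \<le> 2 * \<beta>" if "v \<in> W" "w \<in> W" for v w
    using norm_triangle_ineq4[of v w] \<beta>(1)[OF that(1)] \<beta>(1)[OF that(2)] by linarith
  obtain \<mu> where lift_\<mu>: "lift_radius \<mu>" using lift_radius_exists by blast
  then have \<mu>: "\<mu> > 0" by (simp add: lift_radius_def)
  define r' where "r' = max r 1"
  have np: "norm x + r' + 1 > 0" using norm_ge_zero[of x] unfolding r'_def by linarith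
  define \<epsilon> where "\<epsilon> = min (min (1/2) (\<mu> / 2)) (min (\<eta> / 2) (1 / (norm x + r' + 1)))"
  have \<epsilon>: "\<epsilon> > 0" "\<epsilon> \<le> 1/2" "\<epsilon> \<le> \<mu> / 2" "\<epsilon> \<le> \<eta> / 2" "\<epsilon> \<le> 1 / (norm x + r' + 1)"
    using \<mu> \<eta> np by (auto simp: \<epsilon>_def)
  obtain c where c: "address M = coset_of \<Gamma> c"
    using address_in_torus[OF in_hull] by (auto simp: torus_def)
  obtain \<delta> where \<delta>: "\<delta> > 0" "\<And>N'. N' \<in> model_hull \<Gamma> W \<Longrightarrow> delone_dist M N' < \<delta> \<Longrightarrow>
    \<exists>c'. address N' = coset_of \<Gamma> c' \<and> norm (c' - c) < \<epsilon>"
    using address_near[OF in_hull c \<epsilon>(1)] by metis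
  obtain d where d: "nonsingular \<Gamma> W (coset_of \<Gamma> d)"
    "delone_dist M (cut_project W (coset_of \<Gamma> d)) < min \<delta> \<epsilon>"
    using model_hull_approx[OF in_hull, of "min \<delta> \<epsilon>"] \<delta>(1) \<epsilon>(1) by auto
  define N where "N = cut_project W (coset_of \<Gamma> d)"
  have N: "N \<in> model_hull \<Gamma> W" unfolding N_def by (rule nonsingular_in_model_hull[OF d(1)])
  have addrN: "address N = coset_of \<Gamma> d"
    by (rule address_eqI[OF N]) (simp add: N_def param_cut_project coset_in_torus)
  obtain c' where c': "coset_of \<Gamma> d = coset_of \<Gamma> c'" "norm (c' - c) < \<epsilon>"
    using \<delta>(2)[OF N] d(2) addrN by (auto simp: N_def)
  have Ntor: "coset_of \<Gamma> d \<in> torus \<Gamma>" by (rule coset_in_torus)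
  have "delone_dist M N < \<epsilon>" "\<epsilon> \<le> 1" using d(2) \<epsilon> by (auto simp: N_def)
  then obtain a where a: "0 < a" "a < \<epsilon>" "close_patterns a M N" by (rule delone_dist_less)
  then obtain u v where uv: "norm u < a" "norm v < a"
    and MN: "\<And>z. norm z < 1 / a \<Longrightarrow> z + u \<in> M \<longleftrightarrow> z + v \<in> N"
    by (auto simp: close_patterns_def agree_iff in_shift_iff)
  have "1 / \<epsilon> < 1 / a" using a(1,2) by (intro divide_strict_left_mono) auto
  moreover have "norm x + r' + 1 \<le> 1 / \<epsilon>" using \<epsilon>(1,5) np by (simp add: field_simps)
  ultimately have a1: "norm x + r' + 1 < 1 / a" by linarith
  \<comment> \<open>\<open>e\<close> is the small translation that takes the pattern of \<open>M\<close> around \<open>x\<close> to that of \<open>N\<close>\<close>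
  define e where "e = v - u"
  have e: "norm e < 2 * \<epsilon>" using norm_triangle_ineq4[of v u] uv a by (simp add: e_def)
  have pat: "z + x \<in> M \<longleftrightarrow> z + x + e \<in> N" if "norm z < r'" for z
  proof -
    have "norm (z + x - u) < 1 / a"
      using norm_triangle_ineq4[of "z + x" u] norm_triangle_ineq[of z x] that a1 uv a \<epsilon> by linarith
    then show ?thesis using MN[of "z + x - u"] by (simp add: e_def algebra_simps)
  qed
  have r': "r' \<ge> 1" "r' \<ge> r" by (auto simp: r'_def)
  then have "x + e \<in> N" using pat[of 0] x by simp
  then obtain h where h: "h \<in> W" "(h, x + e) \<in> coset_of \<Gamma> d"
    by (auto simp: N_def mem_cut_project)
  have dist_h: "dist h (star x) < \<eta> / 2"
  proof -
    have "(star x, x) \<in> coset_of \<Gamma> c" using star_mem(2)[OF x] c by simp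
    moreover have "(h, x + e) \<in> coset_of \<Gamma> c'" using h(2) c'(1) by simp
    ultimately have "h - star x = fst (c' - c)"
      using lift_radiusD[OF lift_\<mu> star_mem(1)[OF x] h(1)] c'(2) e \<epsilon>(1,3) by simp
    then show ?thesis using norm_fst[of "c' - c"] c'(2) \<epsilon>(4) by (simp add: dist_norm)
  qed
  define V where "V = {\<gamma> \<in> \<Gamma>. norm (fst \<gamma>) \<le> 2 * \<beta> \<and> norm (snd \<gamma>) \<le> r'}"
  have V: "finite V" unfolding V_def by (rule lattice_finite)
  have V0: "0 \<in> V" using lattice_zero \<beta>(2) r' by (simp add: V_def)
  \<comment> \<open>addresses \<open>k\<close> with \<open>k + fst \<gamma> \<in> T \<gamma>\<close> see the same as \<open>h\<close> at \<open>\<gamma>\<close>\<close>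
  define T where "T \<gamma> = (if h + fst \<gamma> \<in> W then interior W else - W)" for \<gamma> :: "'h \<times> 'd"
  have opT: "open (T \<gamma>)" for \<gamma> using window_closed by (auto simp: T_def)
  have hT: "h + fst \<gamma> \<in> T \<gamma>" if "\<gamma> \<in> \<Gamma>" for \<gamma>
  proof -
    have "(h, x + e) + \<gamma> \<in> coset_of \<Gamma> d" by (rule coset_add[OF Ntor h(2) that])
    then have "h + fst \<gamma> \<in> fst ` coset_of \<Gamma> d" by (metis fst_add fst_conv imageI)
    then have "h + fst \<gamma> \<notin> frontier W" using d(1) by (auto simp: nonsingular_def)
    then show ?thesis using window_closed by (auto simp: T_def frontier_def)
  qed
  define U where "U = ball h (\<eta> / 2) \<inter> (\<Inter>\<gamma>\<in>V. (\<lambda>k. k + fst \<gamma>) -` T \<gamma>)"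
  have "open U"
    unfolding U_def using V opT by (intro open_Int open_ball open_INT ballI open_vimage continuous_intros)
  moreover have "h \<in> U" using \<eta> hT by (auto simp: U_def V_def)
  ultimately obtain k0 where k0: "k0 \<in> U" "\<forall>(c, s)\<in>A. c \<bullet> k0 \<noteq> s"
    using open_meets_generic[OF A(1) _ \<open>open U\<close>] A(2) by blast
  then have "open (U \<inter> {z. \<forall>(c, s)\<in>A. c \<bullet> z \<noteq> s})" "U \<inter> {z. \<forall>(c, s)\<in>A. c \<bullet> z \<noteq> s} \<noteq> {}"
    using \<open>open U\<close> open_off_hyperplanes[OF A(1)] by auto
  then obtain k y where k: "(k, y) \<in> address M" "k \<in> U" "\<forall>(c, s)\<in>A. c \<bullet> k \<noteq> s"
    using coset_dense[OF address_in_torus[OF in_hull]] by (metis (no_types, lifting) IntD1 IntD2 mem_Collect_eq prod.collapse)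
  have kT: "k + fst \<gamma> \<in> T \<gamma>" if "\<gamma> \<in> V" for \<gamma> using k(2) that by (auto simp: U_def)
  have kW: "k \<in> interior W" using kT[OF V0] h(1) by (simp add: T_def)
  then have y: "y \<in> M" using mem_if_star_interior[OF in_hull k(1)] by simp
  have sy: "star y = k" by (rule star_map_eqI[OF in_hull k(1)])
  have "dist (star y) (star x) < \<eta>"
    using k(2) dist_h sy dist_triangle[of k "star x" h] by (auto simp: U_def dist_commute)
  moreover have "agree r (shift M x) (shift M y)"
    unfolding agree_iff in_shift_iff
  proof (intro allI impI)
    fix z :: 'd assume "norm z < r"
    then have z: "norm z < r'" using r' by simp
    have "z + x + e \<in> N \<longleftrightarrow> z + y \<in> M"
    proof
      assume "z + x + e \<in> N"
      then obtain g where g: "g \<in> W" "(g, z + x + e) \<in> coset_of \<Gamma> d"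
        by (auto simp: N_def mem_cut_project)
      define \<gamma> where "\<gamma> = (g, z + x + e) - (h, x + e)"
      have \<gamma>: "fst \<gamma> = g - h" "snd \<gamma> = z" by (auto simp: \<gamma>_def)
      have \<gamma>V: "\<gamma> \<in> V"
        using coset_diff[OF Ntor g(2) h(2)] \<beta>2[OF g(1) h(1)] z \<gamma> by (simp add: V_def \<gamma>_def)
      then have "k + fst \<gamma> \<in> interior W" using kT[of \<gamma>] g(1) \<gamma> by (simp add: T_def)
      then have "y + snd \<gamma> \<in> M" using translate_in_M[OF y, of \<gamma>] \<gamma>V sy by (simp add: V_def)
      then show "z + y \<in> M" using \<gamma> by (simp add: add.commute)
    next
      assume zy: "z + y \<in> M"
      define \<gamma> where "\<gamma> = (star (z + y) - star y, z)"
      have \<gamma>V: "\<gamma> \<in> V"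
        using star_lattice[OF y zy] \<beta>2[OF star_mem(1)[OF zy] star_mem(1)[OF y]] z
        by (simp add: V_def \<gamma>_def)
      have "k + fst \<gamma> \<in> W" using star_mem(1)[OF zy] sy by (simp add: \<gamma>_def)
      then have "h + fst \<gamma> \<in> W" using kT[OF \<gamma>V] by (auto simp: T_def split: if_splits)
      moreover have "(h, x + e) + \<gamma> \<in> coset_of \<Gamma> d"
        using \<gamma>V by (intro coset_add[OF Ntor h(2)]) (simp add: V_def)
      ultimately show "z + x + e \<in> N"
        unfolding N_def mem_cut_project by (intro bexI[of _ "h + fst \<gamma>"]) (auto simp: \<gamma>_def algebra_simps)
    qed
    then show "z + x \<in> M \<longleftrightarrow> z + y \<in> M" using pat[OF z] by simp
  qed
  ultimately show ?thesis using that y k(3) sy by blast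
qed

text \<open>The vectors between points of \<open>M\<close> at bounded distance come from finitely many lattice vectors.\<close>

lemma finite_local_complexity: "finite ((\<lambda>x. shift M x \<inter> ball 0 r) ` M)"
proof -
  obtain \<beta> where \<beta>: "\<And>w. w \<in> W \<Longrightarrow> norm w \<le> \<beta>" using window_bounded by metis
  define V where "V = {\<gamma> \<in> \<Gamma>. norm (fst \<gamma>) \<le> 2 * \<beta> \<and> norm (snd \<gamma>) \<le> r}"
  have "finite (Pow (snd ` V))" unfolding V_def using lattice_finite by blast
  moreover have "(\<lambda>x. shift M x \<inter> ball 0 r) ` M \<subseteq> Pow (snd ` V)"
  proof clarify
    fix x z assume x: "x \<in> M" and z: "z \<in> shift M x" "z \<in> ball 0 r"
    then have zx: "z + x \<in> M" by (simp add: in_shift_iff)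
    have "norm (star (z + x) - star x) \<le> 2 * \<beta>"
      using norm_triangle_ineq4[of "star (z + x)" "star x"] \<beta>[OF star_mem(1)[OF zx]] \<beta>[OF star_mem(1)[OF x]]
      by linarith
    then have "(star (z + x) - star x, z) \<in> V" using star_lattice[OF x zx] z by (simp add: V_def)
    then show "z \<in> snd ` V" by force
  qed
  ultimately show ?thesis by (rule finite_subset[rotated])
qed

text \<open>Compactness of the transversal: by finite local complexity a diagonal subsequence stabilizes on
  every ball.\<close>

lemma transversal_limit:
  fixes x :: "nat \<Rightarrow> 'd"
  assumes x: "\<And>k. x k \<in> M"
  obtains d N where "strict_mono d" "N \<in> transversal M"
    "\<And>n i. i > n \<Longrightarrow> agree (real n) N (shift M (x (d i)))"
proof -
  define P where "P n s \<longleftrightarrow> (\<forall>i j. shift M (x (s i)) \<inter> ball 0 (real n) = shift M (x (s j)) \<inter> ball 0 (real n))"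
    for n and s :: "nat \<Rightarrow> nat"
  interpret subseqs P
  proof
    fix n and s :: "nat \<Rightarrow> nat" assume "strict_mono s"
    define f where "f i = shift M (x (s i)) \<inter> ball 0 (real n)" for i
    have "finite (range f)"
      by (rule finite_subset[OF _ finite_local_complexity[of "real n"]]) (use x in \<open>auto simp: f_def\<close>)
    then obtain i0 where i0: "infinite {i. f i = f i0}"
      using pigeonhole_infinite[of UNIV f] by auto
    define r where "r = enumerate {i. f i = f i0}"
    have "strict_mono r" unfolding r_def by (rule strict_mono_enumerate[OF i0])
    moreover have "f (r i) = f i0" for i using enumerate_in_set[OF i0, of i] by (simp add: r_def)
    then have "P n (s \<circ> r)" by (auto simp: P_def f_def)
    ultimately show "\<exists>r. strict_mono r \<and> P n (s \<circ> r)" by blast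
  qed
  define d where "d = diagseq"
  have d: "strict_mono d" unfolding d_def by (rule subseq_diagseq)
  have "P n (d \<circ> ((+) (Suc n)))" for n
    unfolding d_def by (rule diagseq_holds) (simp add: P_def)
  then have ag: "z \<in> shift M (x (d i)) \<longleftrightarrow> z \<in> shift M (x (d j))"
    if "i > n" "j > n" "norm z < real n" for n i j z
    using that \<open>\<And>n. P n (d \<circ> ((+) (Suc n)))\<close>[of n, unfolded P_def, rule_format, of "i - Suc n" "j - Suc n"]
    by (auto simp: set_eq_iff)
  define N where "N = {z. \<exists>n. norm z < real n \<and> z \<in> shift M (x (d (Suc n)))}"
  have N: "agree (real n) N (shift M (x (d i)))" if i: "i > n" for n i
    unfolding agree_iff
  proof (intro allI impI iffI)
    fix z :: 'd assume z: "norm z < real n"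
    {
      assume "z \<in> N"
      then obtain m where m: "norm z < real m" "z \<in> shift M (x (d (Suc m)))" by (auto simp: N_def)
      define j where "j = Suc (max m n)"
      have "z \<in> shift M (x (d j))" using ag[of m "Suc m" j z] m by (simp add: j_def)
      then show "z \<in> shift M (x (d i))" using ag[of n j i z] z i by (simp add: j_def)
    next
      assume "z \<in> shift M (x (d i))"
      then have "z \<in> shift M (x (d (Suc n)))" using ag[of n i "Suc n" z] z i by simp
      then show "z \<in> N" using z by (auto simp: N_def)
    }
  qed
  have "delone N"
  proof -
    obtain e where e: "e > 0" "\<And>a b. a \<in> M \<Longrightarrow> b \<in> M \<Longrightarrow> dist a b < e \<Longrightarrow> a = b"
      using delone_M unfolding delone_def uniform_discrete_def by blast
    obtain R where R: "R > 0" "\<And>z. \<exists>a\<in>M. dist z a \<le> R" using delone_M by (auto simp: delone_def)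
    have "a = b" if ab: "a \<in> N" "b \<in> N" "dist a b < e" for a b
    proof -
      obtain n :: nat where n: "max (norm a) (norm b) < real n" using reals_Archimedean2 by blast
      have "a \<in> shift M (x (d (Suc n)))" "b \<in> shift M (x (d (Suc n)))"
        using N[of n "Suc n"] ab n by (auto simp: agree_iff)
      then have "a + x (d (Suc n)) = b + x (d (Suc n))"
        using ab(3) by (intro e(2)) (auto simp: in_shift_iff)
      then show ?thesis by simp
    qed
    moreover have "\<exists>a\<in>N. dist z a \<le> R" for z
    proof -
      obtain n :: nat where n: "norm z + R < real n" using reals_Archimedean2 by blast
      obtain a where a: "a \<in> M" "dist (z + x (d (Suc n))) a \<le> R" using R by blast
      define b where "b = a - x (d (Suc n))"
      have b: "dist z b \<le> R" using a(2) by (simp add: b_def dist_norm algebra_simps)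
      then have "norm b < real n" using n norm_triangle_ineq2[of b z] by (simp add: dist_norm norm_minus_commute)
      then have "b \<in> N" using N[of n "Suc n"] a(1) by (auto simp: agree_iff in_shift_iff b_def)
      then show ?thesis using b by blast
    qed
    ultimately show ?thesis unfolding delone_def uniform_discrete_def using e(1) R(1) by blast
  qed
  moreover have "\<exists>y\<in>M. delone_dist N (shift M y) < \<epsilon>" if \<epsilon>: "\<epsilon> > 0" for \<epsilon>
  proof -
    obtain n where n: "1 / real (Suc n) < \<epsilon>" using \<epsilon> nat_approx_posE by blast
    have "agree (real (Suc n)) N (shift M (x (d (n + 2))))" by (rule N) simp
    then have "close_patterns (1 / real (Suc n)) N (shift M (x (d (n + 2))))"
      unfolding close_patterns_def by (intro exI[of _ 0]) simp
    then have "delone_dist N (shift M (x (d (n + 2)))) \<le> 1 / real (Suc n)"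
      by (intro delone_dist_le) auto
    then show ?thesis using n x by (meson le_less_trans)
  qed
  ultimately have "N \<in> transversal M" unfolding mem_transversal[OF delone_M] by blast
  then show ?thesis using that d N by blast
qed

lemma agree_delone_dist: "n > 0 \<Longrightarrow> agree (real n) A B \<Longrightarrow> delone_dist A B \<le> 1 / real n"
  by (rule delone_dist_le) (auto simp: close_patterns_def intro!: exI[of _ 0])

lemma transversal_delone: "transversal M \<subseteq> Collect delone"
  using mem_transversal[OF delone_M] by auto

text \<open>A continuous function on the compact transversal is uniformly continuous.\<close>

lemma wpe_uniform:
  fixes F :: "'d \<Rightarrow> 'y::metric_space"
  assumes F: "wpe M F" and \<epsilon>: "\<epsilon> > 0"
  obtains r where "r > 0"
    "\<And>x y. x \<in> M \<Longrightarrow> y \<in> M \<Longrightarrow> agree r (shift M x) (shift M y) \<Longrightarrow> dist (F x) (F y) < \<epsilon>"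
proof -
  obtain Ft where Ft: "continuous_map (subtopology delone_topology (transversal M)) euclidean Ft"
    "\<And>x. x \<in> M \<Longrightarrow> F x = Ft (shift M x)"
    using F unfolding wpe_def wpe_ext_def by blast
  have "\<exists>r>0. \<forall>x\<in>M. \<forall>y\<in>M. agree r (shift M x) (shift M y) \<longrightarrow> dist (F x) (F y) < \<epsilon>"
  proof (rule ccontr)
    assume "\<not> ?thesis"
    then have "\<exists>x y. x \<in> M \<and> y \<in> M \<and> agree (real (Suc k)) (shift M x) (shift M y) \<and>
      \<not> dist (F x) (F y) < \<epsilon>" for k
      by (metis of_nat_0_less_iff zero_less_Suc)
    then obtain x y where xy: "\<And>k. x k \<in> M" "\<And>k. y k \<in> M"
      "\<And>k. agree (real (Suc k)) (shift M (x k)) (shift M (y k))"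
      "\<And>k. \<not> dist (F (x k)) (F (y k)) < \<epsilon>" by metis
    obtain d N where dN: "strict_mono d" "N \<in> transversal M"
      "\<And>n i. i > n \<Longrightarrow> agree (real n) N (shift M (x (d i)))"
      using transversal_limit[of x] xy(1) by metis
    have "openin euclidean (ball (Ft N) (\<epsilon> / 2))" "Ft N \<in> ball (Ft N) (\<epsilon> / 2)" using \<epsilon> by auto
    then obtain \<delta> where \<delta>: "\<delta> > 0"
      "\<And>N'. N' \<in> transversal M \<Longrightarrow> delone_dist N N' < \<delta> \<Longrightarrow> Ft N' \<in> ball (Ft N) (\<epsilon> / 2)"
      using Ft(1) dN(2) unfolding continuous_map_delone_iff[OF transversal_delone] by metis
    obtain n where n: "1 / real (Suc n) < \<delta>" using \<delta>(1) nat_approx_posE by blast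
    define k where "k = d (Suc (Suc n))"
    have ax: "agree (real (Suc n)) N (shift M (x k))" unfolding k_def by (rule dN) simp
    have "k \<ge> Suc n" unfolding k_def using seq_suble[OF dN(1), of "Suc (Suc n)"] by simp
    then have ay: "agree (real (Suc n)) N (shift M (y k))"
      using ax agree_mono[OF xy(3)[of k], of "real (Suc n)"] by (auto simp: agree_iff)
    have "shift M z \<in> transversal M" if "z \<in> M" for z
      unfolding mem_transversal[OF delone_M] using that delone_dist_self delone_shift[OF delone_M] by metis
    then have "Ft (shift M (x k)) \<in> ball (Ft N) (\<epsilon> / 2)" "Ft (shift M (y k)) \<in> ball (Ft N) (\<epsilon> / 2)"
      using \<delta>(2) agree_delone_dist[OF _ ax] agree_delone_dist[OF _ ay] n xy(1,2) by auto
    then have "dist (F (x k)) (F (y k)) < \<epsilon>"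
      using Ft(2) xy(1,2) dist_triangle3[of "F (x k)" "F (y k)" "Ft N"] by auto
    then show False using xy(4) by blast
  qed
  then show ?thesis using that by blast
qed

end

section \<open>Chambers of hyperplane arrangements\<close>

definition off_planes :: "('a::euclidean_space \<times> real) set \<Rightarrow> 'a \<Rightarrow> bool" where
  "off_planes A h \<longleftrightarrow> (\<forall>(c, s)\<in>A. c \<bullet> h \<noteq> s)"

definition separators :: "('a::euclidean_space \<times> real) set \<Rightarrow> 'a \<Rightarrow> 'a \<Rightarrow> ('a \<times> real) set" where
  "separators A h k = {(c, s)\<in>A. (c \<bullet> h < s) \<noteq> (c \<bullet> k < s)}"

definition chamber :: "('a::euclidean_space \<times> real) set \<Rightarrow> 'a \<Rightarrow> 'a set" where
  "chamber A h = {k. off_planes A k \<and> separators A h k = {}}"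

lemma chamber_eq_Inter:
  assumes "off_planes A h"
  shows "chamber A h = (\<Inter>(c, s)\<in>A. if c \<bullet> h < s then {k. c \<bullet> k < s} else {k. c \<bullet> k > s})"
  unfolding chamber_def separators_def off_planes_def
proof (intro set_eqI iffI)
  fix k
  assume k: "k \<in> (\<Inter>(c, s)\<in>A. if c \<bullet> h < s then {k. c \<bullet> k < s} else {k. c \<bullet> k > s})"
  have "(c \<bullet> h < s \<longrightarrow> c \<bullet> k < s) \<and> (\<not> c \<bullet> h < s \<longrightarrow> c \<bullet> k > s)" if "(c, s) \<in> A" for c s
    using bspec[OF k[unfolded INT_iff] that] by (auto split: if_splits)
  then show "k \<in> {k. (\<forall>(c, s)\<in>A. c \<bullet> k \<noteq> s) \<and> {(c, s). (c, s) \<in> A \<and> (c \<bullet> h < s) \<noteq> (c \<bullet> k < s)} = {}}"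
    by fastforce
qed (force split: if_splits)

lemma chamber_open: "finite A \<Longrightarrow> off_planes A h \<Longrightarrow> open (chamber A h)"
  unfolding chamber_eq_Inter
  by (intro open_INT) (auto simp: open_halfspace_lt open_halfspace_gt)

lemma chamber_convex: "off_planes A h \<Longrightarrow> convex (chamber A h)"
  unfolding chamber_eq_Inter
  by (intro convex_INT) (auto simp: convex_halfspace_lt convex_halfspace_gt)

lemma chamber_self: "off_planes A h \<Longrightarrow> h \<in> chamber A h"
  by (auto simp: chamber_def separators_def)

lemma chamber_eq: "k \<in> chamber A h \<Longrightarrow> chamber A k = chamber A h"
  unfolding chamber_def separators_def by fastforce

lemma separators_chamber:
  "h' \<in> chamber A h \<Longrightarrow> k' \<in> chamber A k \<Longrightarrow> separators A h' k' = separators A h k"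
  unfolding chamber_def separators_def by fastforce

lemma separators_mono: "A \<subseteq> B \<Longrightarrow> separators A h k \<subseteq> separators B h k"
  by (auto simp: separators_def)

lemma off_planes_mono: "A \<subseteq> B \<Longrightarrow> off_planes B h \<Longrightarrow> off_planes A h"
  by (auto simp: off_planes_def)

text \<open>Walk from \<open>h\<close> to a generic point \<open>y\<close> of the chamber of \<open>k\<close>.  The planes are then crossed at different times, and
  just after the first crossing exactly one plane has been crossed.\<close>

lemma adjacent_chamber:
  fixes A :: "('a::euclidean_space \<times> real) set"
  assumes A: "finite A"
    and np: "\<And>c s c' s'. (c, s) \<in> A \<Longrightarrow> (c', s') \<in> A \<Longrightarrow> c \<noteq> c' \<Longrightarrow> \<forall>a b. a *\<^sub>R c = b *\<^sub>R c' \<longrightarrow> a = 0"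
    and nz: "\<And>c s. (c, s) \<in> A \<Longrightarrow> c \<noteq> 0"
    and h: "off_planes A h" and k: "off_planes A k" and sep: "separators A h k \<noteq> {}"
  obtains U p where "open U" "U \<noteq> {}" "p \<in> separators A h k"
    "\<And>z. z \<in> U \<Longrightarrow> off_planes A z \<and> separators A h z = {p} \<and>
       separators A z k = separators A h k - {p}"
proof -
  \<comment> \<open>a segment from \<open>h\<close> to \<open>y\<close> meets \<open>p\<close> and \<open>q\<close> at the same time iff \<open>y - h\<close> is orthogonal to \<open>n p q\<close>\<close>
  define n where "n p q = (snd p - fst p \<bullet> h) *\<^sub>R fst q - (snd q - fst q \<bullet> h) *\<^sub>R fst p" for p q :: "'a \<times> real"
  have n0: "n p q \<noteq> 0" if pq: "p \<in> A" "q \<in> A" "p \<noteq> q" for p q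
  proof (cases "fst p = fst q")
    case True
    then have "n p q = (snd p - snd q) *\<^sub>R fst p" by (simp add: n_def algebra_simps)
    moreover have "snd p \<noteq> snd q" using True pq(3) by (simp add: prod_eq_iff)
    moreover have "fst p \<noteq> 0" using nz[of "fst p" "snd p"] pq(1) by simp
    ultimately show ?thesis by simp
  next
    case False
    show ?thesis
    proof
      assume "n p q = 0"
      then have "(snd p - fst p \<bullet> h) *\<^sub>R fst q = (snd q - fst q \<bullet> h) *\<^sub>R fst p" by (simp add: n_def)
      then have "snd p - fst p \<bullet> h = 0"
        using np[of "fst q" "snd q" "fst p" "snd p"] pq False by auto
      then show False using h pq(1) by (auto simp: off_planes_def split_beta)
    qed
  qed
  define D where "D = (\<lambda>(p, q). (n p q, n p q \<bullet> h)) ` {(p, q)\<in>A \<times> A. p \<noteq> q}"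
  have "finite D" unfolding D_def using A by (intro finite_imageI finite_subset[OF _ finite_cartesian_product[OF A A]]) auto
  moreover have "\<And>c s. (c, s) \<in> D \<Longrightarrow> c \<noteq> 0" using n0 by (auto simp: D_def)
  moreover have "open (chamber A k)" "chamber A k \<noteq> {}"
    using chamber_open[OF A k] chamber_self[OF k] by auto
  ultimately obtain y where y: "y \<in> chamber A k" "\<forall>(c, s)\<in>D. c \<bullet> y \<noteq> s"
    using open_meets_generic by blast
  have gen: "n p q \<bullet> (y - h) \<noteq> 0" if "p \<in> A" "q \<in> A" "p \<noteq> q" for p q
  proof -
    have "(n p q, n p q \<bullet> h) \<in> D" unfolding D_def using that by (intro image_eqI[of _ _ "(p, q)"]) auto
    then have "n p q \<bullet> y \<noteq> n p q \<bullet> h" using y(2) by blast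
    then show ?thesis by (simp add: inner_diff_right)
  qed
  define S where "S = separators A h k"
  have SA: "S \<subseteq> A" by (auto simp: S_def separators_def)
  have S_y: "S = separators A h y"
    using y(1) separators_chamber[OF chamber_self[OF h] y(1)] by (simp add: S_def)
  have yoff: "off_planes A y" using y(1) by (simp add: chamber_def)
  \<comment> \<open>the time at which the segment from \<open>h\<close> to \<open>y\<close> crosses \<open>p\<close>\<close>
  define t where "t p = (snd p - fst p \<bullet> h) / (fst p \<bullet> (y - h))" for p
  have cases: "snd p - fst p \<bullet> h > 0 \<and> fst p \<bullet> (y - h) > snd p - fst p \<bullet> h \<or>
      snd p - fst p \<bullet> h < 0 \<and> fst p \<bullet> (y - h) < snd p - fst p \<bullet> h" if p: "p \<in> S" for p
  proof -
    have "fst p \<bullet> y \<noteq> snd p" "fst p \<bullet> h \<noteq> snd p"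
      using p SA yoff h by (auto simp: off_planes_def split_beta)
    then show ?thesis using p unfolding S_y separators_def by (auto simp: inner_diff_right)
  qed
  have t01: "0 < t p \<and> t p < 1" if "p \<in> S" for p
    using cases[OF that] by (auto simp: t_def field_simps)
  have t_eq: "t p * (fst p \<bullet> (y - h)) = snd p - fst p \<bullet> h" if "p \<in> S" for p
    using cases[OF that] by (auto simp: t_def)
  have t_inj: "t p \<noteq> t q" if pq: "p \<in> S" "q \<in> S" "p \<noteq> q" for p q
  proof
    assume eq: "t p = t q"
    have "n p q \<bullet> (y - h) = (snd p - fst p \<bullet> h) * (fst q \<bullet> (y - h)) - (snd q - fst q \<bullet> h) * (fst p \<bullet> (y - h))"
      by (simp add: n_def inner_diff_left)
    also have "\<dots> = 0" unfolding t_eq[OF pq(1), symmetric] t_eq[OF pq(2), symmetric] eq by simp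
    finally show False using gen pq SA by blast
  qed
  have finS: "finite S" using A SA by (rule finite_subset[rotated])
  obtain p where p: "p \<in> S" "\<And>q. q \<in> S \<Longrightarrow> t p \<le> t q"
    using ex_min_if_finite[of "t ` S"] finS sep unfolding S_def[symmetric]
    by (metis (no_types, lifting) finite_imageI image_iff image_is_empty linorder_not_less)
  define t2 where "t2 = Min (insert 1 (t ` (S - {p})))"
  have "t p < t q" if "q \<in> S - {p}" for q
    using that p(2)[of q] t_inj[OF p(1), of q] by (auto simp: order_less_le)
  then have "t p < t2"
    unfolding t2_def using finS t01[OF p(1)] by (subst Min_gr_iff) auto
  then obtain \<tau> where \<tau>: "t p < \<tau>" "\<tau> < t2" using dense by blast
  have t2: "t2 \<le> 1" "\<And>q. q \<in> S \<Longrightarrow> q \<noteq> p \<Longrightarrow> t2 \<le> t q"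
    unfolding t2_def using finS by auto
  have \<tau>01: "0 < \<tau>" "\<tau> < 1" using \<tau> t01[OF p(1)] t2(1) by linarith+
  define z where "z = h + \<tau> *\<^sub>R (y - h)"
  have side: "fst q \<bullet> z \<noteq> snd q \<and> ((fst q \<bullet> h < snd q) \<noteq> (fst q \<bullet> z < snd q) \<longleftrightarrow> q = p)"
    if q: "q \<in> A" for q
  proof (cases "q \<in> S")
    case True
    have e: "fst q \<bullet> z - snd q = (\<tau> - t q) * (fst q \<bullet> (y - h))"
      using t_eq[OF True] by (simp add: z_def inner_add_right algebra_simps)
    show ?thesis
    proof (cases "q = p")
      case True
      then have "\<tau> - t q > 0" using \<tau> by simp
      then show ?thesis using cases[OF \<open>q \<in> S\<close>] e True
        by (smt (verit) mult_pos_pos mult_pos_neg)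
    next
      case False
      then have "\<tau> - t q < 0" using \<tau> t2(2)[OF \<open>q \<in> S\<close>] by simp
      then show ?thesis using cases[OF \<open>q \<in> S\<close>] e False
        by (smt (verit) mult_neg_pos mult_neg_neg)
    qed
  next
    case False
    have off: "fst q \<bullet> y \<noteq> snd q" "fst q \<bullet> h \<noteq> snd q"
      using q yoff h by (auto simp: off_planes_def split_beta)
    have "(fst q \<bullet> h < snd q) = (fst q \<bullet> y < snd q)"
      using False q by (auto simp: S_y separators_def)
    moreover have e: "fst q \<bullet> z - snd q = (1 - \<tau>) * (fst q \<bullet> h - snd q) + \<tau> * (fst q \<bullet> y - snd q)"
      by (simp add: z_def algebra_simps inner_add_right)
    moreover have "q \<noteq> p" using False p(1) by blast
    ultimately show ?thesis using off \<tau>01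
      by (smt (verit) mult_pos_pos mult_pos_neg)
  qed
  have zoff: "off_planes A z" using side by (auto simp: off_planes_def split_beta)
  have sep_hz: "separators A h z = {p}"
    using side p(1) SA unfolding separators_def by fastforce
  have sep_zk: "separators A z k = S - {p}"
  proof (intro set_eqI)
    fix q show "q \<in> separators A z k \<longleftrightarrow> q \<in> S - {p}"
      using side[of q] p(1) unfolding S_def separators_def by (cases q) auto
  qed
  show ?thesis
  proof (rule that[of "chamber A z" p])
    show "open (chamber A z)" by (rule chamber_open[OF A zoff])
    show "chamber A z \<noteq> {}" using chamber_self[OF zoff] by blast
    show "p \<in> separators A h k" using p(1) by (simp add: S_def)
    fix x assume x: "x \<in> chamber A z"
    show "off_planes A x \<and> separators A h x = {p} \<and> separators A x k = separators A h k - {p}"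
      using x sep_hz sep_zk separators_chamber[OF chamber_self[OF h] x]
        separators_chamber[OF x chamber_self[OF k]]
      by (simp add: S_def chamber_def)
  qed
qed

section \<open>Hyperplanes carrying the boundary of the window\<close>

lemma frontier_polyhedron_subset:
  fixes S :: "'a::euclidean_space set"
  assumes "polyhedron S"
  obtains A where "finite A" "\<And>a b. (a, b) \<in> A \<Longrightarrow> a \<noteq> 0"
    "\<And>x. x \<in> frontier S \<Longrightarrow> \<exists>(a, b)\<in>A. a \<bullet> x = b"
proof -
  obtain F where F: "finite F" "S = \<Inter>F" "\<forall>h\<in>F. \<exists>a b. a \<noteq> 0 \<and> h = {x. a \<bullet> x \<le> b}"
    using assms by (auto simp: polyhedron_def)
  then obtain a b where ab: "\<And>h. h \<in> F \<Longrightarrow> a h \<noteq> 0" "\<And>h. h \<in> F \<Longrightarrow> h = {x. a h \<bullet> x \<le> b h}"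
    by metis
  show ?thesis
  proof (rule that[of "(\<lambda>h. (a h, b h)) ` F"])
    show "finite ((\<lambda>h. (a h, b h)) ` F)" using F(1) by simp
    show "c \<noteq> 0" if "(c, d) \<in> (\<lambda>h. (a h, b h)) ` F" for c d using that ab by auto
    fix x assume x: "x \<in> frontier S"
    have "closed S" using assms by (rule polyhedron_imp_closed)
    then have "x \<in> S" "x \<notin> interior S" using x by (auto simp: frontier_def)
    show "\<exists>(c, d)\<in>(\<lambda>h. (a h, b h)) ` F. c \<bullet> x = d"
    proof (rule ccontr)
      assume contra: "\<not> ?thesis"
      define U where "U = (\<Inter>h\<in>F. {x. a h \<bullet> x < b h})"
      have "open U" unfolding U_def using F(1) by (intro open_INT ballI open_halfspace_lt) auto
      moreover have "U \<subseteq> S" unfolding U_def F(2) using ab(2) by fastforce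
      moreover have "x \<in> U"
        unfolding U_def
      proof (intro INT_I CollectI)
        fix h assume h: "h \<in> F"
        then have "x \<in> h" using \<open>x \<in> S\<close> F(2) by blast
        then have "a h \<bullet> x \<le> b h" using ab(2)[OF h] by blast
        moreover have "a h \<bullet> x \<noteq> b h" using contra h by auto
        ultimately show "a h \<bullet> x < b h" by simp
      qed
      ultimately have "x \<in> interior S" by (meson interiorI)
      then show False using \<open>x \<notin> interior S\<close> by simp
    qed
  qed
qed

lemma frontier_Union_finite_subset:
  assumes "finite \<F>" "x \<in> frontier (\<Union>\<F>)"
  shows "\<exists>S\<in>\<F>. x \<in> frontier S"
  using assms
proof (induction \<F>)
  case (insert S \<F>)
  then show ?case using frontier_Un_subset[of S "\<Union>\<F>"] by auto
qed auto

text \<open>Choosing one representative of each line of normals makes distinct normals linearly independent.\<close>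

lemma normalize_normals:
  fixes A :: "('a::euclidean_space \<times> real) set"
  assumes A: "finite A" "\<And>a b. (a, b) \<in> A \<Longrightarrow> a \<noteq> 0"
  obtains C B where "finite C" "finite (B :: real set)" "0 \<notin> C"
    "\<And>c c' a b. c \<in> C \<Longrightarrow> c' \<in> C \<Longrightarrow> c \<noteq> c' \<Longrightarrow> a *\<^sub>R c = b *\<^sub>R c' \<Longrightarrow> a = 0"
    "\<And>x. \<exists>(a, b)\<in>A. a \<bullet> x = b \<Longrightarrow> \<exists>c\<in>C. c \<bullet> x \<in> B"
proof -
  define rep where "rep a = (SOME c::'a. c \<noteq> 0 \<and> span {c} = span {a})" for a
  have rep: "rep a \<noteq> 0" "span {rep a} = span {a}" if "a \<noteq> 0" for a
    using someI[of "\<lambda>c. c \<noteq> 0 \<and> span {c} = span {a}" a] that unfolding rep_def by auto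
  have span_eq: "span {a *\<^sub>R c} = span {c}" if "a \<noteq> 0" for a and c :: 'a
    by (rule span_eq[THEN iffD2]) (use that span_base[of "a *\<^sub>R c" "{a *\<^sub>R c}"] in
        \<open>auto simp: span_singleton intro!: rangeI image_eqI[of _ _ "inverse a"]\<close>)
  have "\<exists>k. a = k *\<^sub>R rep a \<and> k \<noteq> 0" if "a \<noteq> 0" for a
  proof -
    have "a \<in> span {rep a}" using rep(2)[OF that] span_base[of a "{a}"] by simp
    then obtain k where "a = k *\<^sub>R rep a" by (auto simp: span_singleton)
    then show ?thesis using that by auto
  qed
  then obtain k where k: "\<And>a. a \<noteq> 0 \<Longrightarrow> a = k a *\<^sub>R rep a" "\<And>a. a \<noteq> 0 \<Longrightarrow> k a \<noteq> 0" by metis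
  show ?thesis
  proof (rule that[of "(\<lambda>(a, b). rep a) ` A" "(\<lambda>(a, b). b / k a) ` A"])
    show "0 \<notin> (\<lambda>(a, b). rep a) ` A" using rep(1) A(2) by force
    fix x assume "\<exists>(a, b)\<in>A. a \<bullet> x = b"
    then obtain a b where ab: "(a, b) \<in> A" "a \<bullet> x = b" by auto
    have a0: "a \<noteq> 0" using A(2)[OF ab(1)] .
    have "k a * (rep a \<bullet> x) = b" using ab(2) k(1)[OF a0] by (metis inner_scaleR_left)
    then have "rep a \<bullet> x = b / k a" using k(2)[OF a0] by (simp add: field_simps)
    then have "rep a \<bullet> x \<in> (\<lambda>(a, b). b / k a) ` A" using ab(1) by force
    then show "\<exists>c\<in>(\<lambda>(a, b). rep a) ` A. c \<bullet> x \<in> (\<lambda>(a, b). b / k a) ` A" using ab(1) by force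
  next
    fix c c' :: 'a and a b :: real
    assume c: "c \<in> (\<lambda>(a, b). rep a) ` A" "c' \<in> (\<lambda>(a, b). rep a) ` A" "c \<noteq> c'" "a *\<^sub>R c = b *\<^sub>R c'"
    obtain d d' v v' where "(d, v) \<in> A" "(d', v') \<in> A" and d': "c = rep d" "c' = rep d'"
      using c(1,2) by auto
    then have d: "d \<noteq> 0" "d' \<noteq> 0" "c = rep d" "c' = rep d'" using A(2) by auto
    show "a = 0"
    proof (rule ccontr)
      assume "a \<noteq> 0"
      then have "b \<noteq> 0" using c(4) rep(1)[OF d(1)] d(3) by auto
      have "span {d} = span {d'}"
        using span_eq[OF \<open>a \<noteq> 0\<close>, of c] span_eq[OF \<open>b \<noteq> 0\<close>, of c'] c(4) rep(2)[OF d(1)] rep(2)[OF d(2)] d(3,4)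
        by simp
      then have "rep d = rep d'" by (simp add: rep_def)
      then show False using c(3) d by simp
    qed
  qed (use A(1) in auto)
qed

lemma polyhedral_window_planes:
  assumes "polyhedral_window W"
  obtains C B where "finite C" "finite (B :: real set)" "0 \<notin> C"
    "\<And>c c' a b. c \<in> C \<Longrightarrow> c' \<in> C \<Longrightarrow> c \<noteq> c' \<Longrightarrow> a *\<^sub>R c = b *\<^sub>R c' \<Longrightarrow> a = 0"
    "\<And>x. x \<in> frontier W \<Longrightarrow> \<exists>c\<in>C. c \<bullet> x \<in> B"
proof -
  obtain \<P> where \<P>: "finite \<P>" "\<And>P. P \<in> \<P> \<Longrightarrow> compact_polyhedron P" "W = \<Union>\<P>"
    using assms by (auto simp: polyhedral_window_def)
  obtain \<Q> where \<Q>: "\<And>P. P \<in> \<P> \<Longrightarrow> finite (\<Q> P)" "\<And>P Q. P \<in> \<P> \<Longrightarrow> Q \<in> \<Q> P \<Longrightarrow> polytope Q"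
    "\<And>P. P \<in> \<P> \<Longrightarrow> P = \<Union>(\<Q> P)"
    using \<P>(2) unfolding compact_polyhedron_def by metis
  define \<R> where "\<R> = (\<Union>P\<in>\<P>. \<Q> P)"
  have "\<Union>\<R> = (\<Union>P\<in>\<P>. \<Union>(\<Q> P))" unfolding \<R>_def by blast
  also have "\<dots> = (\<Union>P\<in>\<P>. P)" by (intro SUP_cong refl \<Q>(3)[symmetric])
  finally have WR: "W = \<Union>\<R>" using \<P>(3) by simp
  have polyR: "polyhedron Q" if "Q \<in> \<R>" for Q
    using that \<Q>(2) polytope_imp_polyhedron unfolding \<R>_def by blast
  have "finite \<R>" unfolding \<R>_def using \<P>(1) \<Q>(1) by (rule finite_UN_I)
  note \<R> = this polyR WR
  have "\<exists>A. finite A \<and> (\<forall>(a, b)\<in>A. a \<noteq> 0) \<and> (\<forall>x\<in>frontier Q. \<exists>(a, b)\<in>A. a \<bullet> x = b)" if Q: "Q \<in> \<R>" for Q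
  proof -
    obtain A where "finite A" "\<And>a b. (a, b) \<in> A \<Longrightarrow> a \<noteq> 0"
      "\<And>x. x \<in> frontier Q \<Longrightarrow> \<exists>(a, b)\<in>A. a \<bullet> x = b"
      using frontier_polyhedron_subset[OF \<R>(2)[OF Q]] by metis
    then show ?thesis by (intro exI[of _ A]) auto
  qed
  then obtain A where A: "\<And>Q. Q \<in> \<R> \<Longrightarrow> finite (A Q)" "\<And>Q. Q \<in> \<R> \<Longrightarrow> \<forall>(a, b)\<in>A Q. a \<noteq> 0"
    "\<And>Q. Q \<in> \<R> \<Longrightarrow> \<forall>x\<in>frontier Q. \<exists>(a, b)\<in>A Q. a \<bullet> x = b" by metis
  have fin: "finite (\<Union>(A ` \<R>))" using A(1) \<R>(1) by blast
  have nz: "a \<noteq> 0" if "(a, b) \<in> \<Union>(A ` \<R>)" for a b using that A(2) by fast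
  obtain C B where CB: "finite C" "finite (B :: real set)" "0 \<notin> C"
    "\<And>c c' a b. c \<in> C \<Longrightarrow> c' \<in> C \<Longrightarrow> c \<noteq> c' \<Longrightarrow> a *\<^sub>R c = b *\<^sub>R c' \<Longrightarrow> a = 0"
    "\<And>x. \<exists>(a, b)\<in>\<Union>(A ` \<R>). a \<bullet> x = b \<Longrightarrow> \<exists>c\<in>C. c \<bullet> x \<in> B"
    by (rule normalize_normals[OF fin nz]) blast+
  have "\<exists>c\<in>C. c \<bullet> x \<in> B" if x: "x \<in> frontier W" for x
  proof (rule CB(5))
    obtain Q where "Q \<in> \<R>" "x \<in> frontier Q"
      using frontier_Union_finite_subset[OF \<R>(1)] x \<R>(3) by blast
    then show "\<exists>(a, b)\<in>\<Union>(A ` \<R>). a \<bullet> x = b" using A(3) by fastforce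
  qed
  then show ?thesis using that CB by blast
qed

context model_scheme
begin

lemma lattice_scaleR_int:
  assumes "\<gamma> \<in> \<Gamma>"
  shows "of_int n *\<^sub>R \<gamma> \<in> \<Gamma>"
proof -
  have *: "real m *\<^sub>R \<gamma> \<in> \<Gamma>" for m :: nat
    by (induction m) (use assms lattice_zero lattice_add in \<open>auto simp: scaleR_left_distrib\<close>)
  show ?thesis
  proof (cases "n \<ge> 0")
    case True
    then show ?thesis using *[of "nat n"] by simp
  next
    case False
    then show ?thesis using lattice_uminus[OF *[of "nat (- n)"]] by simp
  qed
qed

lemma lattice_sum: "finite I \<Longrightarrow> (\<And>i. i \<in> I \<Longrightarrow> f i \<in> \<Gamma>) \<Longrightarrow> sum f I \<in> \<Gamma>"
  by (induction I rule: finite_induct) (auto simp: lattice_zero lattice_add)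

text \<open>Let \<open>G\<close> consist of the lattice vectors with internal part orthogonal to \<open>c\<close>.  If every functional that
  vanishes on \<open>G\<close> had trivial physical component, the span of \<open>G\<close> would contain the physical space.
  Every lattice vector could then be made physically short by subtracting an element of \<open>G\<close>, which does not
  change \<open>c \<bullet> fst \<gamma>\<close>.  So \<open>c \<bullet> fst \<gamma>\<close> would take finitely many values
  on the lattice vectors with internal part in the unit ball, contrary to density.\<close>

lemma hyperplane_sublattice_annihilator:
  assumes c: "c \<noteq> 0"
  obtains l e where "e \<noteq> 0" "\<And>\<gamma>. \<gamma> \<in> \<Gamma> \<Longrightarrow> c \<bullet> fst \<gamma> = 0 \<Longrightarrow> l \<bullet> fst \<gamma> + e \<bullet> snd \<gamma> = 0"
proof (rule ccontr)
  assume contra: "\<not> thesis"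
  have no: False if "e \<noteq> 0" "\<And>\<gamma>. \<gamma> \<in> \<Gamma> \<Longrightarrow> c \<bullet> fst \<gamma> = 0 \<Longrightarrow> l \<bullet> fst \<gamma> + e \<bullet> snd \<gamma> = 0" for l e
    using contra \<open>\<And>l e. e \<noteq> 0 \<Longrightarrow> (\<And>\<gamma>. \<gamma> \<in> \<Gamma> \<Longrightarrow> c \<bullet> fst \<gamma> = 0 \<Longrightarrow> l \<bullet> fst \<gamma> + e \<bullet> snd \<gamma> = 0) \<Longrightarrow> thesis\<close>
      that by blast
  define G where "G = {\<gamma> \<in> \<Gamma>. c \<bullet> fst \<gamma> = 0}"
  have perp: "snd z = 0" if "\<And>g. g \<in> span G \<Longrightarrow> orthogonal z g" for z
  proof (rule ccontr)
    assume "snd z \<noteq> 0"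
    moreover have "fst z \<bullet> fst \<gamma> + snd z \<bullet> snd \<gamma> = 0" if "\<gamma> \<in> \<Gamma>" "c \<bullet> fst \<gamma> = 0" for \<gamma>
    proof -
      have "\<gamma> \<in> span G" using that by (simp add: G_def span_base)
      then have "orthogonal z \<gamma>" using \<open>\<And>g. g \<in> span G \<Longrightarrow> orthogonal z g\<close> by blast
      then show ?thesis by (simp add: orthogonal_def inner_prod_def)
    qed
    ultimately show False by (rule no)
  qed
  have vertical: "(0, y) \<in> span G" for y
  proof -
    obtain g z where gz: "g \<in> span G" "\<And>w. w \<in> span G \<Longrightarrow> orthogonal z w" "(0, y) = g + z"
      using orthogonal_subspace_decomp_exists[of G "(0, y)"] by blast
    have "snd z = 0" using perp gz(2) by blast
    then have "z \<bullet> (0, y) = 0" by (simp add: inner_prod_def)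
    moreover have "z \<bullet> g = 0" using gz(1,2) by (simp add: orthogonal_def)
    ultimately have "z \<bullet> z = 0" using gz(3) by (simp add: inner_add_right)
    then show ?thesis using gz by simp
  qed
  obtain b where b: "b \<subseteq> G" "independent b" "G \<subseteq> span b"
    using maximal_independent_subset by metis
  have finb: "finite b" using b(2) independent_imp_finite by blast
  define K where "K = (\<Sum>v\<in>b. norm v)"
  have near: "\<exists>g\<in>G. norm (s - g) \<le> K" if "s \<in> span G" for s
  proof -
    have "s \<in> span b" using that b(3) by (metis span_minimal subspace_span subsetD)
    then obtain u where u: "s = (\<Sum>v\<in>b. u v *\<^sub>R v)" using span_finite[OF finb] by auto
    \<comment> \<open>round the coefficients of \<open>s\<close> down to integers\<close>
    define g where "g = (\<Sum>v\<in>b. of_int \<lfloor>u v\<rfloor> *\<^sub>R v)"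
    have "g \<in> \<Gamma>" unfolding g_def using b(1) by (intro lattice_sum[OF finb] lattice_scaleR_int) (auto simp: G_def)
    moreover have "fst g = (\<Sum>v\<in>b. of_int \<lfloor>u v\<rfloor> *\<^sub>R fst v)" unfolding g_def by (simp add: fst_sum)
    then have "c \<bullet> fst g = 0" using b(1) by (auto simp: inner_sum_right G_def intro!: sum.neutral)
    moreover have "norm (s - g) \<le> K"
    proof -
      have "s - g = (\<Sum>v\<in>b. frac (u v) *\<^sub>R v)"
        unfolding u g_def sum_subtractf[symmetric] by (simp add: frac_def algebra_simps)
      also have "norm \<dots> \<le> (\<Sum>v\<in>b. norm (frac (u v) *\<^sub>R v))" by (rule norm_sum)
      also have "\<dots> \<le> K"
        unfolding K_def by (intro sum_mono) (simp add: mult_left_le_one_le frac_lt_1 less_imp_le)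
      finally show ?thesis .
    qed
    ultimately show ?thesis unfolding G_def by blast
  qed
  define X where "X = (\<lambda>\<gamma>. c \<bullet> fst \<gamma>) ` {\<gamma> \<in> \<Gamma>. norm (fst \<gamma>) \<le> 1 + K \<and> norm (snd \<gamma>) \<le> K}"
  have X: "finite X" unfolding X_def using lattice_finite by blast
  have inX: "c \<bullet> fst \<gamma> \<in> X" if \<gamma>: "\<gamma> \<in> \<Gamma>" "norm (fst \<gamma>) \<le> 1" for \<gamma>
  proof -
    obtain g where g: "g \<in> G" "norm ((0, snd \<gamma>) - g) \<le> K" using near[OF vertical] by blast
    have "norm (fst g) \<le> K" "norm (snd \<gamma> - snd g) \<le> K"
      using norm_fst[of "(0, snd \<gamma>) - g"] norm_snd[of "(0, snd \<gamma>) - g"] g(2) by auto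
    then have "\<gamma> - g \<in> {\<gamma> \<in> \<Gamma>. norm (fst \<gamma>) \<le> 1 + K \<and> norm (snd \<gamma>) \<le> K}"
      using g(1) \<gamma> norm_triangle_ineq4[of "fst \<gamma>" "fst g"] lattice_diff by (auto simp: G_def)
    then have "c \<bullet> fst (\<gamma> - g) \<in> X" unfolding X_def by blast
    then show ?thesis using g(1) by (simp add: G_def inner_diff_right)
  qed
  have "finite ({c} \<times> X)" "\<And>a s. (a, s) \<in> {c} \<times> X \<Longrightarrow> a \<noteq> 0" using X c by auto
  moreover have "open (ball (0::'h) 1)" "ball (0::'h) 1 \<noteq> {}" by auto
  ultimately obtain h where h: "h \<in> ball 0 1" "\<forall>(a, s)\<in>{c} \<times> X. a \<bullet> h \<noteq> s"
    using open_meets_generic by blast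
  have "open (ball 0 1 \<inter> {z. \<forall>(a, s)\<in>{c} \<times> X. a \<bullet> z \<noteq> s})"
    using open_off_hyperplanes[OF \<open>finite ({c} \<times> X)\<close>] by auto
  moreover have "ball 0 1 \<inter> {z. \<forall>(a, s)\<in>{c} \<times> X. a \<bullet> z \<noteq> s} \<noteq> {}" using h by blast
  ultimately obtain \<gamma> where "\<gamma> \<in> \<Gamma>" "fst \<gamma> \<in> ball 0 1 \<inter> {z. \<forall>(a, s)\<in>{c} \<times> X. a \<bullet> z \<noteq> s}"
    by (rule lattice_dense)
  then show False using inX[of \<gamma>] by auto
qed

text \<open>On the sublattice orthogonal to \<open>c\<close> the annihilator expresses \<open>e \<bullet> snd \<gamma>\<close> through the bounded internal part.
  For each further value in \<open>B\<close> the lattice vectors differ from a fixed one by an element of this sublattice.\<close>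

lemma wall_direction:
  assumes c: "c \<noteq> 0" and B: "finite B"
  obtains e K where "norm e = 1" "K \<ge> 0"
    "\<And>\<gamma>. \<gamma> \<in> \<Gamma> \<Longrightarrow> c \<bullet> fst \<gamma> \<in> B \<Longrightarrow> norm (fst \<gamma>) \<le> \<rho> \<Longrightarrow> \<bar>e \<bullet> snd \<gamma>\<bar> \<le> K"
proof -
  obtain l0 e0 where le0: "e0 \<noteq> 0"
    "\<And>\<gamma>. \<gamma> \<in> \<Gamma> \<Longrightarrow> c \<bullet> fst \<gamma> = 0 \<Longrightarrow> l0 \<bullet> fst \<gamma> + e0 \<bullet> snd \<gamma> = 0"
    using hyperplane_sublattice_annihilator[OF c] by metis
  define l where "l = (1 / norm e0) *\<^sub>R l0"
  define e where "e = (1 / norm e0) *\<^sub>R e0"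
  have e: "norm e = 1" using le0(1) by (simp add: e_def)
  have le: "l \<bullet> fst \<gamma> + e \<bullet> snd \<gamma> = 0" if "\<gamma> \<in> \<Gamma>" "c \<bullet> fst \<gamma> = 0" for \<gamma>
    using le0(2)[OF that] by (simp add: l_def e_def add_divide_distrib[symmetric])
  define \<rho>' where "\<rho>' = max \<rho> 0"
  define g where "g b = (SOME \<gamma>. \<gamma> \<in> \<Gamma> \<and> c \<bullet> fst \<gamma> = b \<and> norm (fst \<gamma>) \<le> \<rho>')" for b
  define K where "K = norm l * (2 * \<rho>') + (\<Sum>b\<in>B. \<bar>e \<bullet> snd (g b)\<bar>)"
  have "K \<ge> 0" unfolding K_def by (intro add_nonneg_nonneg mult_nonneg_nonneg sum_nonneg) (auto simp: \<rho>'_def)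
  moreover have "\<bar>e \<bullet> snd \<gamma>\<bar> \<le> K" if \<gamma>: "\<gamma> \<in> \<Gamma>" "c \<bullet> fst \<gamma> \<in> B" "norm (fst \<gamma>) \<le> \<rho>" for \<gamma>
  proof -
    define b where "b = c \<bullet> fst \<gamma>"
    have "\<gamma> \<in> \<Gamma> \<and> c \<bullet> fst \<gamma> = b \<and> norm (fst \<gamma>) \<le> \<rho>'" using \<gamma> by (simp add: b_def \<rho>'_def)
    then have g: "g b \<in> \<Gamma>" "c \<bullet> fst (g b) = b" "norm (fst (g b)) \<le> \<rho>'"
      unfolding g_def by (metis (mono_tags, lifting) someI)+
    have "e \<bullet> snd (\<gamma> - g b) = - (l \<bullet> fst (\<gamma> - g b))"
      using le[OF lattice_diff[OF \<gamma>(1) g(1)]] g(2) by (simp add: b_def inner_diff_right)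
    then have "\<bar>e \<bullet> snd (\<gamma> - g b)\<bar> \<le> norm l * norm (fst (\<gamma> - g b))"
      using Cauchy_Schwarz_ineq2[of l "fst (\<gamma> - g b)"] by simp
    also have "\<dots> \<le> norm l * (2 * \<rho>')"
      using norm_triangle_ineq4[of "fst \<gamma>" "fst (g b)"] \<gamma>(3) g(3)
      by (intro mult_left_mono) (auto simp: \<rho>'_def)
    finally have "\<bar>e \<bullet> snd (\<gamma> - g b)\<bar> \<le> norm l * (2 * \<rho>')" .
    moreover have "\<bar>e \<bullet> snd (g b)\<bar> \<le> (\<Sum>b\<in>B. \<bar>e \<bullet> snd (g b)\<bar>)"
      using B \<gamma>(2) unfolding b_def by (intro member_le_sum) auto
    ultimately show ?thesis unfolding K_def by (simp add: inner_diff_right)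
  qed
  ultimately show ?thesis using that e by blast
qed

end

section \<open>Increments along paths\<close>

text \<open>The path \<open>m\<close> and its translate by \<open>t\<close> see the same patterns of radius \<open>R1\<close>.  As \<open>R1\<close> exceeds the step length,
  the translated path cannot leave \<open>M\<close>.\<close>

lemma increment_along_path:
  fixes F :: "'d::euclidean_space \<Rightarrow> 'y::ab_group_add"
  assumes step: "\<And>x y x' y'. \<lbrakk>x \<in> M; y \<in> M; x' \<in> M; y' \<in> M; norm (y - x) \<le> R0; y - x = y' - x';
      agree R1 (shift M x) (shift M x')\<rbrakk> \<Longrightarrow> F y - F x = F y' - F x'"
    and R: "R0 < R1"
    and m: "\<And>i. i \<le> N \<Longrightarrow> m i \<in> M" "\<And>i. i < N \<Longrightarrow> norm (m (Suc i) - m i) \<le> R0"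
    and t: "m 0 + t \<in> M"
    and same: "\<And>i z. i < N \<Longrightarrow> norm z < R1 \<Longrightarrow> m i + z \<in> M \<longleftrightarrow> m i + z + t \<in> M"
    and i: "i \<le> N"
  shows "m i + t \<in> M \<and> F (m i) - F (m 0) = F (m i + t) - F (m 0 + t)"
  using i
proof (induction i)
  case (Suc i)
  then have i: "i < N" and IH: "m i + t \<in> M" "F (m i) - F (m 0) = F (m i + t) - F (m 0 + t)" by auto
  have "m i + (m (Suc i) - m i) \<in> M \<longleftrightarrow> m i + (m (Suc i) - m i) + t \<in> M"
    using m(2)[OF i] R by (intro same i) simp
  then have S: "m (Suc i) + t \<in> M" using m(1)[of "Suc i"] i by simp
  have "agree R1 (shift M (m i)) (shift M (m i + t))"
    unfolding agree_iff in_shift_iff using same[OF i] by (simp add: algebra_simps)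
  then have "F (m (Suc i)) - F (m i) = F (m (Suc i) + t) - F (m i + t)"
    using m i IH(1) S by (intro step) auto
  have "F (m (Suc i)) - F (m 0) = (F (m (Suc i)) - F (m i)) + (F (m i) - F (m 0))" by simp
  also have "\<dots> = (F (m (Suc i) + t) - F (m i + t)) + (F (m i + t) - F (m 0 + t))"
    using IH(2) \<open>F (m (Suc i)) - F (m i) = _\<close> by simp
  finally show ?case using S by simp
qed (use t in simp)

section \<open>Patterns and chambers of the window\<close>

text \<open>The boundary of a polyhedral window lies on the finitely many hyperplanes \<open>{h. c \<bullet> h = b}\<close> with
  \<open>c \<in> C\<close> and \<open>b \<in> B\<close>; no two normals in \<open>C\<close> are parallel.\<close>

locale planar_model_set = model_set \<Gamma> W M
  for \<Gamma> :: "('h::euclidean_space \<times> 'd::euclidean_space) set" and W :: "'h set" and M :: "'d set" +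
  fixes C :: "'h set" and B :: "real set"
  assumes finite_C: "finite C" and finite_B: "finite B" and zero_notin_C: "0 \<notin> C"
    and not_parallel: "c \<in> C \<Longrightarrow> c' \<in> C \<Longrightarrow> c \<noteq> c' \<Longrightarrow> a *\<^sub>R c = b *\<^sub>R c' \<Longrightarrow> a = 0"
    and frontier_planes: "h \<in> frontier W \<Longrightarrow> \<exists>c\<in>C. c \<bullet> h \<in> B"
begin

text \<open>A lattice vector between two points of \<open>M\<close> has its internal part in \<open>W - W\<close>.\<close>

definition visible :: "real \<Rightarrow> ('h \<times> 'd) set" where
  "visible T = {\<gamma> \<in> \<Gamma>. (\<exists>v\<in>W. \<exists>w\<in>W. fst \<gamma> = v - w) \<and> norm (snd \<gamma>) < T}"

text \<open>A plane of this arrangement is where the address \<open>h\<close> has \<open>h + fst \<gamma>\<close> on a hyperplane of the boundary.\<close>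

definition planes :: "real \<Rightarrow> ('h \<times> real) set" where
  "planes T = (\<lambda>(c, b, \<gamma>). (c, b - c \<bullet> fst \<gamma>)) ` (C \<times> B \<times> visible T)"

lemma visible_bounded:
  obtains \<beta> where "\<And>T \<gamma>. \<gamma> \<in> visible T \<Longrightarrow> norm (fst \<gamma>) \<le> \<beta>"
proof -
  obtain \<beta> where \<beta>: "\<And>w. w \<in> W \<Longrightarrow> norm w \<le> \<beta>" using window_bounded by metis
  have "norm (fst \<gamma>) \<le> 2 * \<beta>" if \<gamma>: "\<gamma> \<in> visible T" for T \<gamma>
  proof -
    obtain v w where "v \<in> W" "w \<in> W" "fst \<gamma> = v - w" using \<gamma> by (auto simp: visible_def)
    then show ?thesis using \<beta>[of v] \<beta>[of w] norm_triangle_ineq4[of v w] by simp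
  qed
  then show ?thesis using that by blast
qed

lemma finite_planes: "finite (planes T)"
proof -
  obtain \<beta> where \<beta>: "\<And>T \<gamma>. \<gamma> \<in> visible T \<Longrightarrow> norm (fst \<gamma>) \<le> \<beta>" using visible_bounded by metis
  have "visible T \<subseteq> {\<gamma> \<in> \<Gamma>. norm (fst \<gamma>) \<le> \<beta> \<and> norm (snd \<gamma>) \<le> T}"
  proof
    fix \<gamma> assume "\<gamma> \<in> visible T"
    then show "\<gamma> \<in> {\<gamma> \<in> \<Gamma>. norm (fst \<gamma>) \<le> \<beta> \<and> norm (snd \<gamma>) \<le> T}"
      using \<beta>[of \<gamma> T] by (auto simp: visible_def)
  qed
  then have "finite (visible T)" using lattice_finite finite_subset by blast
  then show ?thesis unfolding planes_def using finite_C finite_B by blast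
qed

lemma planes_mono: "S \<le> T \<Longrightarrow> planes S \<subseteq> planes T"
  by (force simp: planes_def visible_def)

lemma planes_normal: "(c, s) \<in> planes T \<Longrightarrow> c \<in> C"
  by (auto simp: planes_def)

lemma planes_nonzero: "(c, s) \<in> planes T \<Longrightarrow> c \<noteq> 0"
  using planes_normal zero_notin_C by blast

lemma planes_mem: "c \<in> C \<Longrightarrow> b \<in> B \<Longrightarrow> \<gamma> \<in> visible T \<Longrightarrow> (c, b - c \<bullet> fst \<gamma>) \<in> planes T"
  by (force simp: planes_def)

lemma plane_crossing:
  assumes "u \<in> W" "v \<notin> interior W"
    and off: "\<And>c b. c \<in> C \<Longrightarrow> b \<in> B \<Longrightarrow> c \<bullet> u \<noteq> b \<and> c \<bullet> v \<noteq> b"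
  shows "\<exists>c\<in>C. \<exists>b\<in>B. (c \<bullet> u < b) \<noteq> (c \<bullet> v < b)"
proof -
  have "v \<notin> frontier W" using frontier_planes off by blast
  then have "v \<notin> W" using assms(2) window_closed by (auto simp: frontier_def)
  then have "closed_segment u v \<inter> frontier W \<noteq> {}"
    using assms(1) by (intro connected_Int_frontier) auto
  then obtain q where q: "q \<in> closed_segment u v" "q \<in> frontier W" by blast
  obtain c where c: "c \<in> C" "c \<bullet> q \<in> B" using frontier_planes[OF q(2)] by blast
  obtain a where a: "0 \<le> a" "a \<le> 1" "q = (1 - a) *\<^sub>R u + a *\<^sub>R v"
    using q(1) by (auto simp: closed_segment_def)
  define b where "b = c \<bullet> q"
  have e: "(1 - a) * (c \<bullet> u - b) + a * (c \<bullet> v - b) = 0"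
    unfolding b_def a(3) by (simp add: inner_add_right algebra_simps)
  have "c \<bullet> u - b \<noteq> 0" "c \<bullet> v - b \<noteq> 0" using off[OF c(1), of b] c(2) by (auto simp: b_def)
  then have "(c \<bullet> u < b) \<noteq> (c \<bullet> v < b)"
  proof (intro notI)
    assume nz: "c \<bullet> u - b \<noteq> 0" "c \<bullet> v - b \<noteq> 0" and eq: "(c \<bullet> u < b) = (c \<bullet> v < b)"
    show False
    proof (cases "c \<bullet> u < b")
      case True
      then have "c \<bullet> u - b < 0" "c \<bullet> v - b < 0" using eq by auto
      then show False using e a(1,2) convex_bound_lt[of "c \<bullet> u - b" 0 "c \<bullet> v - b" "1 - a" a] by simp
    next
      case False
      then have "b - c \<bullet> u < 0" "b - c \<bullet> v < 0" using eq nz by auto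
      then have "(1 - a) * (b - c \<bullet> u) + a * (b - c \<bullet> v) < 0"
        using a(1,2) convex_bound_lt[of "b - c \<bullet> u" 0 "b - c \<bullet> v" "1 - a" a] by simp
      then show False using e by (simp add: algebra_simps)
    qed
  qed
  then show ?thesis using c by (auto simp: b_def)
qed

text \<open>If a vector leads from \<open>x\<close> into \<open>M\<close> but not from \<open>y\<close>, the segment between the translated addresses leaves \<open>W\<close>
  through its boundary.\<close>

lemma patch_difference:
  assumes xy: "x \<in> M" "y \<in> M" and off: "off_planes (planes T) (star x)" "off_planes (planes T) (star y)"
    and \<gamma>: "\<gamma> \<in> \<Gamma>" "norm (snd \<gamma>) < T" "x + snd \<gamma> \<in> M" "y + snd \<gamma> \<notin> M"
  shows "\<gamma> \<in> visible T"
    "\<exists>c\<in>C. \<exists>b\<in>B. (c, b - c \<bullet> fst \<gamma>) \<in> separators (planes T) (star x) (star y)"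
proof -
  have W: "star x + fst \<gamma> \<in> W" using star_translate(2)[OF xy(1) \<gamma>(1)] star_mem(1)[OF \<gamma>(3)] by simp
  have "fst \<gamma> = (star x + fst \<gamma>) - star x" by simp
  then show vis: "\<gamma> \<in> visible T"
    unfolding visible_def using \<gamma>(1,2) W star_mem(1)[OF xy(1)] by blast
  have nW: "star y + fst \<gamma> \<notin> interior W" using translate_in_M[OF xy(2) \<gamma>(1)] \<gamma>(4) by blast
  have "\<exists>c\<in>C. \<exists>b\<in>B. (c \<bullet> (star x + fst \<gamma>) < b) \<noteq> (c \<bullet> (star y + fst \<gamma>) < b)"
  proof (rule plane_crossing[OF W nW])
    fix c b assume "c \<in> C" "b \<in> B"
    then have "(c, b - c \<bullet> fst \<gamma>) \<in> planes T" using vis by (rule planes_mem)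
    then have "c \<bullet> star x \<noteq> b - c \<bullet> fst \<gamma>" "c \<bullet> star y \<noteq> b - c \<bullet> fst \<gamma>"
      using off by (auto simp: off_planes_def)
    then show "c \<bullet> (star x + fst \<gamma>) \<noteq> b \<and> c \<bullet> (star y + fst \<gamma>) \<noteq> b"
      by (simp add: inner_add_right algebra_simps)
  qed
  then obtain c b where cb: "c \<in> C" "b \<in> B"
    "(c \<bullet> (star x + fst \<gamma>) < b) \<noteq> (c \<bullet> (star y + fst \<gamma>) < b)" by blast
  have "(c, b - c \<bullet> fst \<gamma>) \<in> separators (planes T) (star x) (star y)"
    using planes_mem[OF cb(1,2) vis] cb(3) by (simp add: separators_def inner_add_right less_diff_eq)
  then show "\<exists>c\<in>C. \<exists>b\<in>B. (c, b - c \<bullet> fst \<gamma>) \<in> separators (planes T) (star x) (star y)"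
    using cb by blast
qed

lemma separators_sym: "separators A h k = separators A k h"
  by (auto simp: separators_def)

lemma same_chamber_agree:
  assumes xy: "x \<in> M" "y \<in> M" and off: "off_planes (planes T) (star x)"
    and ch: "star y \<in> chamber (planes T) (star x)"
  shows "agree T (shift M x) (shift M y)"
proof -
  have offy: "off_planes (planes T) (star y)" and sep: "separators (planes T) (star x) (star y) = {}"
    using ch by (auto simp: chamber_def)
  have 1: "z + y \<in> M" if "norm z < T" "z + x \<in> M" for z
    using patch_difference(2)[OF xy off offy star_lattice[OF xy(1) that(2)]] that sep
    by (auto simp: add.commute)
  have 2: "z + x \<in> M" if "norm z < T" "z + y \<in> M" for z
    using patch_difference(2)[OF xy(2,1) offy off star_lattice[OF xy(2) that(2)]] that sep
    by (auto simp: add.commute separators_sym[of _ "star y"])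
  show ?thesis unfolding agree_iff in_shift_iff using 1 2 by blast
qed

lemma chamber_subset_interior:
  assumes x: "x \<in> M" and T: "T > 0" and off: "off_planes (planes T) (star x)"
  shows "chamber (planes T) (star x) \<subseteq> interior W"
proof
  fix h assume h: "h \<in> chamber (planes T) (star x)"
  have "star x - star x = 0" by simp
  then have "0 \<in> visible T" using lattice_zero T star_mem(1)[OF x] by (force simp: visible_def)
  then have pl: "(c, b) \<in> planes T" if "c \<in> C" "b \<in> B" for c b
    using planes_mem[OF that, of 0 T] by simp
  show "h \<in> interior W"
  proof (rule ccontr)
    assume "h \<notin> interior W"
    moreover have "c \<bullet> star x \<noteq> b \<and> c \<bullet> h \<noteq> b" if "c \<in> C" "b \<in> B" for c b
      using off h pl[OF that] by (auto simp: off_planes_def chamber_def)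
    ultimately have "\<exists>c\<in>C. \<exists>b\<in>B. (c \<bullet> star x < b) \<noteq> (c \<bullet> h < b)"
      by (intro plane_crossing star_mem(1)[OF x]) auto
    then show False using h pl by (auto simp: chamber_def separators_def)
  qed
qed

end

section \<open>Values on the two sides of a plane\<close>

text \<open>The constants witness strong pattern equivariance of the coboundary of \<open>F\<close>.\<close>

locale pattern_cocycle = planar_model_set \<Gamma> W M C B
  for \<Gamma> :: "('h::euclidean_space \<times> 'd::euclidean_space) set" and W M C B +
  fixes F :: "'d \<Rightarrow> real" and R0 R1 :: real
  assumes R0_pos: "0 < R0" and R0_less: "R0 < R1"
    and covering: "\<exists>x\<in>M. dist z x \<le> R0 / 3"
    and step: "\<lbrakk>x \<in> M; y \<in> M; x' \<in> M; y' \<in> M; norm (y - x) \<le> R0; y - x = y' - x';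
      agree R1 (shift M x) (shift M x')\<rbrakk> \<Longrightarrow> F y - F x = F y' - F x'"
    and F_wpe: "wpe M F"
begin

lemma uniform:
  assumes "\<epsilon> > 0"
  obtains r where "r > 0"
    "\<And>x y. x \<in> M \<Longrightarrow> y \<in> M \<Longrightarrow> agree r (shift M x) (shift M y) \<Longrightarrow> \<bar>F x - F y\<bar> < \<epsilon>"
  using wpe_uniform[OF F_wpe assms] unfolding dist_real_def by metis

text \<open>Join \<open>x\<close> to \<open>y\<close> by a path in \<open>M\<close> with short steps that stays near the segment; a large pattern around
  \<open>x\<close> contains the small patterns around all of its vertices.\<close>

lemma long_increments:
  obtains R where "R > 0" "\<And>x y x' y'. \<lbrakk>x \<in> M; y \<in> M; x' \<in> M; y' \<in> M; norm (y - x) \<le> T;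
    y - x = y' - x'; agree R (shift M x) (shift M x')\<rbrakk> \<Longrightarrow> F y - F x = F y' - F x'"
proof -
  define R where "R = \<bar>T\<bar> + R0 + R1"
  have "F y - F x = F y' - F x'"
    if xy: "x \<in> M" "y \<in> M" "x' \<in> M" "y' \<in> M" "norm (y - x) \<le> T" "y - x = y' - x'"
      and ag: "agree R (shift M x) (shift M x')" for x y x' y'
  proof -
    obtain N :: nat where "max (T / (R0 / 3)) 0 < real N" using reals_Archimedean2 by blast
    then have N: "T / (R0 / 3) < real N" "N > 0" by auto
    obtain pt where pt: "\<And>z. pt z \<in> M" "\<And>z. dist z (pt z) \<le> R0 / 3" using covering by metis
    define q where "q i = x + (real i / real N) *\<^sub>R (y - x)" for i
    define m where "m i = (if i = 0 then x else if i = N then y else pt (q i))" for i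
    have m: "m i \<in> M" for i using pt xy by (simp add: m_def)
    have mq: "norm (m i - q i) \<le> R0 / 3" for i
      using pt(2)[of "q i"] R0_pos N(2) by (simp add: m_def q_def dist_norm norm_minus_commute)
    have qq: "norm (q (Suc i) - q i) \<le> R0 / 3" for i
    proof -
      have "q (Suc i) - q i = (1 / real N) *\<^sub>R (y - x)"
        by (simp add: q_def add_divide_distrib scaleR_left_distrib)
      then have "norm (q (Suc i) - q i) = norm (y - x) / real N" by simp
      also have "\<dots> \<le> R0 / 3" using N xy(5) R0_pos by (simp add: field_simps)
      finally show ?thesis .
    qed
    have st: "norm (m (Suc i) - m i) \<le> R0" for i
    proof -
      have "m (Suc i) - m i = (m (Suc i) - q (Suc i)) + (q (Suc i) - q i) - (m i - q i)" by simp
      also have "norm \<dots> \<le> norm (m (Suc i) - q (Suc i)) + norm (q (Suc i) - q i) + norm (m i - q i)"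
        by (meson add_right_mono norm_triangle_ineq norm_triangle_ineq4 order_trans)
      also have "\<dots> \<le> R0" using mq[of i] mq[of "Suc i"] qq[of i] by simp
      finally show ?thesis .
    qed
    have near: "norm (m i - x) \<le> \<bar>T\<bar> + R0" if "i \<le> N" for i
    proof -
      have "norm (q i - x) = (real i / real N) * norm (y - x)" by (simp add: q_def)
      also have "\<dots> \<le> 1 * norm (y - x)" using that N(2) by (intro mult_right_mono) auto
      finally have "norm (q i - x) \<le> T" using xy(5) by simp
      moreover have "norm (m i - x) \<le> norm (m i - q i) + norm (q i - x)"
        using norm_triangle_ineq[of "m i - q i" "q i - x"] by simp
      ultimately show ?thesis using mq[of i] R0_pos by linarith
    qed
    have same: "m i + z \<in> M \<longleftrightarrow> m i + z + (x' - x) \<in> M" if "i < N" "norm z < R1" for i z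
    proof -
      have "norm (m i - x + z) < R"
        using near[of i] that norm_triangle_ineq[of "m i - x" z] by (simp add: R_def)
      then have "m i - x + z + x \<in> M \<longleftrightarrow> m i - x + z + x' \<in> M"
        using ag unfolding agree_iff in_shift_iff by blast
      then show ?thesis by (simp add: algebra_simps)
    qed
    have "m 0 + (x' - x) \<in> M" using xy by (simp add: m_def)
    then have "F (m N) - F (m 0) = F (m N + (x' - x)) - F (m 0 + (x' - x))"
      using increment_along_path[where F=F and M=M and ?R0.0=R0 and ?R1.0=R1 and m=m and N=N and t="x' - x" and i=N]
        step R0_less m st same by blast
    moreover have "y + (x' - x) = y'" using xy(6) by (simp add: algebra_simps)
    ultimately show ?thesis using N(2) by (simp add: m_def)
  qed
  moreover have "R > 0" using R0_pos R0_less by (simp add: R_def)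
  ultimately show ?thesis using that by blast
qed

text \<open>The radius \<open>R'\<close> will be chosen once and for all, while \<open>T\<close> depends on \<open>\<epsilon>\<close>.\<close>

definition close_across_planes :: "real \<Rightarrow> real \<Rightarrow> real \<Rightarrow> bool" where
  "close_across_planes R' \<epsilon> T \<longleftrightarrow> (\<forall>x\<in>M. \<forall>y\<in>M. \<forall>p.
     off_planes (planes T) (star x) \<longrightarrow> off_planes (planes T) (star y) \<longrightarrow>
     separators (planes T) (star x) (star y) = {p} \<longrightarrow> agree R' (shift M x) (shift M y) \<longrightarrow>
     \<bar>F x - F y\<bar> < \<epsilon>)"

text \<open>The disagreements between the patterns of \<open>x\<close> and \<open>y\<close> (the set \<open>walls\<close>) lie in a slab of width \<open>K\<close>
  orthogonal to \<open>e c\<close> and at distance at least \<open>R'\<close> from the origin.  Walk in the direction \<open>v\<close> that leads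
  away from them.  After the distance \<open>K + R0 / 3 + R1\<close> the slab is out of reach; before that the path stays
  so close to the origin that the balls of radius \<open>R1\<close> around its vertices contain no vector of length
  \<open>R' = K + R0 + 2 * R1\<close> or more.\<close>

lemma adjacent_values_close:
  obtains R' where "R' > 0" "\<And>\<epsilon>. \<epsilon> > 0 \<Longrightarrow> \<exists>T0. \<forall>T\<ge>T0. close_across_planes R' \<epsilon> T"
proof -
  obtain \<beta> where \<beta>: "\<And>T \<gamma>. \<gamma> \<in> visible T \<Longrightarrow> norm (fst \<gamma>) \<le> \<beta>" using visible_bounded by metis
  define D where "D = (\<lambda>(b, b'). b - b') ` (B \<times> B)"
  have D: "finite D" unfolding D_def using finite_B by blast
  have "\<exists>e K. norm e = 1 \<and> K \<ge> 0 \<and>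
      (\<forall>\<gamma>\<in>\<Gamma>. c \<bullet> fst \<gamma> \<in> D \<longrightarrow> norm (fst \<gamma>) \<le> 2 * \<beta> \<longrightarrow> \<bar>e \<bullet> snd \<gamma>\<bar> \<le> K)" if "c \<in> C" for c
  proof -
    have "c \<noteq> 0" using that zero_notin_C by blast
    then show ?thesis using wall_direction[OF _ D, of c "2 * \<beta>"] by metis
  qed
  then obtain e k where ek: "\<And>c. c \<in> C \<Longrightarrow> norm (e c) = 1" "\<And>c. c \<in> C \<Longrightarrow> k c \<ge> 0"
    "\<And>c \<gamma>. c \<in> C \<Longrightarrow> \<gamma> \<in> \<Gamma> \<Longrightarrow> c \<bullet> fst \<gamma> \<in> D \<Longrightarrow> norm (fst \<gamma>) \<le> 2 * \<beta> \<Longrightarrow> \<bar>e c \<bullet> snd \<gamma>\<bar> \<le> k c"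
    by metis
  define K where "K = sum k C"
  have K: "k c \<le> K" if "c \<in> C" for c unfolding K_def using that ek(2) finite_C by (intro member_le_sum) auto
  have K0: "K \<ge> 0" unfolding K_def using ek(2) by (intro sum_nonneg) auto
  define R' where "R' = K + R0 + 2 * R1"
  have "\<exists>T0. \<forall>T\<ge>T0. close_across_planes R' \<epsilon> T" if \<epsilon>: "\<epsilon> > 0" for \<epsilon>
  proof -
    obtain r where r: "r > 0"
      "\<And>x y. x \<in> M \<Longrightarrow> y \<in> M \<Longrightarrow> agree r (shift M x) (shift M y) \<Longrightarrow> \<bar>F x - F y\<bar> < \<epsilon>"
      using uniform[OF \<epsilon>] by metis
    define l where "l = R0 / 3"
    have l: "l > 0" using R0_pos by (simp add: l_def)
    obtain N :: nat where "(K + l + max r R1) / l < real N" using reals_Archimedean2 by blast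
    then have N: "K + l + max r R1 < real N * l" using l by (simp add: field_simps)
    define T0 where "T0 = real N * l + l + max r R1"
    show ?thesis
      unfolding close_across_planes_def
    proof (intro exI[of _ T0] allI impI ballI)
      fix T x y p
      assume T: "T0 \<le> T" and x: "x \<in> M" and y: "y \<in> M"
        and off: "off_planes (planes T) (star x)" "off_planes (planes T) (star y)"
        and sep: "separators (planes T) (star x) (star y) = {p}"
        and ag: "agree R' (shift M x) (shift M y)"
      define c where "c = fst p"
      have "separators (planes T) (star x) (star y) \<subseteq> planes T" by (auto simp: separators_def)
      then have "p \<in> planes T" unfolding sep by simp
      then have cC: "c \<in> C" using planes_normal[of "fst p" "snd p" T] by (simp add: c_def)
      \<comment> \<open>the lattice vectors at which the patterns around \<open>x\<close> and \<open>y\<close> disagree\<close>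
      define walls where "walls = {\<gamma> \<in> \<Gamma>. norm (snd \<gamma>) < T \<and> (x + snd \<gamma> \<in> M) \<noteq> (y + snd \<gamma> \<in> M)}"
      have wall: "\<gamma> \<in> visible T \<and> c \<bullet> fst \<gamma> + snd p \<in> B" if \<gamma>: "\<gamma> \<in> walls" for \<gamma>
      proof -
        have g: "\<gamma> \<in> \<Gamma>" "norm (snd \<gamma>) < T" using \<gamma> by (auto simp: walls_def)
        have "\<gamma> \<in> visible T \<and> (\<exists>c\<in>C. \<exists>b\<in>B. (c, b - c \<bullet> fst \<gamma>) \<in> separators (planes T) (star x) (star y))"
        proof (cases "x + snd \<gamma> \<in> M")
          case True
          then have "y + snd \<gamma> \<notin> M" using \<gamma> by (simp add: walls_def)
          then show ?thesis using patch_difference[OF x y off g True] by blast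
        next
          case False
          then have "y + snd \<gamma> \<in> M" using \<gamma> by (simp add: walls_def)
          then show ?thesis using patch_difference[OF y x off(2,1) g _ False]
            unfolding separators_sym[of _ "star y"] by blast
        qed
        then show ?thesis unfolding sep by (auto simp: c_def)
      qed
      have wall_far: "norm (snd \<gamma>) \<ge> R'" if \<gamma>: "\<gamma> \<in> walls" for \<gamma>
      proof (rule ccontr)
        assume "\<not> norm (snd \<gamma>) \<ge> R'"
        then have "snd \<gamma> + x \<in> M \<longleftrightarrow> snd \<gamma> + y \<in> M" using ag unfolding agree_iff in_shift_iff by simp
        then show False using \<gamma> by (simp add: walls_def add.commute)
      qed
      have slab: "\<bar>e c \<bullet> snd \<gamma> - e c \<bullet> snd \<gamma>'\<bar> \<le> K" if \<gamma>: "\<gamma> \<in> walls" "\<gamma>' \<in> walls" for \<gamma> \<gamma>'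
      proof -
        have "c \<bullet> fst (\<gamma> - \<gamma>') = (c \<bullet> fst \<gamma> + snd p) - (c \<bullet> fst \<gamma>' + snd p)" by (simp add: inner_diff_right)
        then have "c \<bullet> fst (\<gamma> - \<gamma>') \<in> D"
          using wall[OF \<gamma>(1)] wall[OF \<gamma>(2)] unfolding D_def
          by (intro image_eqI[of _ _ "(c \<bullet> fst \<gamma> + snd p, c \<bullet> fst \<gamma>' + snd p)"]) auto
        moreover have "norm (fst (\<gamma> - \<gamma>')) \<le> 2 * \<beta>"
          using \<beta>[of \<gamma> T] \<beta>[of \<gamma>' T] wall[OF \<gamma>(1)] wall[OF \<gamma>(2)] norm_triangle_ineq4[of "fst \<gamma>" "fst \<gamma>'"]
          by simp
        moreover have "\<gamma> - \<gamma>' \<in> \<Gamma>" using \<gamma> lattice_diff by (simp add: walls_def)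
        ultimately have "\<bar>e c \<bullet> snd (\<gamma> - \<gamma>')\<bar> \<le> k c" using ek(3)[OF cC] by blast
        then show ?thesis using K[OF cC] by (simp add: inner_diff_right)
      qed
      obtain v where v: "norm v = 1" "\<And>\<gamma>. \<gamma> \<in> walls \<Longrightarrow> v \<bullet> snd \<gamma> \<le> K"
      proof (cases "\<exists>\<gamma>0\<in>walls. e c \<bullet> snd \<gamma>0 > 0")
        case True
        then obtain \<gamma>0 where \<gamma>0: "\<gamma>0 \<in> walls" "e c \<bullet> snd \<gamma>0 > 0" by blast
        have "- e c \<bullet> snd \<gamma> \<le> K" if "\<gamma> \<in> walls" for \<gamma> using slab[OF that \<gamma>0(1)] \<gamma>0(2) by simp
        then show ?thesis using that[of "- e c"] ek(1)[OF cC] by simp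
      next
        case False
        then have "e c \<bullet> snd \<gamma> \<le> K" if "\<gamma> \<in> walls" for \<gamma> using that K0 by fastforce
        then show ?thesis using that[of "e c"] ek(1)[OF cC] by simp
      qed
      \<comment> \<open>the two bounds are used after and before leaving the slab, respectively\<close>
      have avoid: "norm (snd \<gamma> - u) \<ge> t - K - l \<and> norm (snd \<gamma> - u) \<ge> R' - t - l"
        if \<gamma>: "\<gamma> \<in> walls" and t: "t \<ge> 0" and u: "norm (u - t *\<^sub>R v) \<le> l" for \<gamma> t u
      proof
        have "v \<bullet> v = 1" using v(1) by (simp add: norm_eq_1)
        then have "v \<bullet> (u - snd \<gamma>) = t + v \<bullet> (u - t *\<^sub>R v) - v \<bullet> snd \<gamma>" by (simp add: inner_diff_right)
        moreover have "\<bar>v \<bullet> (u - t *\<^sub>R v)\<bar> \<le> l"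
          using Cauchy_Schwarz_ineq2[of v "u - t *\<^sub>R v"] v(1) u by simp
        moreover have "v \<bullet> (u - snd \<gamma>) \<le> norm (snd \<gamma> - u)"
          using norm_cauchy_schwarz[of v "u - snd \<gamma>"] v(1) by (simp add: norm_minus_commute)
        ultimately show "norm (snd \<gamma> - u) \<ge> t - K - l" using v(2)[OF \<gamma>] by linarith
        have "norm u \<le> norm (u - t *\<^sub>R v) + norm (t *\<^sub>R v)" using norm_triangle_ineq[of "u - t *\<^sub>R v" "t *\<^sub>R v"] by simp
        then have "norm u \<le> l + t" using u v(1) t by simp
        then show "norm (snd \<gamma> - u) \<ge> R' - t - l"
          using wall_far[OF \<gamma>] norm_triangle_ineq2[of "snd \<gamma>" u] by linarith
      qed
      obtain pt where pt: "\<And>z. pt z \<in> M" "\<And>z. dist z (pt z) \<le> l" using covering unfolding l_def by metis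
      define m where "m i = (if i = 0 then x else pt (x + (real i * l) *\<^sub>R v))" for i
      have mM: "m i \<in> M" for i using pt x by (simp add: m_def)
      have mq: "norm (m i - x - (real i * l) *\<^sub>R v) \<le> l" for i
        using pt(2)[of "x + (real i * l) *\<^sub>R v"] l
        by (simp add: m_def dist_norm norm_minus_commute diff_diff_eq)
      have st: "norm (m (Suc i) - m i) \<le> R0" for i
      proof -
        have "m (Suc i) - m i = (m (Suc i) - x - (real (Suc i) * l) *\<^sub>R v) + l *\<^sub>R v - (m i - x - (real i * l) *\<^sub>R v)"
          by (simp add: algebra_simps)
        also have "norm \<dots> \<le> norm (m (Suc i) - x - (real (Suc i) * l) *\<^sub>R v) + norm (l *\<^sub>R v) + norm (m i - x - (real i * l) *\<^sub>R v)"
          by (meson add_right_mono norm_triangle_ineq norm_triangle_ineq4 order_trans)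
        also have "\<dots> \<le> R0" using mq[of "Suc i"] mq[of i] v(1) l by (simp add: l_def)
        finally show ?thesis .
      qed
      have same: "m i + z \<in> M \<longleftrightarrow> m i + z + (y - x) \<in> M"
        if i: "i \<le> N" and z: "norm z < \<rho>" "\<rho> \<le> max r R1"
          and \<rho>: "\<rho> \<le> R1 \<or> real i * l \<ge> K + l + \<rho>" for i z \<rho>
      proof (rule ccontr)
        assume ne: "\<not> ?thesis"
        define u where "u = m i - x"
        have u: "norm (u - (real i * l) *\<^sub>R v) \<le> l" using mq[of i] by (simp add: u_def)
        have ne': "(x + (u + z) \<in> M) \<noteq> (y + (u + z) \<in> M)"
          using ne by (simp add: u_def algebra_simps)
        have "\<exists>g. (g, u + z) \<in> \<Gamma>"
          using ne' star_lattice[OF x, of "x + (u + z)"] star_lattice[OF y, of "y + (u + z)"] by auto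
        then obtain g where g: "(g, u + z) \<in> \<Gamma>" by blast
        have "norm u \<le> norm (u - (real i * l) *\<^sub>R v) + norm ((real i * l) *\<^sub>R v)"
          using norm_triangle_ineq[of "u - (real i * l) *\<^sub>R v" "(real i * l) *\<^sub>R v"] by simp
        also have "\<dots> \<le> l + real i * l" using u v(1) l by simp
        also have "\<dots> \<le> l + real N * l" using i l by simp
        finally have "norm (u + z) < T"
          using z norm_triangle_ineq[of u z] T unfolding T0_def by linarith
        then have w: "(g, u + z) \<in> walls" using g ne' by (simp add: walls_def)
        have "norm z \<ge> real i * l - K - l" "norm z \<ge> R' - real i * l - l"
          using avoid[OF w _ u] l by auto
        then show False using \<rho> z(1) R0_pos l_def unfolding R'_def by (auto simp: field_simps)
      qed
      have "m 0 + (y - x) \<in> M" using y by (simp add: m_def)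
      moreover have "m i + z \<in> M \<longleftrightarrow> m i + z + (y - x) \<in> M" if "i < N" "norm z < R1" for i z
        using that by (intro same[where \<rho>=R1]) auto
      ultimately have end_: "m N + (y - x) \<in> M \<and> F (m N) - F (m 0) = F (m N + (y - x)) - F (m 0 + (y - x))"
        using increment_along_path[where F=F and M=M and ?R0.0=R0 and ?R1.0=R1 and m=m and N=N and t="y - x" and i=N]
          step R0_less mM st by blast
      have "agree r (shift M (m N)) (shift M (m N + (y - x)))"
        unfolding agree_iff in_shift_iff
      proof (intro allI impI)
        fix z :: 'd assume z: "norm z < r"
        have "real N * l \<ge> K + l + r" using N by linarith
        then have "m N + z \<in> M \<longleftrightarrow> m N + z + (y - x) \<in> M" using z by (intro same[where \<rho>=r]) auto
        then show "z + m N \<in> M \<longleftrightarrow> z + (m N + (y - x)) \<in> M" by (simp add: algebra_simps)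
      qed
      then have "\<bar>F (m N) - F (m N + (y - x))\<bar> < \<epsilon>" using r(2) mM end_ by blast
      moreover have "F x - F y = F (m N) - F (m N + (y - x))" using end_ by (simp add: m_def)
      ultimately show "\<bar>F x - F y\<bar> < \<epsilon>" by simp
    qed
  qed
  moreover have "R' > 0" using K0 R0_pos R0_less by (simp add: R'_def)
  ultimately show ?thesis using that by blast
qed

end

section \<open>Additive functions from affine increments\<close>

lemma finite_image_factor:
  assumes "finite (\<phi> ` S)" "\<And>x y. x \<in> S \<Longrightarrow> y \<in> S \<Longrightarrow> \<phi> x = \<phi> y \<Longrightarrow> f x = f y"
  shows "finite (f ` S)"
proof -
  have "f ` S \<subseteq> (\<lambda>v. f (SOME x. x \<in> S \<and> \<phi> x = v)) ` (\<phi> ` S)"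
  proof
    fix u assume "u \<in> f ` S"
    then obtain x where x: "x \<in> S" "u = f x" by blast
    define y where "y = (SOME y. y \<in> S \<and> \<phi> y = \<phi> x)"
    have "y \<in> S \<and> \<phi> y = \<phi> x" unfolding y_def by (rule someI[of _ x]) (use x in auto)
    then have "f x = f y" using assms(2) x(1) by metis
    then show "u \<in> (\<lambda>v. f (SOME x. x \<in> S \<and> \<phi> x = v)) ` (\<phi> ` S)"
      using x unfolding y_def by blast
  qed
  then show ?thesis using assms(1) finite_subset by blast
qed

lemma additive_of_nat:
  assumes "Modules.additive (L :: 'a::real_vector \<Rightarrow> real)"
  shows "L (real n *\<^sub>R t) = real n * L t"
  using additive.zero[OF assms] additive.add[OF assms]
  by (induction n) (simp_all add: scaleR_left_distrib distrib_right)

text \<open>Near \<open>0\<close> the increment \<open>l\<close> of \<open>g\<close> is additive; its extension to all vectors is \<open>2 ^ n * l (t / 2 ^ n)\<close>, for any \<open>n\<close>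
  that makes \<open>t / 2 ^ n\<close> short enough.\<close>

lemma affine_increments_extend:
  fixes g :: "'a::real_normed_vector \<Rightarrow> real"
  assumes U: "open U" "convex U" "h0 \<in> U" and g: "continuous_on U g"
    and inc: "\<And>h k t. h \<in> U \<Longrightarrow> k \<in> U \<Longrightarrow> h + t \<in> U \<Longrightarrow> k + t \<in> U \<Longrightarrow> g (h + t) - g h = g (k + t) - g k"
  obtains L where "Modules.additive L" "continuous_on UNIV L"
    "\<And>h k. h \<in> U \<Longrightarrow> k \<in> U \<Longrightarrow> g k - g h = L (k - h)"
proof -
  obtain \<rho> where \<rho>: "\<rho> > 0" "ball h0 \<rho> \<subseteq> U" using U open_contains_ball by blast
  have inU: "h0 + t \<in> U" if "norm t < \<rho>" for t using \<rho>(2) that by (auto simp: dist_norm)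
  define l where "l t = g (h0 + t) - g h0" for t
  have ladd: "l (s + t) = l s + l t" if "norm s < \<rho>" "norm t < \<rho>" "norm (s + t) < \<rho>" for s t
    using inc[of "h0 + s" h0 t] inU[OF that(1)] inU[OF that(2)] inU[OF that(3)] U(3)
    by (simp add: l_def algebra_simps)
  define L where "L t = 2 ^ (LEAST n. norm t < \<rho> * 2 ^ n) * l ((1 / 2 ^ (LEAST n. norm t < \<rho> * 2 ^ n)) *\<^sub>R t)" for t
  have ex: "\<exists>n. norm t < \<rho> * 2 ^ n" for t :: 'a
    using real_arch_pow[of 2 "norm t / \<rho>"] \<rho>(1) by (auto simp: field_simps)
  have L: "L t = 2 ^ n * l ((1 / 2 ^ n) *\<^sub>R t)" if n: "norm t < \<rho> * 2 ^ n" for t n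
  proof -
    define n0 where "n0 = (LEAST n. norm t < \<rho> * 2 ^ n)"
    have "n0 \<le> n" unfolding n0_def using n by (rule Least_le)
    have n0: "norm t < \<rho> * 2 ^ n0" unfolding n0_def using ex[of t] by (rule LeastI_ex)
    have "2 ^ m * l ((1 / 2 ^ m) *\<^sub>R t) = L t" if "n0 \<le> m" for m
      using that
    proof (induction m rule: dec_induct)
      case base then show ?case by (simp add: L_def n0_def)
    next
      case (step m)
      define u where "u = (1 / 2 ^ Suc m) *\<^sub>R t"
      have "\<rho> * 2 ^ n0 \<le> \<rho> * 2 ^ m" using step(1) \<rho>(1) by simp
      then have m: "norm t < \<rho> * 2 ^ m" using n0 by linarith
      then have "norm ((1 / 2 ^ m) *\<^sub>R t) < \<rho>" by (simp add: field_simps)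
      moreover have uu: "u + u = (1 / 2 ^ m) *\<^sub>R t"
        unfolding u_def scaleR_left_distrib[symmetric] by (simp add: field_simps)
      moreover have "norm u < \<rho>"
      proof -
        have "norm (u + u) = 2 * norm u" by (simp add: scaleR_2[symmetric])
        moreover have "norm (u + u) < \<rho>" unfolding uu by fact
        ultimately show ?thesis using norm_ge_zero[of u] by linarith
      qed
      ultimately have "l ((1 / 2 ^ m) *\<^sub>R t) = 2 * l u" using ladd[of u u] by simp
      then show ?case using step(3) by (simp add: u_def)
    qed
    then show ?thesis using \<open>n0 \<le> n\<close> by simp
  qed
  have Lsmall: "L t = l t" if "norm t < \<rho>" for t using L[of t 0] that by simp
  have pow: "\<rho> * 2 ^ i \<le> \<rho> * 2 ^ j" if "i \<le> j" for i j :: nat using that \<rho>(1) by simp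
  have add: "L (s + t) = L s + L t" for s t
  proof -
    obtain i where i: "norm s < \<rho> * 2 ^ i" using ex[of s] by blast
    obtain j where j: "norm t < \<rho> * 2 ^ j" using ex[of t] by blast
    obtain k where k: "norm (s + t) < \<rho> * 2 ^ k" using ex[of "s + t"] by blast
    define n where "n = max i (max j k)"
    have n: "norm s < \<rho> * 2 ^ n" "norm t < \<rho> * 2 ^ n" "norm (s + t) < \<rho> * 2 ^ n"
      using i j k pow[of i n] pow[of j n] pow[of k n] unfolding n_def by linarith+
    have "norm ((1 / 2 ^ n) *\<^sub>R u) < \<rho>" if "norm u < \<rho> * 2 ^ n" for u :: 'a
      using that by (simp add: field_simps)
    then have "l ((1 / 2 ^ n) *\<^sub>R s + (1 / 2 ^ n) *\<^sub>R t) = l ((1 / 2 ^ n) *\<^sub>R s) + l ((1 / 2 ^ n) *\<^sub>R t)"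
      using n by (intro ladd) (auto simp: scaleR_right_distrib[symmetric])
    then show ?thesis using L[OF n(1)] L[OF n(2)] L[OF n(3)]
      by (simp add: scaleR_right_distrib distrib_left)
  qed
  then have additive: "Modules.additive L" by (rule additive.intro)
  have "continuous_on UNIV L"
    unfolding continuous_on_iff
  proof (intro ballI allI impI)
    fix x :: 'a and e :: real assume e: "e > 0"
    obtain d where d: "d > 0" "\<And>h. h \<in> U \<Longrightarrow> dist h h0 < d \<Longrightarrow> dist (g h) (g h0) < e"
      using g U(3) e unfolding continuous_on_iff by metis
    have "dist (L y) (L x) < e" if y: "dist y x < min d \<rho>" for y
    proof -
      have "norm (y - x) < \<rho>" "norm (y - x) < d" using y by (auto simp: dist_norm)
      then have "\<bar>L (y - x)\<bar> < e"
        using Lsmall[of "y - x"] d(2)[OF inU[of "y - x"]] by (simp add: l_def dist_real_def dist_norm)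
      then show ?thesis using additive.diff[OF additive, of y x] by (simp add: dist_real_def)
    qed
    then show "\<exists>d>0. \<forall>x'\<in>UNIV. dist x' x < d \<longrightarrow> dist (L x') (L x) < e"
      using d(1) \<rho>(1) by (intro exI[of _ "min d \<rho>"]) auto
  qed
  moreover have "g k - g h = L (k - h)" if hk: "h \<in> U" "k \<in> U" for h k
  proof -
    obtain n where n: "norm (k - h) < \<rho> * 2 ^ n" using ex[of "k - h"] by blast
    define t where "t = (1 / 2 ^ n) *\<^sub>R (k - h)"
    have t: "norm t < \<rho>" using n unfolding t_def norm_scaleR by (simp add: field_simps)
    have seg: "h + real j *\<^sub>R t \<in> U" if j: "j \<le> 2 ^ n" for j :: nat
    proof -
      define a where "a = real j / 2 ^ n"
      have "real j \<le> 2 ^ n" using j by (metis of_nat_le_iff of_nat_numeral of_nat_power)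
      then have "0 \<le> a" "a \<le> 1" by (auto simp: a_def field_simps)
      then have "(1 - a) *\<^sub>R h + a *\<^sub>R k \<in> U" using U(2) hk by (simp add: convex_alt)
      moreover
      have jt: "real j *\<^sub>R t = a *\<^sub>R (k - h)" by (simp add: t_def a_def)
      then have "h + real j *\<^sub>R t = (1 - a) *\<^sub>R h + a *\<^sub>R k" by (simp add: algebra_simps)
      ultimately show ?thesis by simp
    qed
    have "g (h + real j *\<^sub>R t) - g h = real j * l t" if "j \<le> 2 ^ n" for j :: nat
      using that
    proof (induction j)
      case (Suc j)
      have "g (h + real j *\<^sub>R t + t) - g (h + real j *\<^sub>R t) = g (h0 + t) - g h0"
        using seg[of j] seg[of "Suc j"] Suc(2) U(3) inU[OF t]
        by (intro inc) (auto simp: algebra_simps)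
      then show ?case using Suc by (simp add: l_def algebra_simps)
    qed simp
    from this[of "2 ^ n"] show ?thesis using L[OF n] by (simp add: t_def)
  qed
  ultimately show ?thesis using that additive by blast
qed

lemma additive_eq_if_eq_near_0:
  fixes L L' :: "'a::real_normed_vector \<Rightarrow> real"
  assumes L: "Modules.additive L" "continuous_on UNIV L" "Modules.additive L'" "continuous_on UNIV L'"
    and \<rho>: "\<rho> > 0" and D: "closure D = UNIV" and eq: "\<And>t. t \<in> D \<Longrightarrow> norm t < \<rho> \<Longrightarrow> L t = L' t"
  shows "L = L'"
proof
  fix t :: 'a
  have small: "L u = L' u" if u: "norm u < \<rho>" for u
  proof -
    have "u \<in> closure (D \<inter> ball 0 \<rho>)"
      using u D open_Int_closure_subset[of "ball 0 \<rho>" D] by (auto simp: Int_commute)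
    moreover have "closure (D \<inter> ball 0 \<rho>) \<subseteq> {v. L v = L' v}"
      using eq L(2,4) by (intro closure_minimal closed_Collect_eq) auto
    ultimately show ?thesis by blast
  qed
  obtain n :: nat where n: "norm t / \<rho> < real n" using reals_Archimedean2 by blast
  then have n0: "real n > 0" using \<rho> by (smt (verit) divide_nonneg_nonneg norm_ge_zero)
  define u where "u = (1 / real n) *\<^sub>R t"
  have "norm u < \<rho>" using n n0 \<rho> by (simp add: u_def field_simps)
  moreover have "t = real n *\<^sub>R u" using n0 by (simp add: u_def)
  ultimately show "L t = L' t" using small additive_of_nat L(1,3) by metis
qed

lemma finite_gap:
  assumes "finite (V :: real set)"
  obtains e where "e > 0" "\<And>a b. a \<in> V \<Longrightarrow> b \<in> V \<Longrightarrow> \<bar>a - b\<bar> < e \<Longrightarrow> a = b"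
  using assms uniform_discrete_finite_iff[of V] unfolding uniform_discrete_def dist_real_def by metis

context pattern_cocycle
begin

section \<open>Affine behaviour on chambers\<close>

lemma planes_independent:
  "(c, s) \<in> planes T \<Longrightarrow> (c', s') \<in> planes T \<Longrightarrow> c \<noteq> c' \<Longrightarrow> \<forall>a b. a *\<^sub>R c = b *\<^sub>R c' \<longrightarrow> a = 0"
  using planes_normal not_parallel by blast

lemma open_meets_off_planes:
  assumes "open U" "U \<noteq> {}"
  obtains q where "q \<in> U" "off_planes (planes T) q"
  by (rule open_meets_generic[OF finite_planes[of T] planes_nonzero assms])
    (auto simp: off_planes_def)

lemma regular_recurrence_off_planes:
  assumes "x \<in> M" "\<eta> > 0"
  obtains y where "y \<in> M" "agree r (shift M x) (shift M y)" "dist (star y) (star x) < \<eta>"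
    "off_planes (planes T) (star y)"
  by (rule regular_recurrence[where r=r, OF assms finite_planes[of T] planes_nonzero])
    (auto simp: off_planes_def)

text \<open>Cross the separating planes one at a time.  None of them belongs to \<open>planes R'\<close>, so that the intermediate
  points stay in the chamber of \<open>planes R'\<close>, and all the points involved share their pattern of radius \<open>R'\<close>.\<close>

lemma chain_of_chambers:
  assumes R': "R' > 0" "R' \<le> T" and \<epsilon>: "\<epsilon> > 0"
    and adj: "close_across_planes R' \<epsilon> T"
    and same: "\<And>x y. x \<in> M \<Longrightarrow> y \<in> M \<Longrightarrow> agree T (shift M x) (shift M y) \<Longrightarrow> \<bar>F x - F y\<bar> < \<epsilon>"
    and xy: "x \<in> M" "y \<in> M" "off_planes (planes T) (star x)" "off_planes (planes T) (star y)"
      "star y \<in> chamber (planes R') (star x)" "card (separators (planes T) (star x) (star y)) = n"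
  shows "\<bar>F x - F y\<bar> \<le> (real n + 1) * \<epsilon>"
  using xy
proof (induction n arbitrary: x)
  case 0
  have "finite (separators (planes T) (star x) (star y))"
    by (rule finite_subset[OF _ finite_planes[of T]]) (auto simp: separators_def)
  then have "star y \<in> chamber (planes T) (star x)" using 0 by (simp add: chamber_def)
  then show ?case using same[OF 0(1,2) same_chamber_agree[OF 0(1,2,3)]] by simp
next
  case (Suc n)
  let ?S = "separators (planes T) (star x) (star y)"
  have offR: "off_planes (planes R') (star x)" using off_planes_mono[OF planes_mono[OF R'(2)] Suc(4)] .
  have ne: "?S \<noteq> {}" using Suc(7) by auto
  obtain U p where U: "open U" "U \<noteq> {}" "p \<in> ?S"
    "\<And>z. z \<in> U \<Longrightarrow> off_planes (planes T) z \<and> separators (planes T) (star x) z = {p} \<and>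
       separators (planes T) z (star y) = ?S - {p}"
    by (rule adjacent_chamber[of "planes T" "star x" "star y", OF finite_planes _ _ Suc(4,5) ne])
      (erule (2) planes_independent | erule planes_nonzero | blast)+
  have pR: "p \<notin> planes R'"
  proof
    assume "p \<in> planes R'"
    then have "p \<in> separators (planes R') (star x) (star y)" using U(3) by (auto simp: separators_def)
    then show False using Suc(6) by (simp add: chamber_def)
  qed
  have Uch: "U \<subseteq> chamber (planes R') (star x)"
  proof
    fix z assume z: "z \<in> U"
    have "separators (planes R') (star x) z \<subseteq> {p} \<inter> planes R'"
      using U(4)[OF z] separators_mono[OF planes_mono[OF R'(2)], of "star x" z] by (auto simp: separators_def)
    then show "z \<in> chamber (planes R') (star x)"
      using pR off_planes_mono[OF planes_mono[OF R'(2)]] U(4)[OF z] by (auto simp: chamber_def)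
  qed
  then have "U \<inter> interior W \<noteq> {}"
    using U(2) chamber_subset_interior[OF Suc(2) R'(1) offR] by blast
  then obtain z where z: "z \<in> M" "star z \<in> U" using dense_in_M[OF U(1)] by metis
  note Uz = U(4)[OF z(2)]
  have chz: "star z \<in> chamber (planes R') (star x)" using z(2) Uch by blast
  have "\<bar>F x - F z\<bar> < \<epsilon>"
    using adj Suc(2,4) z(1) Uz same_chamber_agree[OF Suc(2) z(1) offR chz]
    unfolding close_across_planes_def by blast
  moreover have "\<bar>F z - F y\<bar> \<le> (real n + 1) * \<epsilon>"
  proof (rule Suc(1)[OF z(1) Suc(3)])
    show "off_planes (planes T) (star z)" using Uz by blast
    show "star y \<in> chamber (planes R') (star z)" using Suc(6) chamber_eq[OF chz] by simp
    show "card (separators (planes T) (star z) (star y)) = n" using Uz U(3) Suc(7) by simp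
  qed (rule Suc(5))
  ultimately show ?case by (simp add: algebra_simps)
qed

text \<open>Parallel planes of the finite arrangement have a minimal distance, so two close points are separated by at
  most one plane with given normal.\<close>

lemma separators_le_card_normals:
  obtains \<delta> where "\<delta> > 0" "\<And>h k. dist h k < \<delta> \<Longrightarrow> card (separators (planes T) h k) \<le> card C"
proof -
  obtain e where e: "e > 0" "\<And>a b. a \<in> snd ` planes T \<Longrightarrow> b \<in> snd ` planes T \<Longrightarrow> \<bar>a - b\<bar> < e \<Longrightarrow> a = b"
    using finite_gap[OF finite_imageI[OF finite_planes[of T], of snd]] by metis
  define K where "K = 1 + (\<Sum>c\<in>C. norm c)"
  have K: "norm c \<le> K" if "c \<in> C" for c
    using member_le_sum[OF that, of norm] finite_C by (simp add: K_def)
  have K0: "K > 0" unfolding K_def by (intro add_pos_nonneg sum_nonneg) auto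
  have "card (separators (planes T) h k) \<le> card C" if hk: "dist h k < e / K" for h k
  proof (rule card_inj_on_le[of fst])
    show "finite C" by (rule finite_C)
    show "fst ` separators (planes T) h k \<subseteq> C" using planes_normal by (auto simp: separators_def)
    show "inj_on fst (separators (planes T) h k)"
    proof (rule inj_onI)
      fix p q assume p: "p \<in> separators (planes T) h k" and q: "q \<in> separators (planes T) h k"
        and eq: "fst p = fst q"
      have pT: "p \<in> planes T" "q \<in> planes T" using p q by (auto simp: separators_def)
      have "fst p \<in> C" using planes_normal[of "fst p" "snd p" T] pT by simp
      then have "\<bar>fst p \<bullet> (h - k)\<bar> \<le> K * dist h k"
        using Cauchy_Schwarz_ineq2[of "fst p" "h - k"] K[of "fst p"]
        by (metis dist_norm mult_right_mono norm_ge_zero order_trans)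
      also have "\<dots> < e" using hk K0 by (simp add: field_simps)
      finally have "\<bar>fst p \<bullet> h - fst p \<bullet> k\<bar> < e" by (simp add: inner_diff_right)
      moreover have "\<bar>snd p - snd q\<bar> \<le> \<bar>fst p \<bullet> h - fst p \<bullet> k\<bar>"
        using p q eq by (auto simp: separators_def)
      ultimately have "snd p = snd q" using e(2)[of "snd p" "snd q"] pT by auto
      then show "p = q" using eq by (simp add: prod_eq_iff)
    qed
  qed
  then show ?thesis using that[of "e / K"] e(1) K0 by simp
qed

definition uniform_on_chambers :: "real \<Rightarrow> bool" where
  "uniform_on_chambers R' \<longleftrightarrow> (\<forall>\<epsilon>>0. \<exists>\<delta>>0. \<forall>x\<in>M. \<forall>y\<in>M. off_planes (planes R') (star x) \<longrightarrow>
     star y \<in> chamber (planes R') (star x) \<longrightarrow> dist (star x) (star y) < \<delta> \<longrightarrow> \<bar>F x - F y\<bar> < \<epsilon>)"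

text \<open>The number of planes between two close addresses is at most the number of normals, which does not depend on
  the error \<open>\<epsilon>\<close>.\<close>

lemma uniformly_continuous_on_chambers: "\<exists>R'>0. uniform_on_chambers R'"
proof -
  obtain R' where R': "R' > 0" "\<And>\<epsilon>. \<epsilon> > 0 \<Longrightarrow> \<exists>T0. \<forall>T\<ge>T0. close_across_planes R' \<epsilon> T"
    using adjacent_values_close by metis
  have "\<exists>\<delta>>0. \<forall>x\<in>M. \<forall>y\<in>M. off_planes (planes R') (star x) \<longrightarrow>
     star y \<in> chamber (planes R') (star x) \<longrightarrow> dist (star x) (star y) < \<delta> \<longrightarrow> \<bar>F x - F y\<bar> < \<epsilon>"
    if \<epsilon>: "\<epsilon> > 0" for \<epsilon>
  proof -
    \<comment> \<open>\<open>card C + 1\<close> errors from the chain of chambers, two from moving \<open>x\<close> and \<open>y\<close> off the planes\<close>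
    define \<epsilon>0 where "\<epsilon>0 = \<epsilon> / (real (card C) + 3)"
    have \<epsilon>0: "\<epsilon>0 > 0" "(real (card C) + 3) * \<epsilon>0 = \<epsilon>" using \<epsilon> by (auto simp: \<epsilon>0_def)
    obtain T0 where T0: "\<forall>T\<ge>T0. close_across_planes R' \<epsilon>0 T" using R'(2)[OF \<epsilon>0(1)] by blast
    obtain r where r: "r > 0"
      "\<And>x y. x \<in> M \<Longrightarrow> y \<in> M \<Longrightarrow> agree r (shift M x) (shift M y) \<Longrightarrow> \<bar>F x - F y\<bar> < \<epsilon>0"
      using uniform[OF \<epsilon>0(1)] by metis
    define T where "T = max T0 (max r R')"
    have T: "T0 \<le> T" "r \<le> T" "R' \<le> T" by (auto simp: T_def)
    obtain \<delta> where \<delta>: "\<delta> > 0" "\<And>h k. dist h k < \<delta> \<Longrightarrow> card (separators (planes T) h k) \<le> card C"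
      using separators_le_card_normals by metis
    have "\<bar>F x - F y\<bar> < \<epsilon>"
      if xy: "x \<in> M" "y \<in> M" and off: "off_planes (planes R') (star x)"
        and ch: "star y \<in> chamber (planes R') (star x)" and dxy: "dist (star x) (star y) < \<delta>" for x y
    proof -
      have op: "open (chamber (planes R') (star x))" by (rule chamber_open[OF finite_planes off])
      have near: "\<exists>z\<in>M. \<bar>F w - F z\<bar> < \<epsilon>0 \<and> dist (star z) (star w) < (\<delta> - dist (star x) (star y)) / 2 \<and>
          off_planes (planes T) (star z) \<and> star z \<in> chamber (planes R') (star x)"
        if w: "w \<in> M" "star w \<in> chamber (planes R') (star x)" for w
      proof -
        obtain \<eta> where \<eta>: "\<eta> > 0" "ball (star w) \<eta> \<subseteq> chamber (planes R') (star x)"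
          using op w(2) open_contains_ball by blast
        have "min \<eta> ((\<delta> - dist (star x) (star y)) / 2) > 0" using \<eta>(1) dxy by simp
        then obtain z where z: "z \<in> M" "agree r (shift M w) (shift M z)"
          "dist (star z) (star w) < min \<eta> ((\<delta> - dist (star x) (star y)) / 2)"
          "off_planes (planes T) (star z)"
          by (rule regular_recurrence_off_planes[OF w(1)])
        have "star z \<in> ball (star w) \<eta>" using z(3) by (simp add: dist_commute)
        then show ?thesis
          using z r(2)[OF w(1) z(1,2)] \<eta>(2) by (intro bexI[of _ z]) auto
      qed
      obtain x1 where x1: "x1 \<in> M" "\<bar>F x - F x1\<bar> < \<epsilon>0"
        "dist (star x1) (star x) < (\<delta> - dist (star x) (star y)) / 2"
        "off_planes (planes T) (star x1)" "star x1 \<in> chamber (planes R') (star x)"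
        using near[OF xy(1) chamber_self[OF off]] by blast
      obtain y1 where y1: "y1 \<in> M" "\<bar>F y - F y1\<bar> < \<epsilon>0"
        "dist (star y1) (star y) < (\<delta> - dist (star x) (star y)) / 2"
        "off_planes (planes T) (star y1)" "star y1 \<in> chamber (planes R') (star x)"
        using near[OF xy(2) ch] by blast
      have "dist (star x1) (star y1) \<le> dist (star x1) (star x) + dist (star x) (star y) + dist (star y1) (star y)"
        using dist_triangle[of "star x1" "star y1" "star x"] dist_triangle[of "star x" "star y1" "star y"]
        by (simp add: dist_commute)
      then have "dist (star x1) (star y1) < \<delta>" using x1(3) y1(3) by (simp add: field_simps)
      then have card: "card (separators (planes T) (star x1) (star y1)) \<le> card C" by (rule \<delta>(2))
      have chy: "star y1 \<in> chamber (planes R') (star x1)" using y1(5) chamber_eq[OF x1(5)] by simp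
      have "\<bar>F x1 - F y1\<bar> \<le> (real (card (separators (planes T) (star x1) (star y1))) + 1) * \<epsilon>0"
      proof (rule chain_of_chambers[OF R'(1) T(3) \<epsilon>0(1) _ _ x1(1) y1(1) x1(4) y1(4) chy refl])
        show "close_across_planes R' \<epsilon>0 T" using T0 T(1) by blast
        show "\<bar>F x - F y\<bar> < \<epsilon>0" if "x \<in> M" "y \<in> M" "agree T (shift M x) (shift M y)" for x y
          using r(2)[OF that(1,2) agree_mono[OF that(3) T(2)]] .
      qed
      also have "\<dots> \<le> (real (card C) + 1) * \<epsilon>0" using card \<epsilon>0(1) by simp
      finally show ?thesis using x1(2) y1(2) \<epsilon>0(2) by (simp add: algebra_simps)
    qed
    then show ?thesis using \<delta>(1) by blast
  qed
  then show ?thesis using R'(1) unfolding uniform_on_chambers_def by blast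
qed

lemma finite_increments:
  "finite ((\<lambda>x. F (x + v) - F x) ` {x \<in> M. x + v \<in> M})"
proof -
  obtain R where R: "R > 0" "\<And>x y x' y'. \<lbrakk>x \<in> M; y \<in> M; x' \<in> M; y' \<in> M; norm (y - x) \<le> norm v;
    y - x = y' - x'; agree R (shift M x) (shift M x')\<rbrakk> \<Longrightarrow> F y - F x = F y' - F x'"
    using long_increments[of "norm v"] by metis
  show ?thesis
  proof (rule finite_image_factor[of "\<lambda>x. shift M x \<inter> ball 0 R"])
    show "finite ((\<lambda>x. shift M x \<inter> ball 0 R) ` {x \<in> M. x + v \<in> M})"
      by (rule finite_subset[OF _ finite_local_complexity[of R]]) auto
    fix x y assume "x \<in> {x \<in> M. x + v \<in> M}" "y \<in> {x \<in> M. x + v \<in> M}"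
      "shift M x \<inter> ball 0 R = shift M y \<inter> ball 0 R"
    then show "F (x + v) - F x = F (y + v) - F y"
      by (intro R(2)) (auto simp: agree_def)
  qed
qed

text \<open>\<open>F\<close> extends to a continuous function \<open>g\<close> on the chamber.  An increment of \<open>g\<close> by a fixed lattice vector is
  continuous on a convex set and takes only the finitely many values of the corresponding increments of
  \<open>F\<close>.  Hence it is constant, and by density and continuity the same holds for arbitrary vectors.\<close>

lemma affine_on_chamber:
  assumes R': "R' > 0" and uc: "uniform_on_chambers R'"
    and x0: "x0 \<in> M" "off_planes (planes R') (star x0)"
  obtains L where "Modules.additive L" "continuous_on UNIV L"
    "\<And>x y. x \<in> M \<Longrightarrow> y \<in> M \<Longrightarrow> star x \<in> chamber (planes R') (star x0) \<Longrightarrow>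
       star y \<in> chamber (planes R') (star x0) \<Longrightarrow> F y - F x = L (star y - star x)"
proof -
  define Ch where "Ch = chamber (planes R') (star x0)"
  have Ch: "open Ch" "convex Ch" "star x0 \<in> Ch" "Ch \<subseteq> interior W"
    unfolding Ch_def using x0 R'
    by (auto intro!: chamber_open finite_planes chamber_convex chamber_self chamber_subset_interior[THEN subsetD])
  have close: "\<exists>\<delta>>0. \<forall>x\<in>M. \<forall>y\<in>M. star x \<in> Ch \<longrightarrow> star y \<in> Ch \<longrightarrow> dist (star x) (star y) < \<delta> \<longrightarrow> \<bar>F x - F y\<bar> < \<epsilon>"
    if \<epsilon>: "\<epsilon> > 0" for \<epsilon>
  proof -
    obtain \<delta> where \<delta>: "\<delta> > 0" "\<forall>x\<in>M. \<forall>y\<in>M. off_planes (planes R') (star x) \<longrightarrow>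
     star y \<in> chamber (planes R') (star x) \<longrightarrow> dist (star x) (star y) < \<delta> \<longrightarrow> \<bar>F x - F y\<bar> < \<epsilon>"
      using uc \<epsilon> unfolding uniform_on_chambers_def by blast
    have "off_planes (planes R') h \<and> chamber (planes R') h = Ch" if "h \<in> Ch" for h
      using that chamber_eq[of h "planes R'" "star x0"] by (auto simp: Ch_def chamber_def[of _ "star x0"])
    then show ?thesis using \<delta> by (intro exI[of _ \<delta>]) auto
  qed
  define f where "f h = F (SOME x. x \<in> M \<and> star x = h)" for h
  define X where "X = {star x | x. x \<in> M \<and> star x \<in> Ch}"
  have some: "(SOME y. y \<in> M \<and> star y = star x) \<in> M \<and> star (SOME y. y \<in> M \<and> star y = star x) = star x"
    if "x \<in> M" for x
    by (rule someI[of "\<lambda>y. y \<in> M \<and> star y = star x" x]) (use that in auto)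
  have fF: "f (star x) = F x" if x: "x \<in> M" "star x \<in> Ch" for x
  proof -
    define y where "y = (SOME y. y \<in> M \<and> star y = star x)"
    have y: "y \<in> M" "star y = star x" using some[OF x(1)] by (auto simp: y_def)
    have "\<bar>F y - F x\<bar> < \<epsilon>" if "\<epsilon> > 0" for \<epsilon> using close[OF that] x y by auto
    then have "F y = F x" by (metis abs_of_pos less_irrefl right_minus_eq zero_less_abs_iff)
    then show ?thesis by (simp add: f_def y_def)
  qed
  have "uniformly_continuous_on X f"
    unfolding uniformly_continuous_on_def
  proof (intro allI impI)
    fix \<epsilon> :: real assume "\<epsilon> > 0"
    then obtain \<delta> where "\<delta> > 0"
      "\<forall>x\<in>M. \<forall>y\<in>M. star x \<in> Ch \<longrightarrow> star y \<in> Ch \<longrightarrow> dist (star x) (star y) < \<delta> \<longrightarrow> \<bar>F x - F y\<bar> < \<epsilon>"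
      using close by blast
    then show "\<exists>d>0. \<forall>h\<in>X. \<forall>k\<in>X. dist k h < d \<longrightarrow> dist (f k) (f h) < \<epsilon>"
      using fF by (intro exI[of _ \<delta>]) (auto simp: X_def dist_real_def)
  qed
  then obtain g where g: "uniformly_continuous_on (closure X) g" "\<And>h. h \<in> X \<Longrightarrow> f h = g h"
    by (rule uniformly_continuous_on_extension_on_closure) blast
  have denseX: "\<exists>x\<in>M. star x \<in> U" if U: "open U" "U \<noteq> {}" "U \<subseteq> Ch" for U
  proof -
    have "U \<inter> interior W \<noteq> {}" using U Ch(4) by blast
    then show ?thesis using dense_in_M[OF U(1)] by metis
  qed
  have "Ch \<subseteq> closure X"
  proof
    fix h assume h: "h \<in> Ch"
    show "h \<in> closure X"
      unfolding closure_approachable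
    proof (intro allI impI)
      fix e :: real assume e: "e > 0"
      have "h \<in> ball h e \<inter> Ch" using h e by simp
      then have "open (ball h e \<inter> Ch)" "ball h e \<inter> Ch \<noteq> {}" using Ch(1) by blast+
      then obtain x where "x \<in> M" "star x \<in> ball h e \<inter> Ch" using denseX by blast
      then show "\<exists>y\<in>X. dist y h < e" by (intro bexI[of _ "star x"]) (auto simp: X_def dist_commute)
    qed
  qed
  then have gc: "continuous_on Ch g"
    using g(1) uniformly_continuous_imp_continuous continuous_on_subset by blast
  have gF: "g (star x) = F x" if "x \<in> M" "star x \<in> Ch" for x
  proof -
    have "star x \<in> X" using that unfolding X_def by blast
    then show ?thesis using g(2)[of "star x"] fF[OF that] by simp
  qed
  have lattice_inc: "g (h + fst \<gamma>) - g h = g (k + fst \<gamma>) - g k"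
    if \<gamma>: "\<gamma> \<in> \<Gamma>" and hk: "h \<in> Ch" "k \<in> Ch" "h + fst \<gamma> \<in> Ch" "k + fst \<gamma> \<in> Ch" for \<gamma> h k
  proof -
    define Q where "Q = Ch \<inter> (\<lambda>h. h + fst \<gamma>) -` Ch"
    have "open Q" unfolding Q_def by (intro open_Int Ch(1) open_vimage continuous_intros)
    have "(\<lambda>h. h + fst \<gamma>) -` Ch = (\<lambda>h. - fst \<gamma> + h) ` Ch" by (force simp: image_iff)
    then have "convex Q" unfolding Q_def using Ch(2) by (simp add: convex_Int convex_translation)
    define \<phi> where "\<phi> h = g (h + fst \<gamma>) - g h" for h
    have \<phi>: "continuous_on Q \<phi>"
      unfolding \<phi>_def Q_def
      by (intro continuous_intros continuous_on_compose2[OF gc] continuous_on_subset[OF gc]) auto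
    define V where "V = (\<lambda>x. F (x + snd \<gamma>) - F x) ` {x \<in> M. x + snd \<gamma> \<in> M}"
    have V: "finite V" unfolding V_def by (rule finite_increments)
    have "\<phi> ` Q \<subseteq> V"
    proof (rule ccontr)
      assume "\<not> \<phi> ` Q \<subseteq> V"
      then obtain h where h: "h \<in> Q" "\<phi> h \<in> - V" by blast
      have "open (Q \<inter> \<phi> -` (- V))"
        using continuous_open_preimage[OF \<phi> \<open>open Q\<close>] finite_imp_closed[OF V] by blast
      moreover have "Q \<inter> \<phi> -` (- V) \<subseteq> Ch" by (auto simp: Q_def)
      ultimately obtain x where x: "x \<in> M" "star x \<in> Q \<inter> \<phi> -` (- V)" using h denseX by blast
      have st: "star x \<in> Ch" "star x + fst \<gamma> \<in> Ch" using x(2) by (auto simp: Q_def)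
      have xg: "x + snd \<gamma> \<in> M" using translate_in_M[OF x(1) \<gamma>] st Ch(4) by blast
      have "\<phi> (star x) = F (x + snd \<gamma>) - F x"
        using gF[OF x(1) st(1)] gF[OF xg] star_translate(2)[OF x(1) \<gamma>] st(2) by (simp add: \<phi>_def)
      then have "\<phi> (star x) \<in> V" using x(1) xg by (auto simp: V_def)
      then show False using x(2) by simp
    qed
    then have "finite (\<phi> ` Q)" using V finite_subset by blast
    then have "\<phi> constant_on Q"
      using continuous_finite_range_constant[OF convex_connected[OF \<open>convex Q\<close>] \<phi>] by blast
    then have "\<phi> h = \<phi> k" using hk unfolding constant_on_def Q_def by (metis IntI vimageI2)
    then show ?thesis by (simp add: \<phi>_def)
  qed
  have inc: "g (h + t) - g h = g (k + t) - g k"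
    if hk: "h \<in> Ch" "k \<in> Ch" "h + t \<in> Ch" "k + t \<in> Ch" for h k t
  proof -
    have "\<exists>\<gamma>\<in>\<Gamma>. fst \<gamma> \<in> ball t (1 / real (Suc n))" for n
      by (rule lattice_dense[of "ball t (1 / real (Suc n))"]) auto
    then obtain \<gamma> where \<gamma>: "\<And>n. \<gamma> n \<in> \<Gamma>" "\<And>n. fst (\<gamma> n) \<in> ball t (1 / real (Suc n))" by metis
    have lim: "(\<lambda>n. fst (\<gamma> n)) \<longlonglongrightarrow> t"
    proof (rule metric_LIMSEQ_I)
      fix r :: real assume "r > 0"
      then obtain N where N: "1 / real (Suc N) < r" using nat_approx_posE by blast
      have "dist (fst (\<gamma> n)) t < r" if "n \<ge> N" for n
      proof -
        have "1 / real (Suc n) \<le> 1 / real (Suc N)" using that by (intro divide_left_mono) auto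
        then show ?thesis using \<gamma>(2)[of n] N by (simp add: dist_commute)
      qed
      then show "\<exists>no. \<forall>n\<ge>no. dist (fst (\<gamma> n)) t < r" by blast
    qed
    have ev: "eventually (\<lambda>n. u + fst (\<gamma> n) \<in> Ch) sequentially \<and> (\<lambda>n. g (u + fst (\<gamma> n)) - g u) \<longlonglongrightarrow> g (u + t) - g u"
      if "u + t \<in> Ch" for u
    proof -
      have l: "(\<lambda>n. u + fst (\<gamma> n)) \<longlonglongrightarrow> u + t" using lim by (intro tendsto_intros)
      have "isCont g (u + t)" using gc Ch(1) that continuous_on_eq_continuous_at by blast
      then have "(\<lambda>n. g (u + fst (\<gamma> n))) \<longlonglongrightarrow> g (u + t)" using l by (rule isCont_tendsto_compose)
      then show ?thesis using topological_tendstoD[OF l Ch(1) that] by (auto intro!: tendsto_intros)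
    qed
    have "eventually (\<lambda>n. g (h + fst (\<gamma> n)) - g h = g (k + fst (\<gamma> n)) - g k) sequentially"
      using conjunct1[OF ev[OF hk(3)]] conjunct1[OF ev[OF hk(4)]]
      by eventually_elim (use lattice_inc \<gamma>(1) hk(1,2) in blast)
    then have "(\<lambda>n. g (k + fst (\<gamma> n)) - g k) \<longlonglongrightarrow> g (h + t) - g h"
      using conjunct2[OF ev[OF hk(3)]] tendsto_cong by fast
    then show ?thesis using LIMSEQ_unique conjunct2[OF ev[OF hk(4)]] by blast
  qed
  obtain L where L: "Modules.additive L" "continuous_on UNIV L"
    "\<And>h k. h \<in> Ch \<Longrightarrow> k \<in> Ch \<Longrightarrow> g k - g h = L (k - h)"
    by (rule affine_increments_extend[OF Ch(1-3) gc]) (erule (3) inc | blast)+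
  show ?thesis
  proof (rule that[OF L(1,2)])
    fix x y assume "x \<in> M" "y \<in> M" "star x \<in> chamber (planes R') (star x0)" "star y \<in> chamber (planes R') (star x0)"
    then show "F y - F x = L (star y - star x)"
      using L(3)[of "star x" "star y"] gF by (simp add: Ch_def)
  qed
qed

text \<open>Let \<open>\<beta>\<close> be a lattice vector from one chamber to the other.  The increment of \<open>F\<close> by \<open>\<beta>\<close> is locally constant in the address
  off finitely many planes, so a small move changes \<open>F\<close> by the same amount in both chambers.\<close>

lemma slopes_agree:
  assumes R': "R' > 0" and x0: "x0 \<in> M" "off_planes (planes R') (star x0)"
    and x1: "x1 \<in> M" "off_planes (planes R') (star x1)"
    and L: "Modules.additive L" "continuous_on UNIV L" "Modules.additive L'" "continuous_on UNIV L'"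
    and FL: "\<And>x y. x \<in> M \<Longrightarrow> y \<in> M \<Longrightarrow> star x \<in> chamber (planes R') (star x0) \<Longrightarrow>
       star y \<in> chamber (planes R') (star x0) \<Longrightarrow> F y - F x = L (star y - star x)"
    and FL': "\<And>x y. x \<in> M \<Longrightarrow> y \<in> M \<Longrightarrow> star x \<in> chamber (planes R') (star x1) \<Longrightarrow>
       star y \<in> chamber (planes R') (star x1) \<Longrightarrow> F y - F x = L' (star y - star x)"
  shows "L = L'"
proof -
  define Ch0 Ch1 where "Ch0 = chamber (planes R') (star x0)" and "Ch1 = chamber (planes R') (star x1)"
  have Ch: "open Ch0" "open Ch1" "star x0 \<in> Ch0" "star x1 \<in> Ch1" "Ch0 \<subseteq> interior W" "Ch1 \<subseteq> interior W"
    unfolding Ch0_def Ch1_def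
    using x0(2) x1(2) chamber_subset_interior[OF x0(1) R' x0(2)] chamber_subset_interior[OF x1(1) R' x1(2)]
    by (simp_all add: chamber_open finite_planes chamber_self)
  define \<beta> where "\<beta> = (star x1 - star x0, x1 - x0)"
  have \<beta>: "\<beta> \<in> \<Gamma>" unfolding \<beta>_def by (rule star_lattice[OF x0(1) x1(1)])
  obtain R where R: "R > 0" "\<And>x y x' y'. \<lbrakk>x \<in> M; y \<in> M; x' \<in> M; y' \<in> M; norm (y - x) \<le> norm (snd \<beta>);
    y - x = y' - x'; agree R (shift M x) (shift M x')\<rbrakk> \<Longrightarrow> F y - F x = F y' - F x'"
    using long_increments[of "norm (snd \<beta>)"] by metis
  define Q where "Q = Ch0 \<inter> (\<lambda>h. h + fst \<beta>) -` Ch1"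
  have Q: "open Q" unfolding Q_def by (intro open_Int Ch(1) open_vimage Ch(2) continuous_intros)
  have "star x0 \<in> Q" using Ch(3,4) by (simp add: Q_def \<beta>_def)
  then have "Q \<noteq> {}" by blast
  obtain q where q: "q \<in> Q" "off_planes (planes R) q"
    by (rule open_meets_off_planes[OF Q \<open>Q \<noteq> {}\<close>])
  have oc: "open (Q \<inter> chamber (planes R) q)" using Q chamber_open[OF finite_planes q(2)] by blast
  moreover have "q \<in> Q \<inter> chamber (planes R) q \<inter> interior W"
    using q chamber_self[OF q(2)] Ch(5) by (auto simp: Q_def)
  ultimately obtain y where y: "y \<in> M" "star y \<in> Q \<inter> chamber (planes R) q" using dense_in_M by (metis empty_iff)
  have offy: "off_planes (planes R) (star y)" and chy: "chamber (planes R) (star y) = chamber (planes R) q"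
    using y(2) chamber_eq[of "star y" "planes R" q] by (simp_all add: chamber_def[of _ q])
  obtain \<rho> where \<rho>: "\<rho> > 0" "ball (star y) \<rho> \<subseteq> Q \<inter> chamber (planes R) q"
    using oc y(2) open_contains_ball by blast
  have Q_M: "z + snd \<beta> \<in> M" "star (z + snd \<beta>) = star z + fst \<beta>" if "z \<in> M" "star z \<in> Q" for z
  proof -
    have "star z + fst \<beta> \<in> interior W" using that(2) Ch(6) by (auto simp: Q_def)
    then show "z + snd \<beta> \<in> M" "star (z + snd \<beta>) = star z + fst \<beta>"
      using translate_in_M[OF that(1) \<beta>] star_translate(2)[OF that(1) \<beta>] by auto
  qed
  have yQ: "star y \<in> Q" using y(2) by blast
  show ?thesis
  proof (rule additive_eq_if_eq_near_0[OF L \<rho>(1), of "fst ` \<Gamma>"])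
    show "closure (fst ` \<Gamma>) = UNIV" using scheme by (simp add: cut_and_project_scheme_def)
    fix t assume "t \<in> fst ` \<Gamma>" and t: "norm t < \<rho>"
    then obtain \<gamma> where \<gamma>: "\<gamma> \<in> \<Gamma>" "t = fst \<gamma>" by blast
    have sz: "star y + fst \<gamma> \<in> Q \<inter> chamber (planes R) q" using t \<gamma>(2) \<rho>(2) by (auto simp: dist_norm)
    define z where "z = y + snd \<gamma>"
    have "star y + fst \<gamma> \<in> interior W" using sz Ch(5) by (auto simp: Q_def)
    then have z: "z \<in> M" "star z = star y + fst \<gamma>"
      unfolding z_def using translate_in_M[OF y(1) \<gamma>(1)] star_translate(2)[OF y(1) \<gamma>(1)] by auto
    have zQ: "star z \<in> Q" using sz z(2) by simp
    have "agree R (shift M y) (shift M z)"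
      using same_chamber_agree[OF y(1) z(1) offy] sz z(2) chy by simp
    then have eq: "F (y + snd \<beta>) - F y = F (z + snd \<beta>) - F z"
      using y(1) z(1) Q_M[OF y(1) yQ] Q_M[OF z(1) zQ] by (intro R(2)) auto
    have "F z - F y = L t"
      using FL[OF y(1) z(1)] yQ zQ z(2) \<gamma>(2) by (simp add: Q_def Ch0_def)
    moreover have "F (z + snd \<beta>) - F (y + snd \<beta>) = L' t"
      using FL'[OF Q_M(1)[OF y(1) yQ] Q_M(1)[OF z(1) zQ]] Q_M(2)[OF y(1) yQ] Q_M(2)[OF z(1) zQ] yQ zQ z(2) \<gamma>(2)
      by (simp add: Q_def Ch1_def)
    ultimately show "L t = L' t" using eq by simp
  qed
qed

text \<open>On each chamber \<open>F - L \<circ> star\<close> is constant, and a chamber is given by the set of planes above it.\<close>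

lemma affine_up_to_finitely_many_values:
  obtains L R' where "Modules.additive L" "continuous_on UNIV L"
    "finite ((\<lambda>x. F x - L (star x)) ` {x \<in> M. off_planes (planes R') (star x)})"
proof -
  obtain R' where R': "R' > 0" "uniform_on_chambers R'" using uniformly_continuous_on_chambers by blast
  define P where "P = planes R'"
  obtain h where "h \<in> interior W" "off_planes P h"
    unfolding P_def by (rule open_meets_off_planes[OF open_interior window_interior_nonempty])
  then have "chamber P h \<inter> interior W \<noteq> {}" "open (chamber P h)"
    using chamber_self[of P h] chamber_open[of P h] finite_planes[of R'] by (auto simp: P_def)
  then obtain x0 where x0: "x0 \<in> M" "star x0 \<in> chamber P h" using dense_in_M by metis
  then have off0: "off_planes P (star x0)" by (simp add: chamber_def)
  obtain L where L: "Modules.additive L" "continuous_on UNIV L"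
    "\<And>x y. x \<in> M \<Longrightarrow> y \<in> M \<Longrightarrow> star x \<in> chamber P (star x0) \<Longrightarrow>
       star y \<in> chamber P (star x0) \<Longrightarrow> F y - F x = L (star y - star x)"
    using affine_on_chamber[OF R' x0(1)] off0 unfolding P_def by metis
  have FL: "F y - F x = L (star y - star x)"
    if xy: "x \<in> M" "y \<in> M" "off_planes P (star x)" "star y \<in> chamber P (star x)" for x y
  proof -
    obtain L' where L': "Modules.additive L'" "continuous_on UNIV L'"
      "\<And>u v. u \<in> M \<Longrightarrow> v \<in> M \<Longrightarrow> star u \<in> chamber P (star x) \<Longrightarrow>
         star v \<in> chamber P (star x) \<Longrightarrow> F v - F u = L' (star v - star u)"
      using affine_on_chamber[OF R' xy(1)] xy(3) unfolding P_def by metis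
    have "L = L'"
      by (rule slopes_agree[OF R'(1) x0(1) off0[unfolded P_def] xy(1) xy(3)[unfolded P_def] L(1,2) L'(1,2)])
        (fact L(3)[unfolded P_def], fact L'(3)[unfolded P_def])
    then show ?thesis using L'(3)[OF xy(1,2) chamber_self[OF xy(3)] xy(4)] by simp
  qed
  have "finite ((\<lambda>x. F x - L (star x)) ` {x \<in> M. off_planes P (star x)})"
  proof (rule finite_image_factor[of "\<lambda>x. {(c, s)\<in>P. c \<bullet> star x < s}"])
    show "finite ((\<lambda>x. {(c, s)\<in>P. c \<bullet> star x < s}) ` {x \<in> M. off_planes P (star x)})"
      by (rule finite_subset[of _ "Pow P"]) (auto simp: P_def finite_planes)
    fix x y assume x: "x \<in> {x \<in> M. off_planes P (star x)}" and y: "y \<in> {x \<in> M. off_planes P (star x)}"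
      and eq: "{(c, s)\<in>P. c \<bullet> star x < s} = {(c, s)\<in>P. c \<bullet> star y < s}"
    have "star y \<in> chamber P (star x)" using y eq by (auto simp: chamber_def separators_def)
    then have "F y - F x = L (star y) - L (star x)"
      using FL[of x y] x y additive.diff[OF L(1)] by simp
    then show "F x - L (star x) = F y - L (star y)" by simp
  qed
  then show ?thesis using that[OF L(1,2)] by (simp add: P_def)
qed

end

section \<open>Cohomology classes of weakly pattern equivariant functions\<close>

lemma spe_diff:
  assumes "spe M G" "spe M K"
  shows "spe M (\<lambda>x. G x - K x :: 'y::ab_group_add)"
proof -
  obtain r s where r: "r > 0" "\<forall>x1\<in>M. \<forall>x2\<in>M. agree r (shift M x1) (shift M x2) \<longrightarrow> G x1 = G x2"
    and s: "s > 0" "\<forall>x1\<in>M. \<forall>x2\<in>M. agree s (shift M x1) (shift M x2) \<longrightarrow> K x1 = K x2"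
    using assms unfolding spe_def by blast
  have "G x - K x = G y - K y" if "x \<in> M" "y \<in> M" "agree (max r s) (shift M x) (shift M y)" for x y
    using r(2) s(2) that agree_mono[OF that(3), of r] agree_mono[OF that(3), of s] by simp
  then show ?thesis unfolding spe_def using r(1) by (intro exI[of _ "max r s"]) auto
qed

lemma edge_restrict_delta_diff:
  "edge_restrict M (delta (\<lambda>x. G x - K x)) =
     (\<lambda>e. edge_restrict M (delta G) e - edge_restrict M (delta K) e)"
  by (auto simp: edge_restrict_def delta_def)

lemma cohomologous_class_subset:
  assumes "spe M K" "\<phi>' \<in> Z1 M" "(\<lambda>e. \<phi>' e - \<phi> e) = edge_restrict M (delta K)"
  shows "cohomologous M `` {\<phi>} \<subseteq> cohomologous M `` {\<phi>'}"
proof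
  fix \<psi> assume "\<psi> \<in> cohomologous M `` {\<phi>}"
  then obtain G where G: "\<psi> \<in> Z1 M" "spe M G" "(\<lambda>e. \<psi> e - \<phi> e) = edge_restrict M (delta G)"
    by (auto simp: cohomologous_def)
  have "(\<lambda>e. \<psi> e - \<phi>' e) = (\<lambda>e. (\<psi> e - \<phi> e) - (\<phi>' e - \<phi> e))" by simp
  also have "\<dots> = edge_restrict M (delta (\<lambda>x. G x - K x))"
    using G(3) assms(3) unfolding edge_restrict_delta_diff by metis
  finally show "\<psi> \<in> cohomologous M `` {\<phi>'}"
    using assms(2) G(1) spe_diff[OF G(2) assms(1)] unfolding cohomologous_def by auto
qed

lemma coh_class_eqI:
  assumes "spe2 M (delta F)" "spe2 M (delta G)" "spe M (\<lambda>x. F x - G x)"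
  shows "coh_class M (delta F) = coh_class M (delta G)"
proof -
  have "spe M (\<lambda>x. G x - F x)" using assms(3) unfolding spe_def by (metis minus_diff_eq)
  then show ?thesis
    unfolding coh_class_def
    using assms(3) cohomologous_class_subset edge_restrict_delta_Z1[OF assms(1)]
      edge_restrict_delta_Z1[OF assms(2)] edge_restrict_delta_diff[symmetric]
    by (intro equalityI) blast+
qed

lemma wpe_diff:
  fixes F G :: "'d::euclidean_space \<Rightarrow> real"
  assumes "wpe M F" "wpe M G"
  shows "wpe M (\<lambda>x. F x - G x)"
proof -
  obtain Ft Gt where "wpe_ext M F Ft" "wpe_ext M G Gt" using assms unfolding wpe_def by blast
  then have "wpe_ext M (\<lambda>x. F x - G x) (\<lambda>N. Ft N - Gt N)"
    unfolding wpe_ext_def by (auto intro!: continuous_intros)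
  then show ?thesis unfolding wpe_def by blast
qed

context model_set
begin

lemma nonslip_star:
  assumes L: "continuous_on UNIV (L :: 'h \<Rightarrow> real)"
  shows "nonslip \<Gamma> W M (L \<circ> star)"
proof -
  define Ft where "Ft N = L (star_map \<Gamma> W N 0)" for N
  have "\<exists>\<delta>>0. \<forall>N'\<in>transversal M. delone_dist N N' < \<delta> \<longrightarrow> Ft N' \<in> U"
    if N: "N \<in> transversal M" and U: "open U" "Ft N \<in> U" for N U
  proof -
    have "open (L -` U)" using U(1) L by (rule open_vimage)
    moreover have "star_map \<Gamma> W N 0 \<in> L -` U" using U(2) by (simp add: Ft_def)
    ultimately obtain e where e: "e > 0" "ball (star_map \<Gamma> W N 0) e \<subseteq> L -` U"
      using open_contains_ball by blast
    obtain \<delta> where \<delta>: "\<delta> > 0" "\<And>N'. N' \<in> transversal M \<Longrightarrow> delone_dist N N' < \<delta> \<Longrightarrow>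
      dist (star_map \<Gamma> W N' 0) (star_map \<Gamma> W N 0) < e"
      using star_map_continuous[OF in_hull N e(1)] by metis
    have "Ft N' \<in> U" if "N' \<in> transversal M" "delone_dist N N' < \<delta>" for N'
    proof -
      have "star_map \<Gamma> W N' 0 \<in> ball (star_map \<Gamma> W N 0) e"
        using \<delta>(2)[OF that] by (simp add: dist_commute)
      then show ?thesis using e(2) by (auto simp: Ft_def)
    qed
    then show ?thesis using \<delta>(1) by blast
  qed
  then have "continuous_map (subtopology delone_topology (transversal M)) euclidean Ft"
    unfolding continuous_map_delone_iff[OF transversal_delone] by auto
  moreover have "(L \<circ> star) x = Ft (shift M x)" if "x \<in> M" for x
    using star_map_shift[OF in_hull that] by (simp add: Ft_def)
  ultimately have "wpe_ext M (L \<circ> star) Ft" unfolding wpe_ext_def by blast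
  moreover have "Ft N = Ft N'" if "pi_max \<Gamma> W N = pi_max \<Gamma> W N'" for N N'
    using that by (simp add: Ft_def star_map_def)
  ultimately show ?thesis unfolding nonslip_def using zero_less_one by blast
qed

lemma spe2_delta_star:
  assumes L: "Modules.additive (L :: 'h \<Rightarrow> real)"
  shows "spe2 M (delta (L \<circ> star))"
proof -
  obtain R where R: "R > 0" "\<And>z. \<exists>x\<in>M. dist z x \<le> R" using delone_M by (auto simp: delone_def)
  have "delta (L \<circ> star) x y = delta (L \<circ> star) x' y'"
    if "x \<in> M" "y \<in> M" "x' \<in> M" "y' \<in> M" "y - x = y' - x'" for x y x' y'
  proof -
    have "star y - star x = star y' - star x'"
      using lattice_snd_inj[OF star_lattice[OF that(1,2)] star_lattice[OF that(3,4)]] that(5) by simp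
    moreover have "delta (L \<circ> star) u v = L (star v - star u)" for u v
      by (simp add: delta_def additive.diff[OF L])
    ultimately show ?thesis by simp
  qed
  moreover have "\<forall>z. \<exists>x\<in>M. dist z x \<le> (3 * R) / 3" using R(2) by simp
  ultimately show ?thesis unfolding spe2_def using zero_less_one by blast
qed

end

context pattern_cocycle
begin

text \<open>The finitely many values of \<open>K\<close> at regular points are all its values, since each point has the pattern of a
  regular one.  Uniform continuity with an error below the gap between these values makes
  \<open>K\<close> depend on a finite pattern.\<close>

lemma spe_minus_linear:
  obtains L where "Modules.additive L" "continuous_on UNIV L" "spe M (\<lambda>x. F x - L (star x))"
proof -
  obtain L R' where L: "Modules.additive L" "continuous_on UNIV L"
    "finite ((\<lambda>x. F x - L (star x)) ` {x \<in> M. off_planes (planes R') (star x)})"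
    using affine_up_to_finitely_many_values by metis
  define K where "K x = F x - L (star x)" for x
  define V where "V = K ` {x \<in> M. off_planes (planes R') (star x)}"
  have V: "finite V" using L(3) by (simp add: V_def K_def)
  have "wpe M (L \<circ> star)" using nonslip_star[OF L(2)] unfolding nonslip_def wpe_def by blast
  then have wpe: "wpe M K" using wpe_diff[OF F_wpe, of "L \<circ> star"] by (simp add: K_def[abs_def] o_def)
  have KV: "K x \<in> V" if x: "x \<in> M" for x
  proof -
    have "\<exists>v\<in>V. dist v (K x) < \<epsilon>" if \<epsilon>: "\<epsilon> > 0" for \<epsilon>
    proof -
      obtain r where r: "\<And>x y. x \<in> M \<Longrightarrow> y \<in> M \<Longrightarrow> agree r (shift M x) (shift M y) \<Longrightarrow> dist (K x) (K y) < \<epsilon>"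
        using wpe_uniform[OF wpe \<epsilon>] by metis
      obtain y where y: "y \<in> M" "agree r (shift M x) (shift M y)" "off_planes (planes R') (star y)"
        by (rule regular_recurrence_off_planes[OF x zero_less_one])
      then show ?thesis using r[OF x y(1,2)] by (intro bexI[of _ "K y"]) (auto simp: V_def dist_commute)
    qed
    then have "K x \<in> closure V" by (simp add: closure_approachable)
    then show ?thesis using V by (simp add: finite_imp_closed)
  qed
  obtain e where e: "e > 0" "\<And>a b. a \<in> V \<Longrightarrow> b \<in> V \<Longrightarrow> \<bar>a - b\<bar> < e \<Longrightarrow> a = b"
    using finite_gap[OF V] by metis
  obtain r where r: "r > 0"
    "\<And>x y. x \<in> M \<Longrightarrow> y \<in> M \<Longrightarrow> agree r (shift M x) (shift M y) \<Longrightarrow> dist (K x) (K y) < e"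
    using wpe_uniform[OF wpe e(1)] by metis
  have "spe M K"
    unfolding spe_def using r e(2) KV by (intro exI[of _ r]) (auto simp: dist_real_def)
  then show ?thesis using that L(1,2) by (simp add: K_def[abs_def])
qed

end

text \<open>With radius \<open>0\<close> the set would be the whole space.\<close>

lemma covering_radius_pos:
  fixes M :: "'d::euclidean_space set"
  assumes "uniform_discrete M" "\<And>z. \<exists>x\<in>M. dist z x \<le> R"
  shows "R > 0"
proof (rule ccontr)
  assume "\<not> R > 0"
  then have "z \<in> M" for z using assms(2)[of z] by (metis dist_le_zero_iff linorder_not_le order_trans)
  moreover obtain e where e: "e > 0" "\<And>x y. x \<in> M \<Longrightarrow> y \<in> M \<Longrightarrow> dist x y < e \<Longrightarrow> x = y"
    using assms(1) unfolding uniform_discrete_def by blast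
  moreover obtain b :: 'd where b: "b \<in> Basis" using nonempty_Basis by blast
  ultimately have "(e / 2) *\<^sub>R b = 0" by (intro e(2)) auto
  then show False using e(1) b by auto
qed

lemma (in planar_model_set) analytic_class_represented:
  assumes F: "wpe M F" "spe2 M (delta F)"
  obtains L where "continuous_on UNIV (L :: 'h \<Rightarrow> real)" "Modules.additive L"
    "coh_class M (delta F) = coh_class M (delta (L \<circ> star))"
proof -
  obtain R0 R where cov: "\<And>z. \<exists>x\<in>M. dist z x \<le> R0 / 3"
    and R: "\<And>x1 y1 x2 y2. \<lbrakk>x1 \<in> M; y1 \<in> M; x2 \<in> M; y2 \<in> M; norm (y1 - x1) \<le> R0;
        norm (y2 - x2) \<le> R0; y1 - x1 = y2 - x2; agree R (shift M x1) (shift M x2)\<rbrakk>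
        \<Longrightarrow> delta F x1 y1 = delta F x2 y2"
    using F(2) unfolding spe2_def by blast
  have pos: "R0 > 0" using covering_radius_pos[OF _ cov] delone_M by (auto simp: delone_def)
  define R1 where "R1 = max R (R0 + 1)"
  interpret pattern_cocycle \<Gamma> W M C B F R0 R1
  proof
    show "0 < R0" "R0 < R1" using pos by (auto simp: R1_def)
    show "\<exists>x\<in>M. dist z x \<le> R0 / 3" for z by (rule cov)
    show "wpe M F" by (rule F(1))
    fix x y x' y'
    assume "x \<in> M" "y \<in> M" "x' \<in> M" "y' \<in> M" "norm (y - x) \<le> R0" "y - x = y' - x'"
      "agree R1 (shift M x) (shift M x')"
    then show "F y - F x = F y' - F x'"
      using R[of x y x' y'] agree_mono[of R1 _ _ R] by (auto simp: delta_def R1_def)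
  qed
  obtain L where L: "Modules.additive L" "continuous_on UNIV L" "spe M (\<lambda>x. F x - L (star x))"
    using spe_minus_linear by metis
  then have "coh_class M (delta F) = coh_class M (delta (L \<circ> star))"
    using F(2) spe2_delta_star[OF L(1)] by (intro coh_class_eqI) auto
  then show ?thesis using that L by blast
qed

theorem theorem1p2:
  fixes \<Gamma> :: "('h::euclidean_space \<times> 'd::euclidean_space) set"
    and W :: "'h set" and M :: "'d set"
  assumes "polyhedral_model_set \<Gamma> W M"
  shows "H1_repr \<Gamma> W M = H1_ns \<Gamma> W M \<and> H1_ns \<Gamma> W M = H1_an M"
proof -
  have A: "cut_and_project_scheme \<Gamma>" "polyhedral_window W" "M \<in> model_hull \<Gamma> W"
    using assms by (auto simp: polyhedral_model_set_def)
  obtain C B where CB: "finite C" "finite (B :: real set)" "0 \<notin> C"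
    "\<And>c c' a b. c \<in> C \<Longrightarrow> c' \<in> C \<Longrightarrow> c \<noteq> c' \<Longrightarrow> a *\<^sub>R c = b *\<^sub>R c' \<Longrightarrow> a = 0"
    "\<And>x. x \<in> frontier W \<Longrightarrow> \<exists>c\<in>C. c \<bullet> x \<in> B"
    by (rule polyhedral_window_planes[OF A(2)]) blast
  interpret planar_model_set \<Gamma> W M C B
  proof
    show "is_window W" using A(2) by (simp add: polyhedral_window_def)
  qed (fact A CB)+
  have "H1_repr \<Gamma> W M \<subseteq> H1_ns \<Gamma> W M"
    unfolding H1_repr_def H1_ns_def using nonslip_star spe2_delta_star by blast
  moreover have "H1_ns \<Gamma> W M \<subseteq> H1_an M" by (rule H1_ns_subset_an)
  moreover have "H1_an M \<subseteq> H1_repr \<Gamma> W M"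
    unfolding H1_an_def H1_repr_def using analytic_class_represented by blast
  ultimately show ?thesis by blast
qed

end
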